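(* Let $m\ge 2$, $\gamma>0$, $u>0$, and let $\delta(\gamma,u)=\sqrt{\frac{\gamma^2(m-1)^2}{u^2}+\frac14}$. For $0\le k\le \lfloor\frac m2-1\rfloor$ set $\delta_k=k+\lceil\frac m2\rceil-\frac m2$ (so $\delta_k=k$ if $m$ is even and $\delta_k=k+\frac12$ if $m$ is odd), and set $\delta_{\lfloor m/2\rfloor}=\infty$. Then the bulk-difference invariant $\mathrm{BDI}(\gamma,u)$ (defined in the context whenever $\delta(\gamma,u)\notin\{\delta_k\}$) takes exactly $\lfloor\frac m2\rfloor$ distinct values (quantum anomalous Hall phases), namely $$\mathrm{BDI}(\gamma,u)=\mathrm{BDI}_j:=\frac{m^2}{2}-2\delta_j(\delta_j+1)\quad\text{whenever}\quad \delta_j<\delta(\gamma,u)<\delta_{j+1},$$ for $0\le j\le\lfloor\frac m2-1\rfloor$.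
   Context: Let $\sigma_1,\sigma_2$ be the standard Pauli matrices and $A=\begin{pmatrix}0&0\\1&0\end{pmatrix}$. For a real number $v$ and $\kappa=k_x+ik_y\in\mathbb C\cong\mathbb R^2$, let $\hat H(\kappa;v)$ be the $2m\times 2m$ Hermitian matrix written in $m\times m$ blocks of size $2\times2$ whose $j$-th diagonal block is $u_jI_2+\begin{pmatrix}0&\bar\kappa\\ \kappa&0\end{pmatrix}$ with $u_j=\frac{v}{m-1}\big(j-\frac{m+1}{2}\big)$, whose $(j,j+1)$ block is $\gamma A$ and whose $(j+1,j)$ block is $\gamma A^*$ for $1\le j\le m-1$, all other blocks zero (valley index $+1$, AB stacking). Set $\hat H^N(\kappa)=\hat H(\kappa;u)$ and $\hat H^S(\kappa)=\hat H(\kappa;-u)$. When $\delta(\gamma,u)$ differs from all $\delta_k$, $0$ is not an eigenvalue of $\hat H^h(\kappa)$ for any $\kappa\in\mathbb R^2$, $h\in\{N,S\}$, and one defines the projector $\Pi^h(\kappa)$ onto the span of the eigenvectors of $\hat H^h(\kappa)$ with negative eigenvalues. For a smooth family of projectors $\Pi$ on $\mathbb R^2$ put $\mathcal C[\Pi]=\frac{i}{2\pi}\int_{\mathbb R^2}\mathrm{tr}\,\Pi\, d\Pi\wedge d\Pi$, with $d\Pi=\partial_{k_x}\Pi\,dk_x+\partial_{k_y}\Pi\,dk_y$. The bulk-difference invariant is $\mathrm{BDI}(\gamma,u)=\mathcal C[\Pi^S]-\mathcal C[\Pi^N]$. *)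

theory Defs
  imports "HOL-Analysis.Analysis" "Jordan_Normal_Form.Schur_Decomposition"
begin

text \<open>The 2m x 2m Hamiltonian (valley +1, AB stacking), rows/columns indexed 0..2m-1;
  index r belongs to block r div 2 (0-based) and position r mod 2 inside the block.
  The wave vector kappa = kx + i ky is a complex number.\<close>
definition Hmat :: "nat \<Rightarrow> real \<Rightarrow> real \<Rightarrow> complex \<Rightarrow> complex mat" where
  "Hmat m \<gamma> v \<kappa> = mat (2*m) (2*m) (\<lambda>(r,c).
     let b = r div 2; b' = c div 2; a = r mod 2; a' = c mod 2 in
     if b = b' then
       (if a = a' then complex_of_real (v / (real m - 1) * (real (b+1) - (real m + 1) / 2))
        else if a = 0 then cnj \<kappa> else \<kappa>)
     else if b' = b + 1 \<and> a = 1 \<and> a' = 0 then complex_of_real \<gamma>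
     else if b = b' + 1 \<and> a = 0 \<and> a' = 1 then complex_of_real \<gamma>
     else 0)"

definition neg_eig_span :: "complex mat \<Rightarrow> complex vec set" where
  "neg_eig_span H = LinearCombinations.module.span class_ring (module_vec TYPE(complex) (dim_row H))
      {w. \<exists>e. eigenvector H w e \<and> e \<in> \<real> \<and> Re e < 0}"

definition neg_proj :: "complex mat \<Rightarrow> complex mat" where
  "neg_proj H = (THE P. P \<in> carrier_mat (dim_row H) (dim_row H) \<and> P * P = P \<and> mat_adjoint P = P
      \<and> {w \<in> carrier_vec (dim_row H). P *\<^sub>v w = w} = neg_eig_span H)"

text \<open>Entrywise directional derivative of an n x n matrix family at kappa in direction d
  (d = 1 gives the k_x derivative, d = i gives the k_y derivative).\<close>
definition mat_dderiv :: "nat \<Rightarrow> (complex \<Rightarrow> complex mat) \<Rightarrow> complex \<Rightarrow> complex \<Rightarrow> complex mat" where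
  "mat_dderiv n P \<kappa> d = mat n n (\<lambda>(i,j).
      vector_derivative (\<lambda>t::real. P (\<kappa> + complex_of_real t * d) $$ (i,j)) (at 0))"

definition mtrace :: "complex mat \<Rightarrow> complex" where
  "mtrace A = (\<Sum>i<dim_row A. A $$ (i,i))"

text \<open>C[P] = i/(2 pi) integral over R^2 of tr P dP wedge dP
  = i/(2 pi) integral of tr(P (P_x P_y - P_y P_x)) dkx dky.\<close>
definition chern :: "nat \<Rightarrow> (complex \<Rightarrow> complex mat) \<Rightarrow> complex" where
  "chern n P = \<i> / (2 * complex_of_real pi) *
     integral UNIV (\<lambda>\<kappa>. mtrace (P \<kappa> * (mat_dderiv n P \<kappa> 1 * mat_dderiv n P \<kappa> \<i>
                                         - mat_dderiv n P \<kappa> \<i> * mat_dderiv n P \<kappa> 1)))"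

definition BDI :: "nat \<Rightarrow> real \<Rightarrow> real \<Rightarrow> complex" where
  "BDI m \<gamma> u = chern (2*m) (\<lambda>\<kappa>. neg_proj (Hmat m \<gamma> (-u) \<kappa>))
              - chern (2*m) (\<lambda>\<kappa>. neg_proj (Hmat m \<gamma> u \<kappa>))"

definition delta :: "nat \<Rightarrow> real \<Rightarrow> real \<Rightarrow> real" where
  "delta m \<gamma> u = sqrt (\<gamma>^2 * (real m - 1)^2 / u^2 + 1/4)"

definition delta_k :: "nat \<Rightarrow> nat \<Rightarrow> real" where
  "delta_k m k = real k + real_of_int \<lceil>real m / 2\<rceil> - real m / 2"

definition BDI_val :: "nat \<Rightarrow> nat \<Rightarrow> real" where
  "BDI_val m j = (real m)^2 / 2 - 2 * delta_k m j * (delta_k m j + 1)"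

end

theory Submission
  imports Defs "Jordan_Normal_Form.Spectral_Radius"
begin

text \<open>
  Let \<open>N\<close> be the diagonal matrix with entries \<open>(a + 1) div 2\<close>. Conjugation with \<open>exp (\<i> * \<theta> * N)\<close>
  rotates \<open>\<kappa>\<close>, so \<open>tr (N * \<Pi>)\<close> is a function \<open>G\<close> of \<open>r = |\<kappa>|\<close>, and the angular derivative of
  \<open>\<Pi>\<close> is \<open>\<i> * (N * \<Pi> - \<Pi> * N)\<close>. Hence the curvature \<open>tr (\<Pi> * [\<Pi>_x, \<Pi>_y])\<close> equals
  \<open>\<i> * G'(r) / r\<close>, and the Chern integral is \<open>G(0) - G(\<infinity>)\<close>. At infinity the in-plane part dominates
  and \<open>G(\<infinity>) = m^2 / 2\<close>; at \<open>\<kappa> = 0\<close> the Hamiltonian splits into blocks of size at most two on which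
  \<open>N\<close> is constant, so \<open>G(0)\<close> counts the negative block eigenvalues with weights. Changing the sign of
  \<open>v\<close> replaces \<open>G(0)\<close> by \<open>m^2 - G(0)\<close>.

  The gap closes only at \<open>\<kappa> = 0\<close>. Differentiability of the spectral projector and all bounds come
  from the Davis--Kahan comparison of two eigenbases.
\<close>

unbundle no vec_syntax

section \<open>Adjoints, traces and unitary conjugation\<close>

lemma mult_carrier_square [simp]:
  "A \<in> carrier_mat n n \<Longrightarrow> B \<in> carrier_mat n n \<Longrightarrow> A * B \<in> carrier_mat n n"
  by simp

lemma minus_carrier_square [simp]:
  "B \<in> carrier_mat n n \<Longrightarrow> A - B \<in> carrier_mat n n"
  by (rule minus_carrier_mat)

lemma carrier_eq_matI:
  assumes "A \<in> carrier_mat n k" "B \<in> carrier_mat n k" "\<And>i j. i < n \<Longrightarrow> j < k \<Longrightarrow> A $$ (i,j) = B $$ (i,j)"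
  shows "A = B"
  using assms by (intro eq_matI) auto

lemma mult_mat_vec_carrier_square [simp]:
  "A \<in> carrier_mat n n \<Longrightarrow> w \<in> carrier_vec n \<Longrightarrow> A *\<^sub>v w \<in> carrier_vec n"
  by (rule mult_mat_vec_carrier)

lemma mult_mat_index_sum:
  assumes "A \<in> carrier_mat n k" "B \<in> carrier_mat k l" "i < n" "j < l"
  shows "(A * B) $$ (i,j) = (\<Sum>x<k. A $$ (i,x) * B $$ (x,j))"
  using assms by (auto simp: scalar_prod_def atLeast0LessThan intro!: sum.cong)

lemma mult_mat_vec_index_sum:
  assumes "A \<in> carrier_mat n k" "w \<in> carrier_vec k" "i < n"
  shows "(A *\<^sub>v w) $ i = (\<Sum>x<k. A $$ (i,x) * w $ x)"
  using assms by (auto simp: scalar_prod_def atLeast0LessThan intro!: sum.cong)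

lemma mult3_mat_index_sum:
  assumes X: "X \<in> carrier_mat n n" and Y: "Y \<in> carrier_mat n n" and Z: "Z \<in> carrier_mat n n"
    and ij: "i < n" "j < n"
  shows "(X * Y * Z) $$ (i,j) = (\<Sum>a<n. \<Sum>b<n. X $$ (i,a) * Y $$ (a,b) * Z $$ (b,j))"
proof -
  have "(X * Y * Z) $$ (i,j) = (\<Sum>b<n. (X * Y) $$ (i,b) * Z $$ (b,j))"
    using assms by (intro mult_mat_index_sum) auto
  also have "\<dots> = (\<Sum>b<n. \<Sum>a<n. X $$ (i,a) * Y $$ (a,b) * Z $$ (b,j))"
    using ij by (simp add: mult_mat_index_sum[OF X Y] sum_distrib_right del: index_mult_mat(1))
  also have "\<dots> = (\<Sum>a<n. \<Sum>b<n. X $$ (i,a) * Y $$ (a,b) * Z $$ (b,j))"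
    by (rule sum.swap)
  finally show ?thesis .
qed

lemma mat_diag_dims [simp]: "dim_row (mat_diag n f) = n" "dim_col (mat_diag n f) = n"
  by (simp_all add: mat_diag_def)

lemma mat_diag_index [simp]:
  "i < n \<Longrightarrow> j < n \<Longrightarrow> mat_diag n f $$ (i,j) = (if i = j then f j else 0)"
  by (simp add: mat_diag_def)

lemma mat_diag_mult_vec_index:
  assumes "w \<in> carrier_vec n" "i < n"
  shows "(mat_diag n f *\<^sub>v w) $ i = f i * w $ i"
  unfolding mult_mat_vec_index_sum[OF mat_diag_dim assms]
  using assms by (subst sum.remove[of _ i]) auto

lemma mat_diag_commutator_index:
  fixes A :: "'a :: comm_ring_1 mat"
  assumes "A \<in> carrier_mat n n" "i < n" "j < n"
  shows "(mat_diag n f * A - A * mat_diag n f) $$ (i,j) = (f i - f j) * A $$ (i,j)"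
  using assms by (simp add: mat_diag_mult_left[of _ n n] mat_diag_mult_right[of _ n n] algebra_simps)

lemma mat_adjoint_carrier [simp]:
  "A \<in> carrier_mat n k \<Longrightarrow> mat_adjoint A \<in> carrier_mat k n"
  by (auto simp: mat_adjoint_def mat_of_rows_def)

lemma mat_adjoint_dim [simp]:
  "dim_row (mat_adjoint A) = dim_col A" "dim_col (mat_adjoint A) = dim_row A"
  by (auto simp: mat_adjoint_def)

lemma mat_adjoint_index [simp]:
  "i < dim_col A \<Longrightarrow> j < dim_row A \<Longrightarrow> mat_adjoint A $$ (i,j) = conjugate (A $$ (j,i))"
  by (simp add: mat_adjoint_def mat_of_rows_index cols_nth)

lemma mat_adjoint_adjoint [simp]: "mat_adjoint (mat_adjoint A) = A"
  by (rule eq_matI) auto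

lemma mat_adjoint_one [simp]: "mat_adjoint (1\<^sub>m n :: complex mat) = 1\<^sub>m n"
  by (rule eq_matI) auto

lemma mat_adjoint_mult:
  fixes A B :: "complex mat"
  assumes "A \<in> carrier_mat n k" "B \<in> carrier_mat k l"
  shows "mat_adjoint (A * B) = mat_adjoint B * mat_adjoint A"
proof (rule carrier_eq_matI[of _ l n])
  show "mat_adjoint (A * B) \<in> carrier_mat l n" "mat_adjoint B * mat_adjoint A \<in> carrier_mat l n"
    using assms by (auto intro: mult_carrier_mat[of _ l k])
  fix i j assume ij: "i < l" "j < n"
  have "mat_adjoint (A * B) $$ (i,j) = (\<Sum>x<k. cnj (A $$ (j,x) * B $$ (x,i)))"
    using assms ij by (simp add: mult_mat_index_sum[OF assms] del: index_mult_mat(1))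
  also have "\<dots> = (\<Sum>x<k. mat_adjoint B $$ (i,x) * mat_adjoint A $$ (x,j))"
    using assms ij by (intro sum.cong) auto
  also have "\<dots> = (mat_adjoint B * mat_adjoint A) $$ (i,j)"
    using assms ij by (intro mult_mat_index_sum[symmetric]) auto
  finally show "mat_adjoint (A * B) $$ (i,j) = (mat_adjoint B * mat_adjoint A) $$ (i,j)" .
qed

lemma mat_adjoint_mat_diag: "mat_adjoint (mat_diag n f) = mat_diag n (\<lambda>i. conjugate (f i))"
  by (rule eq_matI) (auto simp: mat_diag_def)

lemma mat_adjoint_four_block:
  assumes "A \<in> carrier_mat k l" "B \<in> carrier_mat k l'" "C \<in> carrier_mat k' l" "D \<in> carrier_mat k' l'"
  shows "mat_adjoint (four_block_mat A B C D)
    = four_block_mat (mat_adjoint A) (mat_adjoint C) (mat_adjoint B) (mat_adjoint D)"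
  by (rule eq_matI) (use assms in auto)

lemma mtrace_zero [simp]: "mtrace (0\<^sub>m n n) = 0"
  by (simp add: mtrace_def)

lemma mtrace_add:
  "A \<in> carrier_mat n n \<Longrightarrow> B \<in> carrier_mat n n \<Longrightarrow> mtrace (A + B) = mtrace A + mtrace B"
  by (auto simp: mtrace_def sum.distrib)

lemma mtrace_minus:
  "A \<in> carrier_mat n n \<Longrightarrow> B \<in> carrier_mat n n \<Longrightarrow> mtrace (A - B) = mtrace A - mtrace B"
  by (auto simp: mtrace_def sum_subtractf)

lemma mtrace_smult: "A \<in> carrier_mat n n \<Longrightarrow> mtrace (c \<cdot>\<^sub>m A) = c * mtrace A"
  by (auto simp: mtrace_def sum_distrib_left)

lemma mtrace_mult_comm:
  assumes "A \<in> carrier_mat n k" "B \<in> carrier_mat k n"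
  shows "mtrace (A * B) = mtrace (B * A)"
proof -
  have "mtrace (A * B) = (\<Sum>i<n. \<Sum>j<k. A $$ (i,j) * B $$ (j,i))"
    using assms by (simp add: mtrace_def mult_mat_index_sum[OF assms] del: index_mult_mat(1))
  also have "\<dots> = (\<Sum>j<k. \<Sum>i<n. B $$ (j,i) * A $$ (i,j))"
    by (subst sum.swap) (simp add: mult.commute)
  also have "\<dots> = mtrace (B * A)"
    using assms by (simp add: mtrace_def mult_mat_index_sum[OF assms(2,1)] del: index_mult_mat(1))
  finally show ?thesis .
qed

lemma mtrace_mat_diag_mult:
  assumes "X \<in> carrier_mat n n"
  shows "mtrace (mat_diag n f * X) = (\<Sum>i<n. f i * X $$ (i,i))"
  using assms by (simp add: mtrace_def mat_diag_mult_left[of _ n n])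

definition hermitian :: "nat \<Rightarrow> complex mat \<Rightarrow> bool" where
  "hermitian n A \<longleftrightarrow> A \<in> carrier_mat n n \<and> mat_adjoint A = A"

lemma hermitian_carrier: "hermitian n A \<Longrightarrow> A \<in> carrier_mat n n"
  by (simp add: hermitian_def)

lemma hermitian_iff_index:
  "hermitian n A \<longleftrightarrow> A \<in> carrier_mat n n \<and> (\<forall>i<n. \<forall>j<n. cnj (A $$ (j,i)) = A $$ (i,j))"
proof -
  have "mat_adjoint A = A \<longleftrightarrow> (\<forall>i<n. \<forall>j<n. mat_adjoint A $$ (i,j) = A $$ (i,j))"
    if "A \<in> carrier_mat n n"
    using that by (auto intro!: eq_matI simp del: mat_adjoint_index)
  thus ?thesis by (auto simp: hermitian_def)
qed

lemma hermitian_add_smult: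
  "hermitian n A \<Longrightarrow> hermitian n B \<Longrightarrow> hermitian n (A + complex_of_real t \<cdot>\<^sub>m B)"
  by (auto simp: hermitian_iff_index)

lemma hermitian_mat_diag: "(\<And>i. i < n \<Longrightarrow> cnj (f i) = f i) \<Longrightarrow> hermitian n (mat_diag n f)"
  by (auto simp: hermitian_iff_index)

definition unitary :: "nat \<Rightarrow> complex mat \<Rightarrow> bool" where
  "unitary n U \<longleftrightarrow> U \<in> carrier_mat n n \<and> mat_adjoint U * U = 1\<^sub>m n"

lemma unitary_carrier: "unitary n U \<Longrightarrow> U \<in> carrier_mat n n"
  by (simp add: unitary_def)

lemma unitary_adjoint_mult: "unitary n U \<Longrightarrow> mat_adjoint U * U = 1\<^sub>m n"
  by (simp add: unitary_def)

lemma unitary_mult_adjoint: "unitary n U \<Longrightarrow> U * mat_adjoint U = 1\<^sub>m n"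
  unfolding unitary_def by (rule mat_mult_left_right_inverse[of _ n]) auto

lemma unitary_adjoint: "unitary n U \<Longrightarrow> unitary n (mat_adjoint U)"
  using unitary_mult_adjoint[of n U] by (simp add: unitary_def)

lemma unitary_cancel_left:
  assumes "unitary n U" "X \<in> carrier_mat n n"
  shows "mat_adjoint U * (U * X) = X"
proof -
  have "mat_adjoint U * (U * X) = (mat_adjoint U * U) * X"
    using assms unitary_carrier[OF assms(1)] by (simp add: assoc_mult_mat[of _ n n _ n _ n])
  thus ?thesis using assms by (simp add: unitary_adjoint_mult)
qed

lemma unitary_mult:
  assumes "unitary n U" "unitary n W"
  shows "unitary n (U * W)"
  using assms unitary_carrier[OF assms(1)] unitary_carrier[OF assms(2)]
  by (simp add: unitary_def mat_adjoint_mult[of _ n n _ n] assoc_mult_mat[of _ n n _ n _ n]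
      unitary_cancel_left[OF assms(1)])

lemma unitary_mat_diag:
  assumes "\<And>i. i < n \<Longrightarrow> cmod (f i) = 1"
  shows "unitary n (mat_diag n f)"
proof -
  have "mat_adjoint (mat_diag n f) * mat_diag n f = 1\<^sub>m n"
    unfolding mat_adjoint_mat_diag mat_diag_diag using assms
    by (intro eq_matI) (auto simp: mat_diag_def mult.commute simp flip: complex_norm_square)
  thus ?thesis by (simp add: unitary_def)
qed

lemma unitary_row_orthonormal:
  assumes "unitary n U" "a < n" "b < n"
  shows "(\<Sum>i<n. U $$ (a,i) * cnj (U $$ (b,i))) = of_bool (a = b)"
proof -
  note U = unitary_carrier[OF assms(1)]
  have "(\<Sum>i<n. U $$ (a,i) * cnj (U $$ (b,i))) = (\<Sum>i<n. U $$ (a,i) * mat_adjoint U $$ (i,b))"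
    using U assms by (intro sum.cong) auto
  also have "\<dots> = (U * mat_adjoint U) $$ (a,b)"
    using U assms by (intro mult_mat_index_sum[symmetric]) auto
  finally show ?thesis using assms by (simp add: unitary_mult_adjoint)
qed

lemma unitary_row_norm:
  assumes "unitary n U" "a < n"
  shows "(\<Sum>i<n. (cmod (U $$ (a,i)))\<^sup>2) = 1"
proof -
  have "complex_of_real (\<Sum>i<n. (cmod (U $$ (a,i)))\<^sup>2) = complex_of_real 1"
    using unitary_row_orthonormal[OF assms assms(2)] by (simp flip: complex_norm_square)
  thus ?thesis unfolding of_real_eq_iff .
qed

lemma unitary_col_norm:
  assumes "unitary n U" "i < n"
  shows "(\<Sum>a<n. (cmod (U $$ (a,i)))\<^sup>2) = 1"
  using unitary_row_norm[OF unitary_adjoint[OF assms(1)] assms(2)] unitary_carrier[OF assms(1)] assms(2)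
  by simp

lemma unitary_entry_le_1:
  assumes "unitary n U" "a < n" "i < n"
  shows "cmod (U $$ (a,i)) \<le> 1"
proof -
  have "(cmod (U $$ (a,i)))\<^sup>2 \<le> (\<Sum>i<n. (cmod (U $$ (a,i)))\<^sup>2)"
    using assms by (intro member_le_sum) auto
  thus ?thesis using unitary_row_norm[OF assms(1,2)] by (simp add: power_le_one_iff)
qed

definition conj_mat :: "complex mat \<Rightarrow> complex mat \<Rightarrow> complex mat" where
  "conj_mat U X = U * X * mat_adjoint U"

lemma conj_mat_carrier [simp]:
  "U \<in> carrier_mat n n \<Longrightarrow> X \<in> carrier_mat n n \<Longrightarrow> conj_mat U X \<in> carrier_mat n n"
  by (simp add: conj_mat_def)

lemma conj_mat_add:
  assumes "U \<in> carrier_mat n n" "X \<in> carrier_mat n n" "Y \<in> carrier_mat n n"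
  shows "conj_mat U (X + Y) = conj_mat U X + conj_mat U Y"
  using assms by (simp add: conj_mat_def mult_add_distrib_mat[of _ n n _ n]
      add_mult_distrib_mat[of _ n n _ _ n])

lemma conj_mat_minus:
  assumes "U \<in> carrier_mat n n" "X \<in> carrier_mat n n" "Y \<in> carrier_mat n n"
  shows "conj_mat U (X - Y) = conj_mat U X - conj_mat U Y"
  using assms by (simp add: conj_mat_def mult_minus_distrib_mat[of _ n n _ n]
      minus_mult_distrib_mat[of _ n n _ _ n])

lemma conj_mat_smult:
  assumes "U \<in> carrier_mat n n" "X \<in> carrier_mat n n"
  shows "conj_mat U (c \<cdot>\<^sub>m X) = c \<cdot>\<^sub>m conj_mat U X"
  using assms by (simp add: conj_mat_def mult_smult_distrib[of _ n n _ n] mult_smult_assoc_mat[of _ n n _ n])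

lemma conj_mat_mult:
  assumes "unitary n U" "X \<in> carrier_mat n n" "Y \<in> carrier_mat n n"
  shows "conj_mat U (X * Y) = conj_mat U X * conj_mat U Y"
  using assms unitary_carrier[OF assms(1)]
  by (simp add: conj_mat_def assoc_mult_mat[of _ n n _ n _ n] unitary_cancel_left[OF assms(1)])

lemma conj_mat_adjoint:
  assumes "U \<in> carrier_mat n n" "X \<in> carrier_mat n n"
  shows "mat_adjoint (conj_mat U X) = conj_mat U (mat_adjoint X)"
  using assms by (simp add: conj_mat_def mat_adjoint_mult[of _ n n _ n] assoc_mult_mat[of _ n n _ n _ n])

lemma hermitian_conj_mat: "hermitian n X \<Longrightarrow> U \<in> carrier_mat n n \<Longrightarrow> hermitian n (conj_mat U X)"
  by (simp add: hermitian_def conj_mat_adjoint[of _ n])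

lemma conj_mat_conj_mat:
  assumes "U \<in> carrier_mat n n" "W \<in> carrier_mat n n" "X \<in> carrier_mat n n"
  shows "conj_mat U (conj_mat W X) = conj_mat (U * W) X"
  using assms by (simp add: conj_mat_def mat_adjoint_mult[of _ n n _ n] assoc_mult_mat[of _ n n _ n _ n])

lemma conj_mat_one: "unitary n U \<Longrightarrow> conj_mat U (1\<^sub>m n) = 1\<^sub>m n"
  using unitary_carrier[of n U] unitary_mult_adjoint[of n U] by (simp add: conj_mat_def)

lemma conj_one_mat: "X \<in> carrier_mat n n \<Longrightarrow> conj_mat (1\<^sub>m n) X = X"
  by (simp add: conj_mat_def)

lemma conj_mat_adjoint_cancel:
  assumes "unitary n U" "X \<in> carrier_mat n n"
  shows "conj_mat U (conj_mat (mat_adjoint U) X) = X"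
  using assms unitary_carrier[OF assms(1)]
  by (simp add: conj_mat_conj_mat[of _ n] unitary_mult_adjoint conj_one_mat)

lemma conj_adjoint_mat_cancel:
  assumes "unitary n U" "X \<in> carrier_mat n n"
  shows "conj_mat (mat_adjoint U) (conj_mat U X) = X"
  using conj_mat_adjoint_cancel[OF unitary_adjoint[OF assms(1)] assms(2)] by simp

lemma mtrace_conj_mat:
  assumes "unitary n U" "X \<in> carrier_mat n n"
  shows "mtrace (conj_mat U X) = mtrace X"
proof -
  have "mtrace (conj_mat U X) = mtrace (mat_adjoint U * (U * X))"
    unfolding conj_mat_def using assms unitary_carrier[OF assms(1)] by (intro mtrace_mult_comm) auto
  thus ?thesis using assms by (simp add: unitary_cancel_left)
qed

lemma conj_mat_index:
  assumes "U \<in> carrier_mat n n" "X \<in> carrier_mat n n" "i < n" "j < n"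
  shows "conj_mat U X $$ (i,j) = (\<Sum>a<n. \<Sum>b<n. U $$ (i,a) * X $$ (a,b) * cnj (U $$ (j,b)))"
  unfolding conj_mat_def using assms by (subst mult3_mat_index_sum[of _ n]) auto

lemma conj_mat_diag_index:
  assumes "X \<in> carrier_mat n n" "i < n" "j < n"
  shows "conj_mat (mat_diag n f) X $$ (i,j) = f i * X $$ (i,j) * cnj (f j)"
  using assms by (simp add: conj_mat_def mat_adjoint_mat_diag mat_diag_mult_left[of _ n n]
      mat_diag_mult_right[of _ n n])

lemma conj_mat_mat_diag_index:
  assumes "U \<in> carrier_mat n n" "i < n" "j < n"
  shows "conj_mat U (mat_diag n f) $$ (i,j) = (\<Sum>k<n. f k * (U $$ (i,k) * cnj (U $$ (j,k))))"
proof -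
  have "conj_mat U (mat_diag n f) $$ (i,j) = (\<Sum>k<n. (U * mat_diag n f) $$ (i,k) * mat_adjoint U $$ (k,j))"
    unfolding conj_mat_def using assms by (intro mult_mat_index_sum) auto
  also have "\<dots> = (\<Sum>k<n. f k * (U $$ (i,k) * cnj (U $$ (j,k))))"
    using assms by (intro sum.cong) (auto simp: mat_diag_mult_right[of _ n n])
  finally show ?thesis .
qed

section \<open>The spectral theorem\<close>

abbreviation real_diag :: "nat \<Rightarrow> (nat \<Rightarrow> real) \<Rightarrow> complex mat" where
  "real_diag n l \<equiv> mat_diag n (\<lambda>i. complex_of_real (l i))"

abbreviation neg_diag :: "nat \<Rightarrow> (nat \<Rightarrow> real) \<Rightarrow> complex mat" where
  "neg_diag n l \<equiv> mat_diag n (\<lambda>i. of_bool (l i < 0))"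

definition spectral_decomp :: "nat \<Rightarrow> complex mat \<Rightarrow> complex mat \<Rightarrow> (nat \<Rightarrow> real) \<Rightarrow> bool" where
  "spectral_decomp n A U l \<longleftrightarrow> unitary n U \<and> A = conj_mat U (real_diag n l)"

lemma spectral_decomp_unitary: "spectral_decomp n A U l \<Longrightarrow> unitary n U"
  by (simp add: spectral_decomp_def)

lemma spectral_decomp_carrier: "spectral_decomp n A U l \<Longrightarrow> A \<in> carrier_mat n n"
  by (auto simp: spectral_decomp_def unitary_carrier)

lemma spectral_decomp_conj_adjoint:
  "spectral_decomp n A U l \<Longrightarrow> conj_mat (mat_adjoint U) A = real_diag n l"
  by (auto simp: spectral_decomp_def conj_adjoint_mat_cancel)

lemma spectral_decomp_conj:
  assumes "spectral_decomp n A U l" "unitary n W"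
  shows "spectral_decomp n (conj_mat W A) (W * U) l"
  using assms unitary_mult[of n W U]
  by (auto simp: spectral_decomp_def unitary_carrier conj_mat_conj_mat[of _ n])

lemma spectral_decompI:
  assumes U: "unitary n U" and A: "A \<in> carrier_mat n n" and AU: "A * U = U * real_diag n l"
  shows "spectral_decomp n A U l"
proof -
  have "A = A * (U * mat_adjoint U)" using A unitary_mult_adjoint[OF U] by simp
  also have "\<dots> = conj_mat U (real_diag n l)"
    unfolding conj_mat_def AU[symmetric]
    using A unitary_carrier[OF U] by (simp add: assoc_mult_mat[of _ n n _ n _ n])
  finally show ?thesis using U by (simp add: spectral_decomp_def)
qed

lemma spectral_decomp_four_block:
  assumes A: "spectral_decomp k A U l" and B: "spectral_decomp k' B W l'"
  shows "spectral_decomp (k + k') (four_block_mat A (0\<^sub>m k k') (0\<^sub>m k' k) B)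
    (four_block_mat U (0\<^sub>m k k') (0\<^sub>m k' k) W) (\<lambda>i. if i < k then l i else l' (i - k))"
proof -
  let ?V = "four_block_mat U (0\<^sub>m k k') (0\<^sub>m k' k) W"
  have U: "U \<in> carrier_mat k k" "unitary k U" "dim_row U = k" "dim_col U = k"
    and W: "W \<in> carrier_mat k' k'" "unitary k' W" "dim_row W = k'" "dim_col W = k'"
    using A B by (auto simp: spectral_decomp_def dest: unitary_carrier)
  have adj: "mat_adjoint ?V = four_block_mat (mat_adjoint U) (0\<^sub>m k k') (0\<^sub>m k' k) (mat_adjoint W)"
  proof -
    have "mat_adjoint (0\<^sub>m i j :: complex mat) = 0\<^sub>m j i" for i j by (rule eq_matI) auto
    thus ?thesis using U W by (simp add: mat_adjoint_four_block[of _ k k _ k' _ k'])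
  qed
  have "unitary (k + k') ?V"
    using U W unfolding unitary_def adj
    by (simp add: mult_four_block_mat[of _ k k _ k' _ k' _ _ k _ k'])
  moreover have "real_diag (k + k') (\<lambda>i. if i < k then l i else l' (i - k))
      = four_block_mat (real_diag k l) (0\<^sub>m k k') (0\<^sub>m k' k) (real_diag k' l')"
    by (rule eq_matI) (auto simp: mat_diag_def)
  ultimately show ?thesis
    using A B U W unfolding spectral_decomp_def conj_mat_def adj
    by (simp add: mult_four_block_mat[of _ k k _ k' _ k' _ _ k _ k'])
qed

lemma unitary_normalised_cols:
  assumes A: "A \<in> carrier_mat n n" and orth: "corthogonal_mat A"
  obtains s :: "nat \<Rightarrow> complex" where "unitary n (A * mat_diag n s)"
proof
  define B where "B = mat_adjoint A * A"
  define s where "s i = complex_of_real (1 / sqrt (Re (B $$ (i,i))))" for i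
  have B: "B \<in> carrier_mat n n" using A by (simp add: B_def)
  have offdiag: "B $$ (i,j) = 0" if "i < n" "j < n" "i \<noteq> j" for i j
    using orth that B A by (auto simp: corthogonal_mat_def Let_def diagonal_mat_def B_def)
  have diag: "s i * B $$ (i,i) * s i = 1" if i: "i < n" for i
  proof -
    define r where "r = (\<Sum>a<n. (cmod (A $$ (a,i)))\<^sup>2)"
    have "B $$ (i,i) = (\<Sum>a<n. mat_adjoint A $$ (i,a) * A $$ (a,i))"
      unfolding B_def using A i by (intro mult_mat_index_sum) auto
    also have "\<dots> = complex_of_real r"
      unfolding r_def using A i by (auto simp: mult.commute simp flip: complex_norm_square intro!: sum.cong)
    finally have B_real: "B $$ (i,i) = complex_of_real r" .
    moreover have "B $$ (i,i) \<noteq> 0" using orth i A by (auto simp: corthogonal_mat_def Let_def B_def)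
    moreover have "r \<ge> 0" by (simp add: r_def sum_nonneg)
    ultimately have "r > 0" by auto
    hence "1 / sqrt r * r * (1 / sqrt r) = 1" by (simp add: field_simps)
    thus ?thesis unfolding s_def B_real by (metis Re_complex_of_real of_real_mult of_real_1)
  qed
  have "mat_adjoint (mat_diag n s) = mat_diag n s" by (simp add: mat_adjoint_mat_diag s_def[abs_def])
  hence "mat_adjoint (A * mat_diag n s) * (A * mat_diag n s) = mat_diag n s * B * mat_diag n s"
    using A by (simp add: B_def mat_adjoint_mult[of _ n n _ n] assoc_mult_mat[of _ n n _ n _ n])
  also have "\<dots> = 1\<^sub>m n"
    using B offdiag diag
    by (intro eq_matI) (auto simp: mat_diag_mult_left[of _ n n] mat_diag_mult_right[of _ n n])
  finally show "unitary n (A * mat_diag n s)" using A by (simp add: unitary_def)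
qed

lemma unitary_completion:
  fixes v :: "complex vec"
  assumes v: "v \<in> carrier_vec n" "v \<noteq> 0\<^sub>v n"
  obtains W c where "unitary n W" "col W 0 = c \<cdot>\<^sub>v v" "n > 0"
proof -
  interpret cof_vec_space n "TYPE(complex)" .
  have n_pos: "n > 0" using v by (metis gr0I carrier_vecD eq_vecI index_zero_vec(2) not_less_zero)
  define b where "b = basis_completion v"
  define ws where "ws = gram_schmidt n b"
  have b: "set b \<subseteq> carrier_vec n" "distinct b" "\<not> lin_dep (set b)" "hd b = v" "length b = n"
    using basis_completion[OF v, folded b_def] by auto
  obtain vs where vs: "b = v # vs" using b(4,5) n_pos by (cases b) auto
  note ws = gram_schmidt_result[OF b(1-3) refl, folded ws_def]
  have hd: "hd ws = v" unfolding ws_def vs by (rule gram_schmidt_hd[OF v(1)])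
  define A where "A = mat_of_cols n ws"
  have len: "length ws = n" using ws(4) b(5) by simp
  hence A: "A \<in> carrier_mat n n" unfolding A_def by (metis mat_of_cols_carrier(1))
  have "corthogonal_mat A" unfolding A_def using ws b by (intro orthogonal_mat_of_cols) auto
  then obtain s where s: "unitary n (A * mat_diag n s)" using unitary_normalised_cols[OF A] by blast
  have "col A 0 = v" using hd n_pos len v(1) unfolding A_def by (cases ws) auto
  hence "col (A * mat_diag n s) 0 = s 0 \<cdot>\<^sub>v v"
    using A n_pos by (auto simp: mat_diag_mult_right[of _ n n] intro!: eq_vecI)
  thus ?thesis using s n_pos that by blast
qed

lemma unitary_conj_first_col:
  assumes W: "unitary n W" and A: "A \<in> carrier_mat n n"
    and v: "v \<in> carrier_vec n" "A *\<^sub>v v = e \<cdot>\<^sub>v v" and col: "col W 0 = c \<cdot>\<^sub>v v" and i: "i < n"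
  shows "conj_mat (mat_adjoint W) A $$ (i,0) = (if i = 0 then e else 0)"
proof -
  define B where "B = conj_mat (mat_adjoint W) A"
  note W_carrier = unitary_carrier[OF W]
  have n: "0 < n" using i by simp
  have "B = mat_adjoint W * (A * W)"
    using A W_carrier by (simp add: B_def conj_mat_def assoc_mult_mat[of _ n n _ n _ n])
  hence "col B 0 = mat_adjoint W *\<^sub>v col (A * W) 0"
    using A W_carrier n by (simp only: col_mult2[of _ n n _ n] mat_adjoint_carrier mult_carrier_square)
  also have "col (A * W) 0 = A *\<^sub>v col W 0" using A W_carrier n by (simp only: col_mult2[of _ n n _ n])
  also have "A *\<^sub>v col W 0 = e \<cdot>\<^sub>v col W 0"
    unfolding col using A v by (simp add: mult_mat_vec[of _ n n] smult_smult_assoc mult.commute)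
  also have "mat_adjoint W *\<^sub>v (e \<cdot>\<^sub>v col W 0) = e \<cdot>\<^sub>v (mat_adjoint W *\<^sub>v col W 0)"
    using W_carrier n by (intro mult_mat_vec[of _ n n]) (auto intro: col_carrier_vec)
  also have "mat_adjoint W *\<^sub>v col W 0 = col (mat_adjoint W * W) 0"
    using W_carrier n by (intro col_mult2[symmetric, of _ n n _ n]) auto
  finally have "col B 0 = e \<cdot>\<^sub>v unit_vec n 0" using n by (simp add: unitary_adjoint_mult[OF W])
  hence "col B 0 $ i = (e \<cdot>\<^sub>v unit_vec n 0) $ i" by simp
  moreover have "B \<in> carrier_mat n n" using A W_carrier by (simp add: B_def)
  ultimately show ?thesis using i n unfolding B_def by (simp add: unit_vec_def)
qed

lemma hermitian_first_col_block:
  assumes B: "hermitian (Suc n) B" and col: "\<And>i. i < Suc n \<Longrightarrow> B $$ (i,0) = (if i = 0 then e else 0)"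
  obtains C where "hermitian n C" "B = four_block_mat (real_diag 1 (\<lambda>_. Re e)) (0\<^sub>m 1 n) (0\<^sub>m n 1) C"
proof
  define C where "C = mat n n (\<lambda>(i,j). B $$ (Suc i, Suc j))"
  have sym: "cnj (B $$ (j,i)) = B $$ (i,j)" if "i < Suc n" "j < Suc n" for i j
    using B that by (simp add: hermitian_iff_index)
  have e_real: "complex_of_real (Re e) = e"
    using sym[of 0 0] col[of 0] by (simp add: complex_eq_iff)
  show "hermitian n C" unfolding hermitian_iff_index C_def using sym by simp
  show "B = four_block_mat (real_diag 1 (\<lambda>_. Re e)) (0\<^sub>m 1 n) (0\<^sub>m n 1) C" (is "_ = ?D")
  proof (rule carrier_eq_matI[of _ "Suc n" "Suc n"])
    fix i j assume "i < Suc n" "j < Suc n"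
    thus "B $$ (i,j) = ?D $$ (i,j)"
      using col[of i] col[of j] sym[of 0 j] e_real
      by (cases i; cases j) (auto simp: C_def mat_diag_def)
  qed (use hermitian_carrier[OF B] in \<open>auto simp: C_def mat_diag_def\<close>)
qed

lemma hermitian_deflation:
  assumes A: "hermitian (Suc n) A"
  obtains W e C where "unitary (Suc n) W" "hermitian n C"
    "A = conj_mat W (four_block_mat (real_diag 1 (\<lambda>_. e)) (0\<^sub>m 1 n) (0\<^sub>m n 1) C)"
proof -
  note A_carrier = hermitian_carrier[OF A]
  have "spectrum A \<noteq> {}" by (rule spectrum_non_empty[OF A_carrier]) simp
  then obtain e v where "eigenvector A v e" by (auto simp: spectrum_def eigenvalue_def)
  hence v: "v \<in> carrier_vec (Suc n)" "v \<noteq> 0\<^sub>v (Suc n)" "A *\<^sub>v v = e \<cdot>\<^sub>v v"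
    using A_carrier by (auto simp: eigenvector_def)
  obtain W c where W: "unitary (Suc n) W" and col: "col W 0 = c \<cdot>\<^sub>v v"
    using unitary_completion[OF v(1,2)] by metis
  have "hermitian (Suc n) (conj_mat (mat_adjoint W) A)"
    using A unitary_carrier[OF W] by (simp add: hermitian_conj_mat)
  then obtain C where "hermitian n C"
    "conj_mat (mat_adjoint W) A = four_block_mat (real_diag 1 (\<lambda>_. Re e)) (0\<^sub>m 1 n) (0\<^sub>m n 1) C"
    by (rule hermitian_first_col_block[OF _ unitary_conj_first_col[OF W A_carrier v(1,3) col]])
  thus ?thesis using that[OF W] conj_mat_adjoint_cancel[OF W A_carrier] by metis
qed

theorem hermitian_spectral_decomp:
  assumes "hermitian n A"
  shows "\<exists>U l. spectral_decomp n A U l"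
  using assms
proof (induction n arbitrary: A)
  case 0
  hence "spectral_decomp 0 A (1\<^sub>m 0) (\<lambda>_. 0)"
    by (intro spectral_decompI) (auto simp: unitary_def hermitian_def intro!: eq_matI)
  thus ?case by blast
next
  case (Suc n)
  obtain W e C where W: "unitary (Suc n) W" and C: "hermitian n C"
    and A: "A = conj_mat W (four_block_mat (real_diag 1 (\<lambda>_. e)) (0\<^sub>m 1 n) (0\<^sub>m n 1) C)"
    using hermitian_deflation[OF Suc.prems] by blast
  obtain U l where U: "spectral_decomp n C U l" using Suc.IH[OF C] by blast
  have "spectral_decomp 1 (real_diag 1 (\<lambda>_. e)) (1\<^sub>m 1) (\<lambda>_. e)"
    by (intro spectral_decompI) (auto simp: unitary_def)
  from spectral_decomp_conj[OF spectral_decomp_four_block[OF this U]] W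
  show ?case unfolding A by auto
qed

lemma spectral_decomp_hermitian:
  assumes "spectral_decomp n A U l"
  shows "hermitian n A"
  using assms unitary_carrier[of n U]
  by (auto simp: spectral_decomp_def intro!: hermitian_conj_mat hermitian_mat_diag)

lemma spectral_decomp_intertwine:
  assumes "spectral_decomp n A U l"
  shows "A * U = U * real_diag n l" "mat_adjoint U * A = real_diag n l * mat_adjoint U"
  using assms unitary_carrier[OF spectral_decomp_unitary[OF assms]]
    unitary_adjoint_mult[OF spectral_decomp_unitary[OF assms]]
    unitary_cancel_left[OF spectral_decomp_unitary[OF assms]]
  by (simp_all add: spectral_decomp_def conj_mat_def assoc_mult_mat[of _ n n _ n _ n]
      right_mult_one_mat[of _ n n])

lemma spectral_decomp_mult_col:
  assumes "spectral_decomp n A U l" "i < n"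
  shows "A *\<^sub>v col U i = complex_of_real (l i) \<cdot>\<^sub>v col U i"
proof -
  note U = spectral_decomp_unitary[OF assms(1)]
  note carrier = unitary_carrier[OF U] spectral_decomp_carrier[OF assms(1)]
  have "A *\<^sub>v col U i = col (A * U) i" using carrier assms(2) by (intro col_mult2[symmetric]) auto
  hence "A *\<^sub>v col U i = col (U * real_diag n l) i" unfolding spectral_decomp_intertwine(1)[OF assms(1)] .
  thus ?thesis using carrier assms(2) by (auto simp: mat_diag_mult_right[of _ n n] intro!: eq_vecI)
qed

lemma spectral_decomp_eigenvector:
  assumes "spectral_decomp n A U l" "i < n"
  shows "eigenvector A (col U i) (complex_of_real (l i))"
proof -
  note U = spectral_decomp_unitary[OF assms(1)]
  have "col U i \<noteq> 0\<^sub>v n"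
  proof
    assume zero: "col U i = 0\<^sub>v n"
    have "U $$ (a,i) = 0" if "a < n" for a
      using arg_cong[OF zero, of "\<lambda>v. v $ a"] that assms(2) unitary_carrier[OF U] by simp
    thus False using unitary_col_norm[OF U assms(2)] by simp
  qed
  thus ?thesis
    using spectral_decomp_mult_col[OF assms] spectral_decomp_carrier[OF assms(1)] unitary_carrier[OF U]
    by (auto simp: eigenvector_def)
qed

lemma spectral_decomp_eigen_coords:
  assumes decomp: "spectral_decomp n A U l" and w: "w \<in> carrier_vec n" "A *\<^sub>v w = e \<cdot>\<^sub>v w" and i: "i < n"
  shows "complex_of_real (l i) * (mat_adjoint U *\<^sub>v w) $ i = e * (mat_adjoint U *\<^sub>v w) $ i"
proof -
  note U = spectral_decomp_unitary[OF decomp]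
  note carrier = unitary_carrier[OF U] spectral_decomp_carrier[OF decomp]
  have "real_diag n l *\<^sub>v (mat_adjoint U *\<^sub>v w) = mat_adjoint U *\<^sub>v (A *\<^sub>v w)"
    using carrier w(1) by (simp add: spectral_decomp_intertwine(2)[OF decomp]
        flip: assoc_mult_mat_vec[of _ n n _ n])
  also have "\<dots> = e \<cdot>\<^sub>v (mat_adjoint U *\<^sub>v w)" unfolding w(2) using carrier w(1) by (intro mult_mat_vec) auto
  finally have "(real_diag n l *\<^sub>v (mat_adjoint U *\<^sub>v w)) $ i = (e \<cdot>\<^sub>v (mat_adjoint U *\<^sub>v w)) $ i" by simp
  thus ?thesis using carrier(1) w i by (simp add: mat_diag_mult_vec_index del: index_mult_mat_vec)
qed

lemma unitary_mult_vec_cancel: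
  assumes "unitary n U" "w \<in> carrier_vec n"
  shows "U *\<^sub>v (mat_adjoint U *\<^sub>v w) = w"
proof -
  have "U *\<^sub>v (mat_adjoint U *\<^sub>v w) = (U * mat_adjoint U) *\<^sub>v w"
    using assms unitary_carrier[OF assms(1)] by (simp add: assoc_mult_mat_vec[of _ n n _ n])
  thus ?thesis using assms by (simp add: unitary_mult_adjoint)
qed

lemma spectrum_spectral_decomp:
  assumes decomp: "spectral_decomp n A U l"
  shows "spectrum A = (\<lambda>i. complex_of_real (l i)) ` {..<n}"
proof
  show "(\<lambda>i. complex_of_real (l i)) ` {..<n} \<subseteq> spectrum A"
    using spectral_decomp_eigenvector[OF decomp] unfolding spectrum_def eigenvalue_def by blast
  show "spectrum A \<subseteq> (\<lambda>i. complex_of_real (l i)) ` {..<n}"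
  proof
    fix e assume "e \<in> spectrum A"
    then obtain w where w: "w \<in> carrier_vec n" "w \<noteq> 0\<^sub>v n" "A *\<^sub>v w = e \<cdot>\<^sub>v w"
      using spectral_decomp_carrier[OF decomp] by (auto simp: spectrum_def eigenvalue_def eigenvector_def)
    note U = spectral_decomp_unitary[OF decomp]
    have "\<exists>i<n. (mat_adjoint U *\<^sub>v w) $ i \<noteq> 0"
    proof (rule ccontr)
      assume "\<not> ?thesis"
      hence "mat_adjoint U *\<^sub>v w = 0\<^sub>v n" using unitary_carrier[OF U] by (intro eq_vecI) auto
      hence "U *\<^sub>v 0\<^sub>v n = w" using unitary_mult_vec_cancel[OF U w(1)] by simp
      thus False using w(2) unitary_carrier[OF U] by auto
    qed
    then obtain i where "i < n" "complex_of_real (l i) = e"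
      using spectral_decomp_eigen_coords[OF decomp w(1,3)] by auto
    thus "e \<in> (\<lambda>i. complex_of_real (l i)) ` {..<n}" by blast
  qed
qed

section \<open>The spectral projector\<close>

lemma (in vec_space) lincomb_list_in_span:
  assumes "E \<subseteq> carrier_vec n" "set ws \<subseteq> carrier_vec n"
    and "\<And>i. i < length ws \<Longrightarrow> c i \<noteq> 0 \<Longrightarrow> ws ! i \<in> span E"
  shows "lincomb_list c ws \<in> span E"
  using assms(2,3)
proof (induction ws arbitrary: c)
  case Nil
  interpret submodule class_ring "span E" V using span_is_submodule assms(1) by simp
  show ?case using zero_closed by simp
next
  case (Cons w ws)
  have "lincomb_list (c \<circ> Suc) ws \<in> span E"
    using Cons.prems by (intro Cons.IH) force+
  moreover have "c 0 \<cdot>\<^sub>v w \<in> span E"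
  proof (cases "c 0 = 0")
    case True
    have "0 \<cdot>\<^sub>v w = 0 \<cdot>\<^sub>v (0\<^sub>v n)" using Cons.prems(1) by auto
    also have "\<dots> \<in> span E" using assms(1) span_zero by (intro smult_in_span) (auto simp: span_def)
    finally show ?thesis using True by simp
  next
    case False
    thus ?thesis using Cons.prems(2)[of 0] assms(1) by (intro smult_in_span) auto
  qed
  ultimately show ?case using span_add1[OF assms(1)] by simp
qed

lemma unitary_diag_fixed_iff:
  assumes U: "unitary n U" and w: "w \<in> carrier_vec n"
  shows "conj_mat U (mat_diag n f) *\<^sub>v w = w
    \<longleftrightarrow> (\<forall>i<n. f i * (mat_adjoint U *\<^sub>v w) $ i = (mat_adjoint U *\<^sub>v w) $ i)"
proof -
  define c where "c = mat_adjoint U *\<^sub>v w"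
  note U_carrier = unitary_carrier[OF U]
  have c: "c \<in> carrier_vec n" and U_c: "U *\<^sub>v c = w"
    using U_carrier w unitary_mult_vec_cancel[OF U w] by (auto simp: c_def)
  have conj_apply: "conj_mat U (mat_diag n f) *\<^sub>v w = U *\<^sub>v (mat_diag n f *\<^sub>v c)"
    using U_carrier w by (simp add: conj_mat_def c_def assoc_mult_mat_vec[of _ n n _ n])
  have "U *\<^sub>v (mat_diag n f *\<^sub>v c) = w \<longleftrightarrow> mat_diag n f *\<^sub>v c = c"
  proof
    assume "U *\<^sub>v (mat_diag n f *\<^sub>v c) = w"
    moreover have "mat_adjoint U *\<^sub>v (U *\<^sub>v (mat_diag n f *\<^sub>v c)) = mat_diag n f *\<^sub>v c"
      using unitary_mult_vec_cancel[OF unitary_adjoint[OF U], of "mat_diag n f *\<^sub>v c"] c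
      by simp
    ultimately show "mat_diag n f *\<^sub>v c = c" by (simp add: c_def)
  qed (simp add: U_c)
  also have "\<dots> \<longleftrightarrow> (\<forall>i<n. (mat_diag n f *\<^sub>v c) $ i = c $ i)"
    using c by (auto intro!: eq_vecI simp del: index_mult_mat_vec)
  also have "\<dots> \<longleftrightarrow> (\<forall>i<n. f i * c $ i = c $ i)"
    using mat_diag_mult_vec_index[OF c] by (simp del: index_mult_mat_vec)
  finally show ?thesis unfolding conj_apply c_def .
qed

lemma submodule_fixed_vectors:
  fixes P :: "complex mat"
  assumes "P \<in> carrier_mat n n"
  shows "submodule class_ring {w \<in> carrier_vec n. P *\<^sub>v w = w} (module_vec TYPE(complex) n)"
proof -
  interpret vec_space "TYPE(complex)" n .
  show ?thesis
    by unfold_locales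
      (use assms in \<open>auto simp: mult_add_distrib_mat_vec[of _ n n] mult_mat_vec[of _ n n]\<close>)
qed

lemma neg_eigenvector_fixed:
  assumes decomp: "spectral_decomp n A U l" and w: "eigenvector A w e" and e: "e \<in> \<real>" "Re e < 0"
  shows "w \<in> {w \<in> carrier_vec n. conj_mat U (neg_diag n l) *\<^sub>v w = w}"
proof -
  have w: "w \<in> carrier_vec n" "A *\<^sub>v w = e \<cdot>\<^sub>v w"
    using w spectral_decomp_carrier[OF decomp] by (auto simp: eigenvector_def)
  have "of_bool (l i < 0) * (mat_adjoint U *\<^sub>v w) $ i = (mat_adjoint U *\<^sub>v w) $ i" if "i < n" for i
    using spectral_decomp_eigen_coords[OF decomp w that] e by auto
  thus ?thesis using unitary_diag_fixed_iff[OF spectral_decomp_unitary[OF decomp] w(1)] w(1) by simp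
qed

lemma (in vec_space) mult_mat_vec_in_span:
  assumes U: "U \<in> carrier_mat n k" and v: "v \<in> carrier_vec k" and "E \<subseteq> carrier_vec n"
    and cols: "\<And>i. i < k \<Longrightarrow> v $ i \<noteq> 0 \<Longrightarrow> col U i \<in> E"
  shows "U *\<^sub>v v \<in> span E"
proof -
  have "lincomb_list (($) v) (cols U) = U *\<^sub>v vec k (($) v)"
    using U mat_of_cols_cols[of U] cols_dim[of U]
    by (subst lincomb_list_as_mat_mult) (auto simp del: mat_of_cols_cols)
  also have "vec k (($) v) = v" using v by auto
  finally have "U *\<^sub>v v = lincomb_list (($) v) (cols U)" by simp
  also have "\<dots> \<in> span E"
  proof (rule lincomb_list_in_span[OF \<open>E \<subseteq> carrier_vec n\<close>])
    show "set (cols U) \<subseteq> carrier_vec n" using U cols_dim by blast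
    fix i assume "i < length (cols U)" "v $ i \<noteq> 0"
    thus "cols U ! i \<in> span E" using cols[of i] in_own_span[OF \<open>E \<subseteq> carrier_vec n\<close>] U by auto
  qed
  finally show ?thesis .
qed

lemma neg_eig_span_eq_fixed:
  assumes decomp: "spectral_decomp n A U l"
  shows "neg_eig_span A = {w \<in> carrier_vec n. conj_mat U (neg_diag n l) *\<^sub>v w = w}" (is "_ = ?F")
proof
  interpret vec_space "TYPE(complex)" n .
  note U = spectral_decomp_unitary[OF decomp]
  define E where "E = {w. \<exists>e. eigenvector A w e \<and> e \<in> \<real> \<and> Re e < 0}"
  have span: "neg_eig_span A = span E"
    using spectral_decomp_carrier[OF decomp] by (simp add: neg_eig_span_def E_def)
  have subset: "E \<subseteq> ?F" using neg_eigenvector_fixed[OF decomp] by (auto simp: E_def)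
  show "neg_eig_span A \<subseteq> ?F"
    unfolding span by (intro span_is_subset submodule_fixed_vectors subset)
      (use unitary_carrier[OF U] in simp)
  show "?F \<subseteq> neg_eig_span A"
  proof
    fix w assume w: "w \<in> ?F"
    hence "U *\<^sub>v (mat_adjoint U *\<^sub>v w) \<in> span E"
    proof (intro mult_mat_vec_in_span[OF unitary_carrier[OF U]])
      fix i assume i: "i < n" "(mat_adjoint U *\<^sub>v w) $ i \<noteq> 0"
      hence "l i < 0" using w unitary_diag_fixed_iff[OF U] by force
      thus "col U i \<in> E" unfolding E_def using spectral_decomp_eigenvector[OF decomp i(1)] by force
    qed (use subset unitary_carrier[OF U] in auto)
    thus "w \<in> neg_eig_span A" using w span unitary_mult_vec_cancel[OF U] by simp
  qed
qed

lemma orthogonal_projector_unique: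
  fixes P Q :: "complex mat"
  assumes P: "hermitian n P" "P * P = P" and Q: "hermitian n Q" "Q * Q = Q"
    and range_eq: "{w \<in> carrier_vec n. P *\<^sub>v w = w} = {w \<in> carrier_vec n. Q *\<^sub>v w = w}"
  shows "P = Q"
proof -
  note carrier = hermitian_carrier[OF P(1)] hermitian_carrier[OF Q(1)]
  have absorb: "A * B = B" if A: "A \<in> carrier_mat n n" and B: "B \<in> carrier_mat n n" "B * B = B"
    and same_range: "{w \<in> carrier_vec n. A *\<^sub>v w = w} = {w \<in> carrier_vec n. B *\<^sub>v w = w}"
      for A B :: "complex mat"
  proof (rule mat_col_eqI)
    fix j assume "j < dim_col B"
    hence j: "j < n" using B by simp
    have "B *\<^sub>v col B j = col B j" using B j by (metis col_mult2)
    moreover have "col B j \<in> carrier_vec n" using B j by (intro col_carrier_vec) auto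
    ultimately have "A *\<^sub>v col B j = col B j" using same_range by blast
    thus "col (A * B) j = col B j" using A B j by (metis col_mult2)
  qed (use A B in auto)
  have "P = mat_adjoint (Q * P)" using absorb[of Q P] P carrier Q range_eq by (simp add: hermitian_def)
  also have "\<dots> = P * Q" using P Q carrier by (simp add: mat_adjoint_mult[of _ n n _ n] hermitian_def)
  also have "\<dots> = Q" using absorb[of P Q] Q carrier range_eq by simp
  finally show ?thesis .
qed

lemma neg_proj_eq:
  assumes decomp: "spectral_decomp n A U l"
  shows "neg_proj A = conj_mat U (neg_diag n l)" (is "_ = ?P")
proof -
  note U = spectral_decomp_unitary[OF decomp]
  have dim: "dim_row A = n" using spectral_decomp_carrier[OF decomp] by simp
  have idem: "?P * ?P = ?P" by (simp add: conj_mat_mult[OF U, symmetric] flip: of_bool_conj)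
  have herm: "hermitian n ?P"
    using unitary_carrier[OF U] by (intro hermitian_conj_mat hermitian_mat_diag) auto
  show ?thesis
    unfolding neg_proj_def dim
  proof (rule the_equality)
    show "?P \<in> carrier_mat n n \<and> ?P * ?P = ?P \<and> mat_adjoint ?P = ?P
        \<and> {w \<in> carrier_vec n. ?P *\<^sub>v w = w} = neg_eig_span A"
      using herm[unfolded hermitian_def] idem neg_eig_span_eq_fixed[OF decomp, symmetric] by blast
    fix Q assume "Q \<in> carrier_mat n n \<and> Q * Q = Q \<and> mat_adjoint Q = Q
        \<and> {w \<in> carrier_vec n. Q *\<^sub>v w = w} = neg_eig_span A"
    thus "Q = ?P"
      using herm idem neg_eig_span_eq_fixed[OF decomp, symmetric]
      by (intro orthogonal_projector_unique[of n Q ?P]) (blast | simp add: hermitian_def)+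
  qed
qed

lemma neg_proj_hermitian:
  assumes "hermitian n A"
  shows "hermitian n (neg_proj A)"
proof -
  obtain U l where decomp: "spectral_decomp n A U l" using hermitian_spectral_decomp[OF assms] by blast
  note U = unitary_carrier[OF spectral_decomp_unitary[OF decomp]]
  show ?thesis
    unfolding neg_proj_eq[OF decomp] using U by (intro hermitian_conj_mat hermitian_mat_diag) auto
qed

lemma neg_proj_carrier: "hermitian n A \<Longrightarrow> neg_proj A \<in> carrier_mat n n"
  by (intro hermitian_carrier neg_proj_hermitian)

lemma neg_proj_idem:
  assumes "hermitian n A"
  shows "neg_proj A * neg_proj A = neg_proj A"
proof -
  obtain U l where decomp: "spectral_decomp n A U l" using hermitian_spectral_decomp[OF assms] by blast
  show ?thesis
    unfolding neg_proj_eq[OF decomp]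
    by (simp add: conj_mat_mult[OF spectral_decomp_unitary[OF decomp], symmetric] flip: of_bool_conj)
qed

lemma neg_proj_commute:
  assumes "hermitian n A"
  shows "A * neg_proj A = neg_proj A * A"
proof -
  obtain U l where decomp: "spectral_decomp n A U l" using hermitian_spectral_decomp[OF assms] by blast
  have "A = conj_mat U (real_diag n l)" using decomp by (simp add: spectral_decomp_def)
  thus ?thesis
    unfolding neg_proj_eq[OF decomp]
    by (simp add: conj_mat_mult[OF spectral_decomp_unitary[OF decomp], symmetric] mult.commute)
qed

lemma neg_proj_conj:
  assumes "hermitian n A" "unitary n W"
  shows "neg_proj (conj_mat W A) = conj_mat W (neg_proj A)"
proof -
  obtain U l where decomp: "spectral_decomp n A U l" using hermitian_spectral_decomp[OF assms(1)] by blast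
  note U = unitary_carrier[OF spectral_decomp_unitary[OF decomp]]
  show ?thesis
    unfolding neg_proj_eq[OF decomp] neg_proj_eq[OF spectral_decomp_conj[OF decomp assms(2)]]
    using U unitary_carrier[OF assms(2)] by (simp add: conj_mat_conj_mat[of _ n])
qed

lemma spectral_decomp_smult:
  assumes "spectral_decomp n A U l"
  shows "spectral_decomp n (complex_of_real r \<cdot>\<^sub>m A) U (\<lambda>i. r * l i)"
proof -
  have "real_diag n (\<lambda>i. r * l i) = complex_of_real r \<cdot>\<^sub>m real_diag n l" by (rule eq_matI) auto
  thus ?thesis
    using assms unitary_carrier[OF spectral_decomp_unitary[OF assms]]
    by (simp add: spectral_decomp_def conj_mat_smult[of _ n])
qed

lemma neg_proj_smult_pos:
  assumes "hermitian n A" "r > 0"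
  shows "neg_proj (complex_of_real r \<cdot>\<^sub>m A) = neg_proj A"
proof -
  obtain U l where decomp: "spectral_decomp n A U l" using hermitian_spectral_decomp[OF assms(1)] by blast
  have "r * l i < 0 \<longleftrightarrow> l i < 0" for i using assms(2) by (simp add: mult_less_0_iff)
  thus ?thesis unfolding neg_proj_eq[OF decomp] neg_proj_eq[OF spectral_decomp_smult[OF decomp]] by simp
qed

lemma spectral_decomp_nonzero:
  assumes "spectral_decomp n A U l" "\<not> eigenvalue A 0" "i < n"
  shows "l i \<noteq> 0"
  using spectral_decomp_eigenvector[OF assms(1,3)] assms(2) by (auto simp: eigenvalue_def)

lemma neg_proj_smult_neg:
  assumes "hermitian n A" "\<not> eigenvalue A 0" "r < 0"
  shows "neg_proj (complex_of_real r \<cdot>\<^sub>m A) = 1\<^sub>m n - neg_proj A"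
proof -
  obtain U l where decomp: "spectral_decomp n A U l" using hermitian_spectral_decomp[OF assms(1)] by blast
  note U = spectral_decomp_unitary[OF decomp]
  have "mat_diag n (\<lambda>i. of_bool (r * l i < 0)) = 1\<^sub>m n - neg_diag n l"
    using spectral_decomp_nonzero[OF decomp assms(2)] assms(3)
    by (intro eq_matI) (auto simp: mult_less_0_iff not_less order.order_iff_strict)
  thus ?thesis
    unfolding neg_proj_eq[OF decomp] neg_proj_eq[OF spectral_decomp_smult[OF decomp]]
    using unitary_carrier[OF U] by (simp add: conj_mat_minus[of _ n] conj_mat_one[OF U])
qed

section \<open>Perturbation of eigenvalues and of the spectral projector\<close>

definition entry_norm :: "complex mat \<Rightarrow> real" where
  "entry_norm A = (\<Sum>i<dim_row A. \<Sum>j<dim_col A. cmod (A $$ (i,j)))"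

lemma entry_norm_nonneg [simp]: "entry_norm A \<ge> 0"
  by (simp add: entry_norm_def sum_nonneg)

lemma entry_norm_smult: "entry_norm (c \<cdot>\<^sub>m A) = cmod c * entry_norm A"
  by (simp add: entry_norm_def norm_mult sum_distrib_left)

lemma entry_norm_minus_commute:
  assumes "A \<in> carrier_mat n k" "B \<in> carrier_mat n k"
  shows "entry_norm (A - B) = entry_norm (B - A)"
  using assms by (auto simp: entry_norm_def norm_minus_commute)

lemma entry_norm_le:
  assumes "A \<in> carrier_mat n n" "\<And>i j. i < n \<Longrightarrow> j < n \<Longrightarrow> cmod (A $$ (i,j)) \<le> c"
  shows "entry_norm A \<le> (real n)\<^sup>2 * c"
proof -
  have "entry_norm A = (\<Sum>i<n. \<Sum>j<n. cmod (A $$ (i,j)))"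
    using assms(1) by (simp add: entry_norm_def)
  also have "\<dots> \<le> (\<Sum>i<n. \<Sum>j<n. c)" using assms(2) by (intro sum_mono) auto
  finally show ?thesis by (simp add: power2_eq_square mult.assoc)
qed

lemma unitary_mult_unitary_entry_bound:
  assumes U: "unitary n U" and W: "unitary n W" and X: "X \<in> carrier_mat n n" and ij: "i < n" "j < n"
  shows "cmod ((U * X * W) $$ (i,j)) \<le> entry_norm X"
proof -
  have "cmod ((U * X * W) $$ (i,j)) \<le> (\<Sum>a<n. \<Sum>b<n. cmod (X $$ (a,b)))"
    unfolding mult3_mat_index_sum[OF unitary_carrier[OF U] X unitary_carrier[OF W] ij]
  proof (intro sum_norm_le)
    fix a b assume "a \<in> {..<n}" "b \<in> {..<n}"
    hence "cmod (U $$ (i,a)) * cmod (X $$ (a,b)) * cmod (W $$ (b,j)) \<le> 1 * cmod (X $$ (a,b)) * 1"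
      using ij unitary_entry_le_1[OF U] unitary_entry_le_1[OF W] by (intro mult_mono) auto
    thus "cmod (U $$ (i,a) * X $$ (a,b) * W $$ (b,j)) \<le> cmod (X $$ (a,b))"
      by (simp add: norm_mult)
  qed
  thus ?thesis using X by (simp add: entry_norm_def)
qed

lemma conj_mat_entry_bound:
  assumes "unitary n U" "X \<in> carrier_mat n n" "i < n" "j < n"
  shows "cmod (conj_mat U X $$ (i,j)) \<le> entry_norm X"
  unfolding conj_mat_def using assms by (intro unitary_mult_unitary_entry_bound unitary_adjoint)

lemma unitary_col_large_entry:
  assumes "unitary n U" "j < n"
  shows "\<exists>i<n. 1 / real n \<le> cmod (U $$ (i,j))"
proof (rule ccontr)
  assume "\<not> ?thesis"
  hence small: "cmod (U $$ (i,j)) < 1 / n" if "i < n" for i using that by force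
  have "(\<Sum>i<n. (cmod (U $$ (i,j)))\<^sup>2) < (\<Sum>i<n. 1 / real n)"
  proof (rule sum_strict_mono)
    fix i assume "i \<in> {..<n}"
    hence "(cmod (U $$ (i,j)))\<^sup>2 < (1 / real n)\<^sup>2" using small by (intro power_strict_mono) auto
    also have "(1 / real n)\<^sup>2 \<le> 1 / n" using assms(2) by (simp add: power2_eq_square field_simps)
    finally show "(cmod (U $$ (i,j)))\<^sup>2 < 1 / n" .
  qed (use assms(2) in auto)
  thus False using unitary_col_norm[OF assms] assms(2) by simp
qed

text \<open>The overlap matrix of two eigenbases solves a Sylvester equation; comparing entries is the
  Davis--Kahan argument.\<close>

lemma overlap_sylvester:
  assumes A: "spectral_decomp n A U l" and B: "spectral_decomp n B W l'" and ij: "i < n" "j < n"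
  shows "complex_of_real (l i - l' j) * (mat_adjoint U * W) $$ (i,j) = (mat_adjoint U * (A - B) * W) $$ (i,j)"
proof -
  define K where "K = mat_adjoint U * W"
  have carrier: "U \<in> carrier_mat n n" "W \<in> carrier_mat n n" "A \<in> carrier_mat n n" "B \<in> carrier_mat n n"
    using A B by (auto intro: unitary_carrier spectral_decomp_unitary spectral_decomp_carrier)
  hence K: "K \<in> carrier_mat n n" by (simp add: K_def)
  have "mat_adjoint U * (A - B) * W = (mat_adjoint U * A) * W - mat_adjoint U * (B * W)"
    using carrier by (simp add: mult_minus_distrib_mat[of _ n n _ n] minus_mult_distrib_mat[of _ n n _ _ n]
        assoc_mult_mat[of _ n n _ n _ n])
  also have "\<dots> = real_diag n l * K - K * real_diag n l'"
    unfolding spectral_decomp_intertwine(2)[OF A] spectral_decomp_intertwine(1)[OF B] K_def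
    using carrier by (simp add: assoc_mult_mat[of _ n n _ n _ n])
  finally show ?thesis
    using K ij unfolding K_def[symmetric]
    by (simp add: mat_diag_mult_left[of _ n n] mat_diag_mult_right[of _ n n] algebra_simps)
qed

lemma abs_diff_mult_overlap_le:
  assumes A: "spectral_decomp n A U l" and B: "spectral_decomp n B W l'" and ij: "i < n" "j < n"
  shows "\<bar>l i - l' j\<bar> * cmod ((mat_adjoint U * W) $$ (i,j)) \<le> entry_norm (A - B)"
proof -
  have "\<bar>l i - l' j\<bar> * cmod ((mat_adjoint U * W) $$ (i,j)) = cmod ((mat_adjoint U * (A - B) * W) $$ (i,j))"
    unfolding overlap_sylvester[OF assms, symmetric] norm_mult norm_of_real ..
  also have "\<dots> \<le> entry_norm (A - B)"
    using A B ij by (intro unitary_mult_unitary_entry_bound[of n] unitary_adjoint minus_carrier_square)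
      (auto intro: spectral_decomp_unitary spectral_decomp_carrier)
  finally show ?thesis .
qed

lemma unitary_overlap:
  assumes "spectral_decomp n A U l" "spectral_decomp n B W l'"
  shows "unitary n (mat_adjoint U * W)"
  using assms by (intro unitary_mult unitary_adjoint) (auto intro: spectral_decomp_unitary)

lemma eigenvalue_perturbation:
  assumes A: "spectral_decomp n A U l" and B: "spectral_decomp n B W l'" and j: "j < n"
  shows "\<exists>i<n. \<bar>l i - l' j\<bar> \<le> n * entry_norm (A - B)"
proof -
  obtain i where i: "i < n" "1 / n \<le> cmod ((mat_adjoint U * W) $$ (i,j))"
    using unitary_col_large_entry[OF unitary_overlap[OF A B] j] by blast
  have "\<bar>l i - l' j\<bar> * (1 / n) \<le> \<bar>l i - l' j\<bar> * cmod ((mat_adjoint U * W) $$ (i,j))"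
    using i by (intro mult_left_mono) auto
  also have "\<dots> \<le> entry_norm (A - B)" by (rule abs_diff_mult_overlap_le[OF A B i(1) j])
  finally show ?thesis using i j by (auto simp: field_simps)
qed

definition spectral_gap :: "complex mat \<Rightarrow> real" where
  "spectral_gap A = Min (cmod ` spectrum A)"

lemma spectral_gap_eq_Min:
  assumes "spectral_decomp n A U l"
  shows "spectral_gap A = Min ((\<lambda>i. \<bar>l i\<bar>) ` {..<n})"
  unfolding spectral_gap_def spectrum_spectral_decomp[OF assms] image_image by simp

lemma spectral_gap_le:
  assumes "spectral_decomp n A U l" "i < n"
  shows "spectral_gap A \<le> \<bar>l i\<bar>"
  unfolding spectral_gap_eq_Min[OF assms(1)] using assms(2) by (intro Min_le) auto

lemma spectral_gap_attained:
  assumes "spectral_decomp n A U l" "n > 0"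
  obtains i where "i < n" "spectral_gap A = \<bar>l i\<bar>"
proof -
  have "spectral_gap A \<in> (\<lambda>i. \<bar>l i\<bar>) ` {..<n}"
    unfolding spectral_gap_eq_Min[OF assms(1)] using assms(2) by (intro Min_in) auto
  thus ?thesis using that by auto
qed

lemma spectral_gap_pos:
  assumes "hermitian n A" "n > 0" "\<not> eigenvalue A 0"
  shows "spectral_gap A > 0"
proof -
  obtain U l where decomp: "spectral_decomp n A U l" using hermitian_spectral_decomp[OF assms(1)] by blast
  obtain i where "i < n" "spectral_gap A = \<bar>l i\<bar>" using spectral_gap_attained[OF decomp assms(2)] .
  thus ?thesis using spectral_decomp_nonzero[OF decomp assms(3)] by simp
qed

lemma spectral_gap_perturbation:
  assumes "hermitian n A" "hermitian n B" "n > 0"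
  shows "spectral_gap A - n * entry_norm (A - B) \<le> spectral_gap B"
proof -
  obtain U l W l' where decomp: "spectral_decomp n A U l" and decomp': "spectral_decomp n B W l'"
    using assms hermitian_spectral_decomp by meson
  obtain j where j: "j < n" "spectral_gap B = \<bar>l' j\<bar>" using spectral_gap_attained[OF decomp' assms(3)] .
  obtain i where i: "i < n" "\<bar>l i - l' j\<bar> \<le> n * entry_norm (A - B)"
    using eigenvalue_perturbation[OF decomp decomp' j(1)] by blast
  have "spectral_gap A \<le> \<bar>l i\<bar>" by (rule spectral_gap_le[OF decomp i(1)])
  thus ?thesis using i(2) j(2) by linarith
qed

lemma spectral_gap_lipschitz:
  assumes "hermitian n A" "hermitian n B" "n > 0"
  shows "\<bar>spectral_gap A - spectral_gap B\<bar> \<le> n * entry_norm (A - B)"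
  using spectral_gap_perturbation[OF assms] spectral_gap_perturbation[OF assms(2,1,3)]
    entry_norm_minus_commute[OF assms(1,2)[THEN hermitian_carrier]] by (simp add: abs_le_iff)

lemma overlap_opposite_sign_le:
  assumes A: "spectral_decomp n A U l" and B: "spectral_decomp n B W l'" and gap: "spectral_gap A > 0"
    and ik: "i < n" "k < n" and opp: "(l i < 0) \<noteq> (l' k < 0)"
  shows "cmod ((mat_adjoint U * W) $$ (i,k)) \<le> entry_norm (A - B) / spectral_gap A"
proof -
  have "spectral_gap A \<le> \<bar>l i - l' k\<bar>" using spectral_gap_le[OF A ik(1)] opp by auto
  hence "spectral_gap A * cmod ((mat_adjoint U * W) $$ (i,k))
      \<le> \<bar>l i - l' k\<bar> * cmod ((mat_adjoint U * W) $$ (i,k))"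
    by (intro mult_right_mono) auto
  also have "\<dots> \<le> entry_norm (A - B)" by (rule abs_diff_mult_overlap_le[OF A B ik])
  finally show ?thesis using gap by (simp add: field_simps)
qed

lemma neg_proj_diff_in_eigenbasis:
  assumes A: "spectral_decomp n A U l" and B: "spectral_decomp n B W l'" and ij: "i < n" "j < n"
  defines "K \<equiv> mat_adjoint U * W"
  shows "conj_mat (mat_adjoint U) (neg_proj B) $$ (i,j) - of_bool (i = j \<and> l i < 0)
    = (\<Sum>k<n. (of_bool (l' k < 0) - of_bool (l i < 0)) * (K $$ (i,k) * cnj (K $$ (j,k))))"
proof -
  have K: "unitary n K" unfolding K_def by (rule unitary_overlap[OF A B])
  have "conj_mat (mat_adjoint U) (neg_proj B) = conj_mat K (neg_diag n l')"
    unfolding neg_proj_eq[OF B] K_def using A B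
    by (simp add: conj_mat_conj_mat[of _ n] spectral_decomp_unitary unitary_carrier)
  moreover have "of_bool (i = j \<and> l i < 0) = (\<Sum>k<n. of_bool (l i < 0) * (K $$ (i,k) * cnj (K $$ (j,k))))"
    using unitary_row_orthonormal[OF K ij] by (cases "i = j") (simp_all flip: sum_distrib_left)
  ultimately show ?thesis
    by (simp add: conj_mat_mat_diag_index[OF unitary_carrier[OF K] ij] left_diff_distrib sum_subtractf)
qed

lemma neg_proj_perturbation:
  assumes A: "spectral_decomp n A U l" and B: "spectral_decomp n B W l'" and gap: "spectral_gap A > 0"
    and ij: "i < n" "j < n"
  defines "q \<equiv> conj_mat (mat_adjoint U) (neg_proj B) $$ (i,j) - of_bool (i = j \<and> l i < 0)"
    and "e \<equiv> entry_norm (A - B) / spectral_gap A"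
  shows "cmod q \<le> n * e" "(l i < 0) = (l j < 0) \<Longrightarrow> cmod q \<le> n * e\<^sup>2"
proof -
  define K where "K = mat_adjoint U * W"
  have K: "unitary n K" unfolding K_def by (rule unitary_overlap[OF A B])
  have e_nonneg: "e \<ge> 0" using gap by (simp add: e_def)
  have small: "cmod (K $$ (i',k)) \<le> e" if "i' < n" "k < n" "(l i' < 0) \<noteq> (l' k < 0)" for i' k
    unfolding K_def e_def using that by (intro overlap_opposite_sign_le[OF A B gap])
  have bound: "cmod q \<le> n * x" if x: "x \<ge> 0"
    "\<And>k. k < n \<Longrightarrow> (l i < 0) \<noteq> (l' k < 0) \<Longrightarrow> cmod (K $$ (i,k)) * cmod (K $$ (j,k)) \<le> x" for x :: real
  proof -
    have "cmod q \<le> (\<Sum>k<n. x)"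
      unfolding q_def neg_proj_diff_in_eigenbasis[OF A B ij] K_def[symmetric]
      using x by (intro sum_norm_le) (auto simp: norm_mult of_bool_def)
    thus ?thesis by simp
  qed
  show "cmod q \<le> n * e"
  proof (rule bound[OF e_nonneg])
    fix k assume k: "k < n" "(l i < 0) \<noteq> (l' k < 0)"
    have "cmod (K $$ (i,k)) * cmod (K $$ (j,k)) \<le> e * 1"
      using small[OF ij(1) k] unitary_entry_le_1[OF K ij(2) k(1)] e_nonneg by (intro mult_mono) auto
    thus "cmod (K $$ (i,k)) * cmod (K $$ (j,k)) \<le> e" by simp
  qed
  assume same: "(l i < 0) = (l j < 0)"
  show "cmod q \<le> n * e\<^sup>2"
    unfolding power2_eq_square using small ij same e_nonneg by (intro bound mult_mono) auto
qed

lemma neg_proj_lipschitz: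
  assumes A: "hermitian n A" and B: "hermitian n B" and gap: "spectral_gap A > 0" and ab: "a < n" "b < n"
  shows "cmod (neg_proj B $$ (a,b) - neg_proj A $$ (a,b))
      \<le> real n ^ 3 * (entry_norm (A - B) / spectral_gap A)"
proof -
  obtain U l W l' where decomp: "spectral_decomp n A U l" and decomp': "spectral_decomp n B W l'"
    using A B hermitian_spectral_decomp by meson
  note U = spectral_decomp_unitary[OF decomp]
  note carrier = unitary_carrier[OF U] neg_proj_carrier[OF A] neg_proj_carrier[OF B]
  define Q where "Q = conj_mat (mat_adjoint U) (neg_proj B) - neg_diag n l"
  have Q: "Q \<in> carrier_mat n n" by (simp add: Q_def)
  have "neg_proj B - neg_proj A = conj_mat U Q"
    using carrier by (simp add: Q_def conj_mat_minus[of _ n] conj_mat_adjoint_cancel[OF U]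
        neg_proj_eq[OF decomp])
  moreover have "neg_proj B $$ (a,b) - neg_proj A $$ (a,b) = (neg_proj B - neg_proj A) $$ (a,b)"
    using carrier ab by simp
  ultimately have "neg_proj B $$ (a,b) - neg_proj A $$ (a,b) = conj_mat U Q $$ (a,b)" by simp
  also have "cmod \<dots> \<le> entry_norm Q" by (rule conj_mat_entry_bound[OF U Q ab])
  also have "\<dots> \<le> (real n)\<^sup>2 * (n * (entry_norm (A - B) / spectral_gap A))"
  proof (rule entry_norm_le[OF Q])
    fix i j assume ij: "i < n" "j < n"
    hence "Q $$ (i,j) = conj_mat (mat_adjoint U) (neg_proj B) $$ (i,j) - of_bool (i = j \<and> l i < 0)"
      using carrier by (simp add: Q_def)
    thus "cmod (Q $$ (i,j)) \<le> n * (entry_norm (A - B) / spectral_gap A)"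
      using neg_proj_perturbation(1)[OF decomp decomp' gap ij] by simp
  qed
  finally show ?thesis by (simp add: power2_eq_square power3_eq_cube mult_ac)
qed

section \<open>The derivative of the spectral projector\<close>

lemma has_vector_derivative_at_0I:
  fixes f e :: "real \<Rightarrow> 'a::real_normed_vector"
  assumes expansion: "\<And>t. f t = f 0 + t *\<^sub>R e t" and lim: "(e \<longlongrightarrow> d) (at 0)"
  shows "(f has_vector_derivative d) (at 0)"
  unfolding has_vector_derivative_def has_derivative_at
proof
  show "bounded_linear (\<lambda>x. x *\<^sub>R d)" by (rule bounded_linear_scaleR_left)
  have "((\<lambda>h. norm (e h - d)) \<longlongrightarrow> 0) (at 0)" using lim by (simp add: LIM_zero_iff tendsto_norm_zero)
  moreover have "\<forall>\<^sub>F h in at 0. norm (e h - d) = norm (f (0 + h) - f 0 - h *\<^sub>R d) / norm h"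
    unfolding eventually_at_filter
  proof (rule always_eventually, intro allI impI)
    fix h :: real assume "h \<noteq> 0"
    moreover have "f (0 + h) - f 0 - h *\<^sub>R d = h *\<^sub>R (e h - d)"
      using expansion[of h] by (simp add: algebra_simps)
    ultimately show "norm (e h - d) = norm (f (0 + h) - f 0 - h *\<^sub>R d) / norm h" by simp
  qed
  ultimately show "((\<lambda>h. norm (f (0 + h) - f 0 - h *\<^sub>R d) / norm h) \<longlongrightarrow> 0) (at 0)"
    by (rule Lim_transform_eventually)
qed

lemma has_vector_derivative_0_of_quadratic_bound:
  fixes f :: "real \<Rightarrow> 'a::real_normed_vector"
  assumes bound: "\<And>t. norm (f t - f 0) \<le> C * t\<^sup>2"
  shows "(f has_vector_derivative 0) (at 0)"
proof (rule has_vector_derivative_at_0I)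
  define e where "e t = (1 / t) *\<^sub>R (f t - f 0)" for t
  show "f t = f 0 + t *\<^sub>R e t" for t by (simp add: e_def)
  show "(e \<longlongrightarrow> 0) (at 0)"
  proof (rule Lim_null_comparison)
    have "norm (e t) \<le> C * \<bar>t\<bar>" for t
    proof (cases "t = 0")
      case False
      have "norm (e t) \<le> C * t\<^sup>2 / \<bar>t\<bar>"
        unfolding e_def using bound[of t] by (simp add: divide_right_mono)
      also have "\<dots> = C * \<bar>t\<bar>" using False by (simp add: power2_eq_square abs_if)
      finally show ?thesis .
    qed (simp add: e_def)
    thus "\<forall>\<^sub>F t in at 0. norm (e t) \<le> C * \<bar>t\<bar>" by simp
    show "((\<lambda>t. C * \<bar>t\<bar>) \<longlongrightarrow> 0) (at 0)" by (auto intro!: tendsto_eq_intros)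
  qed
qed

definition step_quotient :: "real \<Rightarrow> real \<Rightarrow> real" where
  "step_quotient s t = (of_bool (t < 0) - of_bool (s < 0)) / (t - s)"

lemma step_quotient_same_sign: "(s < 0) = (t < 0) \<Longrightarrow> step_quotient s t = 0"
  by (simp add: step_quotient_def)

lemma step_quotient_mult: "step_quotient s t * (t - s) = of_bool (t < 0) - of_bool (s < 0)"
  by (cases "s = t") (auto simp: step_quotient_def)

lemma abs_step_quotient_le:
  assumes "g > 0" "g \<le> \<bar>s\<bar>" "g \<le> \<bar>t\<bar>"
  shows "\<bar>step_quotient s t\<bar> \<le> 1 / g"
proof (cases "(s < 0) = (t < 0)")
  case False
  hence "g \<le> \<bar>t - s\<bar>" using assms by auto
  moreover have "\<bar>of_bool (t < 0) - of_bool (s < 0) :: real\<bar> = 1" using False by auto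
  ultimately show ?thesis using assms(1) by (simp add: step_quotient_def abs_divide frac_le)
qed (use assms in \<open>simp add: step_quotient_same_sign\<close>)

definition daletskii_krein :: "nat \<Rightarrow> (nat \<Rightarrow> real) \<Rightarrow> complex mat \<Rightarrow> complex mat" where
  "daletskii_krein n l X = mat n n (\<lambda>(i,j). complex_of_real (step_quotient (l i) (l j)) * X $$ (i,j))"

lemma daletskii_krein_carrier [simp]: "daletskii_krein n l X \<in> carrier_mat n n"
  by (simp add: daletskii_krein_def)

lemma daletskii_krein_index [simp]:
  "i < n \<Longrightarrow> j < n \<Longrightarrow> daletskii_krein n l X $$ (i,j) = complex_of_real (step_quotient (l i) (l j)) * X $$ (i,j)"
  by (simp add: daletskii_krein_def)

locale hermitian_pencil =
  fixes n :: nat and A B U :: "complex mat" and l :: "nat \<Rightarrow> real"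
  assumes decomp: "spectral_decomp n A U l" and nonsingular: "\<not> eigenvalue A 0"
    and B_hermitian: "hermitian n B"
begin

definition pencil_proj :: "real \<Rightarrow> complex mat" where
  "pencil_proj t = neg_proj (A + complex_of_real t \<cdot>\<^sub>m B)"

definition eigenbasis_proj :: "real \<Rightarrow> complex mat" where
  "eigenbasis_proj t = conj_mat (mat_adjoint U) (pencil_proj t)"

lemma U_unitary: "unitary n U"
  by (rule spectral_decomp_unitary[OF decomp])

lemma U_carrier: "U \<in> carrier_mat n n"
  by (rule unitary_carrier[OF U_unitary])

lemma A_hermitian: "hermitian n A"
  by (rule spectral_decomp_hermitian[OF decomp])

lemma pencil_hermitian: "hermitian n (A + complex_of_real t \<cdot>\<^sub>m B)"
  by (rule hermitian_add_smult[OF A_hermitian B_hermitian])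

lemma pencil_proj_carrier [simp]: "pencil_proj t \<in> carrier_mat n n"
  unfolding pencil_proj_def by (rule neg_proj_carrier[OF pencil_hermitian])

lemma eigenbasis_proj_carrier [simp]: "eigenbasis_proj t \<in> carrier_mat n n"
  unfolding eigenbasis_proj_def using U_carrier by simp

lemma eigenbasis_proj_bound:
  fixes t C :: real
  assumes ij: "i < n" "j < n"
  defines "q \<equiv> \<lambda>t. eigenbasis_proj t $$ (i,j) - of_bool (i = j \<and> l i < 0)"
    and "C \<equiv> entry_norm B / spectral_gap A"
  shows "cmod (q t) \<le> n * (C * \<bar>t\<bar>)"
    and "(l i < 0) = (l j < 0) \<Longrightarrow> cmod (q t) \<le> n * (C * \<bar>t\<bar>)\<^sup>2"
proof -
  have gap: "spectral_gap A > 0" using ij A_hermitian nonsingular by (intro spectral_gap_pos) auto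
  obtain W l' where W: "spectral_decomp n (A + complex_of_real t \<cdot>\<^sub>m B) W l'"
    using hermitian_spectral_decomp[OF pencil_hermitian] by blast
  have "A - (A + complex_of_real t \<cdot>\<^sub>m B) = complex_of_real (- t) \<cdot>\<^sub>m B"
    using hermitian_carrier[OF A_hermitian] hermitian_carrier[OF B_hermitian] by (intro eq_matI) auto
  hence dist: "entry_norm (A - (A + complex_of_real t \<cdot>\<^sub>m B)) / spectral_gap A = C * \<bar>t\<bar>"
    by (simp add: entry_norm_smult C_def flip: of_real_minus)
  show "cmod (q t) \<le> n * (C * \<bar>t\<bar>)"
    using neg_proj_perturbation(1)[OF decomp W gap ij]
    unfolding dist q_def eigenbasis_proj_def pencil_proj_def .
  show "cmod (q t) \<le> n * (C * \<bar>t\<bar>)\<^sup>2" if "(l i < 0) = (l j < 0)"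
    using neg_proj_perturbation(2)[OF decomp W gap ij that]
    unfolding dist q_def eigenbasis_proj_def pencil_proj_def .
qed

lemma eigenbasis_proj_0:
  assumes "i < n" "j < n"
  shows "eigenbasis_proj 0 $$ (i,j) = of_bool (i = j \<and> l i < 0)"
  using eigenbasis_proj_bound(1)[OF assms, of 0] by simp

lemma eigenbasis_proj_tendsto:
  assumes "i < n" "j < n"
  shows "((\<lambda>t. eigenbasis_proj t $$ (i,j)) \<longlongrightarrow> of_bool (i = j \<and> l i < 0)) (at 0)"
proof -
  define C where "C = entry_norm B / spectral_gap A"
  have "((\<lambda>t. eigenbasis_proj t $$ (i,j) - of_bool (i = j \<and> l i < 0)) \<longlongrightarrow> 0) (at 0)"
  proof (rule Lim_null_comparison)
    show "\<forall>\<^sub>F t in at 0. cmod (eigenbasis_proj t $$ (i,j) - of_bool (i = j \<and> l i < 0)) \<le> n * (C * \<bar>t\<bar>)"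
      using eigenbasis_proj_bound(1)[OF assms] by (simp add: C_def)
    show "((\<lambda>t. n * (C * \<bar>t\<bar>)) \<longlongrightarrow> 0) (at 0)" by (auto intro!: tendsto_eq_intros)
  qed
  thus ?thesis by (simp add: LIM_zero_iff)
qed

definition eigenbasis_B :: "complex mat" where
  "eigenbasis_B = conj_mat (mat_adjoint U) B"

lemma eigenbasis_B_carrier [simp]: "eigenbasis_B \<in> carrier_mat n n"
  unfolding eigenbasis_B_def using U_carrier B_hermitian hermitian_carrier by simp

lemma eigenbasis_commutator:
  assumes ij: "i < n" "j < n"
  shows "complex_of_real (l i - l j) * eigenbasis_proj t $$ (i,j)
    = - complex_of_real t * (eigenbasis_B * eigenbasis_proj t - eigenbasis_proj t * eigenbasis_B) $$ (i,j)"
proof -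
  define Y where "Y = eigenbasis_proj t"
  define M where "M = real_diag n l + complex_of_real t \<cdot>\<^sub>m eigenbasis_B"
  note B_carrier = hermitian_carrier[OF B_hermitian]
  have Y: "Y \<in> carrier_mat n n" by (simp add: Y_def)
  have "conj_mat (mat_adjoint U) (A + complex_of_real t \<cdot>\<^sub>m B) = M"
    using U_carrier hermitian_carrier[OF A_hermitian] B_carrier spectral_decomp_conj_adjoint[OF decomp]
    by (simp add: M_def eigenbasis_B_def conj_mat_add[of _ n] conj_mat_smult[of _ n])
  moreover have "(A + complex_of_real t \<cdot>\<^sub>m B) * pencil_proj t
      = pencil_proj t * (A + complex_of_real t \<cdot>\<^sub>m B)"
    unfolding pencil_proj_def by (rule neg_proj_commute[OF pencil_hermitian])
  ultimately have "M * Y = Y * M"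
    using conj_mat_mult[OF unitary_adjoint[OF U_unitary]] pencil_hermitian[THEN hermitian_carrier]
    by (metis Y_def eigenbasis_proj_def pencil_proj_carrier)
  hence "real_diag n l * Y + complex_of_real t \<cdot>\<^sub>m (eigenbasis_B * Y)
      = Y * real_diag n l + complex_of_real t \<cdot>\<^sub>m (Y * eigenbasis_B)"
    using Y by (simp add: M_def add_mult_distrib_mat[of _ n n _ _ n] mult_add_distrib_mat[of _ n n _ n]
        mult_smult_assoc_mat[of _ n n _ n] mult_smult_distrib[of _ n n _ n])
  hence "(real_diag n l * Y) $$ (i,j) + complex_of_real t * (eigenbasis_B * Y) $$ (i,j)
      = (Y * real_diag n l) $$ (i,j) + complex_of_real t * (Y * eigenbasis_B) $$ (i,j)"
    using ij Y carrier_matD[OF eigenbasis_B_carrier]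
    by (auto dest!: arg_cong[where f = "\<lambda>X. X $$ (i,j)"] simp del: index_mult_mat(1))
  thus ?thesis
    using ij Y carrier_matD[OF eigenbasis_B_carrier] unfolding Y_def[symmetric]
    by (simp add: mat_diag_mult_left[of _ n n] mat_diag_mult_right[of _ n n] algebra_simps
        del: index_mult_mat(1))
qed

lemma eigenbasis_commutator_tendsto:
  assumes ij: "i < n" "j < n"
  shows "((\<lambda>t. (eigenbasis_B * eigenbasis_proj t - eigenbasis_proj t * eigenbasis_B) $$ (i,j))
    \<longlongrightarrow> (of_bool (l j < 0) - of_bool (l i < 0)) * eigenbasis_B $$ (i,j)) (at 0)"
proof -
  let ?D = "neg_diag n l"
  have index: "(eigenbasis_B * Y - Y * eigenbasis_B) $$ (i,j)
      = (\<Sum>k<n. eigenbasis_B $$ (i,k) * Y $$ (k,j)) - (\<Sum>k<n. Y $$ (i,k) * eigenbasis_B $$ (k,j))"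
    if "Y \<in> carrier_mat n n" for Y
    using that ij carrier_matD[OF eigenbasis_B_carrier]
    by (simp add: mult_mat_index_sum[of _ n n _ n] del: index_mult_mat(1))
  have "((\<lambda>t. eigenbasis_proj t $$ (k,k')) \<longlongrightarrow> ?D $$ (k,k')) (at 0)" if "k < n" "k' < n" for k k'
    using eigenbasis_proj_tendsto[OF that] that by (cases "k = k'") auto
  hence "((\<lambda>t. (eigenbasis_B * eigenbasis_proj t - eigenbasis_proj t * eigenbasis_B) $$ (i,j))
      \<longlongrightarrow> (eigenbasis_B * ?D - ?D * eigenbasis_B) $$ (i,j)) (at 0)"
    unfolding index[OF eigenbasis_proj_carrier] index[OF mat_diag_dim] using ij by (intro tendsto_intros) auto
  thus ?thesis
    using ij by (simp add: mat_diag_mult_left[of _ n n] mat_diag_mult_right[of _ n n] algebra_simps)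
qed

lemma eigenbasis_proj_has_derivative:
  assumes ij: "i < n" "j < n"
  shows "((\<lambda>t. eigenbasis_proj t $$ (i,j))
      has_vector_derivative daletskii_krein n l eigenbasis_B $$ (i,j)) (at 0)"
proof (cases "(l i < 0) = (l j < 0)")
  case True
  define C where "C = entry_norm B / spectral_gap A"
  have "n * (C * \<bar>t\<bar>)\<^sup>2 = (n * C\<^sup>2) * t\<^sup>2" for t by (simp add: power_mult_distrib)
  hence "cmod (eigenbasis_proj t $$ (i,j) - eigenbasis_proj 0 $$ (i,j)) \<le> (n * C\<^sup>2) * t\<^sup>2" for t
    using eigenbasis_proj_bound(2)[OF ij True, of t] unfolding eigenbasis_proj_0[OF ij] C_def by metis
  hence "((\<lambda>t. eigenbasis_proj t $$ (i,j)) has_vector_derivative 0) (at 0)"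
    by (rule has_vector_derivative_0_of_quadratic_bound)
  thus ?thesis using ij True by (simp add: step_quotient_same_sign)
next
  case False
  hence opposite: "complex_of_real (l i - l j) \<noteq> 0" "\<not> (i = j \<and> l i < 0)" by auto
  define e where "e t = - ((eigenbasis_B * eigenbasis_proj t - eigenbasis_proj t * eigenbasis_B) $$ (i,j))
      / complex_of_real (l i - l j)" for t
  have "eigenbasis_proj t $$ (i,j) = eigenbasis_proj 0 $$ (i,j) + t *\<^sub>R e t" for t
  proof -
    have "complex_of_real (l i - l j) * eigenbasis_proj t $$ (i,j)
        = complex_of_real (l i - l j) * (t *\<^sub>R e t)"
      unfolding eigenbasis_commutator[OF ij] e_def using opposite(1)
      by (simp add: scaleR_conv_of_real del: of_real_diff)
    hence "eigenbasis_proj t $$ (i,j) = t *\<^sub>R e t" by (simp only: mult_left_cancel[OF opposite(1)])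
    moreover have "eigenbasis_proj 0 $$ (i,j) = 0" using opposite(2) by (simp add: eigenbasis_proj_0[OF ij])
    ultimately show ?thesis by simp
  qed
  moreover have "(e \<longlongrightarrow>
      - ((of_bool (l j < 0) - of_bool (l i < 0)) * eigenbasis_B $$ (i,j)) / complex_of_real (l i - l j)) (at 0)"
    unfolding e_def by (intro tendsto_intros eigenbasis_commutator_tendsto ij opposite(1))
  ultimately have "((\<lambda>t. eigenbasis_proj t $$ (i,j)) has_vector_derivative
      - ((of_bool (l j < 0) - of_bool (l i < 0)) * eigenbasis_B $$ (i,j)) / complex_of_real (l i - l j)) (at 0)"
    by (rule has_vector_derivative_at_0I)
  also have "- ((of_bool (l j < 0) - of_bool (l i < 0)) * eigenbasis_B $$ (i,j)) / complex_of_real (l i - l j)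
      = daletskii_krein n l eigenbasis_B $$ (i,j)"
    using ij opposite by (simp add: step_quotient_def field_simps)
  finally show ?thesis .
qed

theorem pencil_proj_has_derivative:
  assumes ab: "a < n" "b < n"
  shows "((\<lambda>t. pencil_proj t $$ (a,b))
      has_vector_derivative conj_mat U (daletskii_krein n l eigenbasis_B) $$ (a,b)) (at 0)"
proof -
  have "pencil_proj t = conj_mat U (eigenbasis_proj t)" for t
    unfolding eigenbasis_proj_def by (rule conj_mat_adjoint_cancel[OF U_unitary, symmetric]) simp
  hence "pencil_proj t $$ (a,b) = (\<Sum>i<n. \<Sum>j<n. U $$ (a,i) * eigenbasis_proj t $$ (i,j) * cnj (U $$ (b,j)))"
    for t
    using conj_mat_index[OF U_carrier eigenbasis_proj_carrier ab] by simp
  moreover have "((\<lambda>t. \<Sum>i<n. \<Sum>j<n. U $$ (a,i) * eigenbasis_proj t $$ (i,j) * cnj (U $$ (b,j)))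
      has_vector_derivative conj_mat U (daletskii_krein n l eigenbasis_B) $$ (a,b)) (at 0)"
    unfolding conj_mat_index[OF U_carrier daletskii_krein_carrier ab]
    by (intro has_vector_derivative_sum has_vector_derivative_mult_left has_vector_derivative_mult_right
        eigenbasis_proj_has_derivative) auto
  ultimately show ?thesis by simp
qed

end

definition neg_proj_deriv :: "nat \<Rightarrow> complex mat \<Rightarrow> complex mat \<Rightarrow> complex mat" where
  "neg_proj_deriv n A B = mat n n (\<lambda>(a,b).
     vector_derivative (\<lambda>t. neg_proj (A + complex_of_real t \<cdot>\<^sub>m B) $$ (a,b)) (at 0))"

lemma neg_proj_deriv_carrier [simp]: "neg_proj_deriv n A B \<in> carrier_mat n n"
  by (simp add: neg_proj_deriv_def)

lemma neg_proj_deriv_eq: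
  assumes "spectral_decomp n A U l" "\<not> eigenvalue A 0" "hermitian n B"
  shows "neg_proj_deriv n A B = conj_mat U (daletskii_krein n l (conj_mat (mat_adjoint U) B))"
proof (rule carrier_eq_matI[OF neg_proj_deriv_carrier])
  interpret hermitian_pencil n A B U l using assms by unfold_locales
  show "conj_mat U (daletskii_krein n l (conj_mat (mat_adjoint U) B)) \<in> carrier_mat n n"
    using U_carrier by simp
  fix a b assume ab: "a < n" "b < n"
  thus "neg_proj_deriv n A B $$ (a,b)
      = conj_mat U (daletskii_krein n l (conj_mat (mat_adjoint U) B)) $$ (a,b)"
    using vector_derivative_at[OF pencil_proj_has_derivative[OF ab]]
    by (simp add: neg_proj_deriv_def pencil_proj_def eigenbasis_B_def)
qed

lemma neg_proj_has_derivative: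
  assumes "hermitian n A" "\<not> eigenvalue A 0" "hermitian n B" and ab: "a < n" "b < n"
  shows "((\<lambda>t. neg_proj (A + complex_of_real t \<cdot>\<^sub>m B) $$ (a,b))
      has_vector_derivative neg_proj_deriv n A B $$ (a,b)) (at 0)"
proof -
  obtain U l where decomp: "spectral_decomp n A U l" using hermitian_spectral_decomp[OF assms(1)] by blast
  interpret hermitian_pencil n A B U l using decomp assms by unfold_locales
  show ?thesis
    using pencil_proj_has_derivative[OF ab]
    by (simp add: neg_proj_deriv_eq[OF decomp assms(2,3)] pencil_proj_def eigenbasis_B_def)
qed

lemma neg_proj_deriv_lincomb:
  assumes "hermitian n A" "\<not> eigenvalue A 0" "hermitian n B" "hermitian n C"
  shows "neg_proj_deriv n A (complex_of_real x \<cdot>\<^sub>m B + complex_of_real y \<cdot>\<^sub>m C)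
    = complex_of_real x \<cdot>\<^sub>m neg_proj_deriv n A B + complex_of_real y \<cdot>\<^sub>m neg_proj_deriv n A C"
proof -
  obtain U l where decomp: "spectral_decomp n A U l" using hermitian_spectral_decomp[OF assms(1)] by blast
  note carrier = unitary_carrier[OF spectral_decomp_unitary[OF decomp]] assms(3,4)[THEN hermitian_carrier]
  have herm: "hermitian n (complex_of_real x \<cdot>\<^sub>m B + complex_of_real y \<cdot>\<^sub>m C)"
    using assms(3,4) by (auto simp: hermitian_iff_index)
  have linear: "daletskii_krein n l (complex_of_real x \<cdot>\<^sub>m X + complex_of_real y \<cdot>\<^sub>m Y)
      = complex_of_real x \<cdot>\<^sub>m daletskii_krein n l X + complex_of_real y \<cdot>\<^sub>m daletskii_krein n l Y"
    if "X \<in> carrier_mat n n" "Y \<in> carrier_mat n n" for X Y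
    using that carrier_matD[OF daletskii_krein_carrier] by (intro eq_matI) (auto simp: algebra_simps)
  show ?thesis
    using carrier by (simp add: neg_proj_deriv_eq[OF decomp assms(2)]
        herm assms(3,4) linear conj_mat_add[of _ n] conj_mat_smult[of _ n])
qed

lemma neg_proj_deriv_self:
  assumes "hermitian n A" "\<not> eigenvalue A 0"
  shows "neg_proj_deriv n A A = 0\<^sub>m n n"
proof -
  obtain U l where decomp: "spectral_decomp n A U l" using hermitian_spectral_decomp[OF assms(1)] by blast
  note U = unitary_carrier[OF spectral_decomp_unitary[OF decomp]]
  have "daletskii_krein n l (real_diag n l) = 0\<^sub>m n n"
    using carrier_matD[OF daletskii_krein_carrier] by (intro eq_matI) (auto simp: step_quotient_same_sign)
  moreover have "conj_mat U (0\<^sub>m n n) = 0\<^sub>m n n" using U by (simp add: conj_mat_def)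
  ultimately show ?thesis by (simp add: neg_proj_deriv_eq[OF decomp assms(2,1)]
      spectral_decomp_conj_adjoint[OF decomp])
qed

lemma neg_proj_deriv_tangent:
  assumes "hermitian n A" "\<not> eigenvalue A 0" "hermitian n B"
  shows "neg_proj A * neg_proj_deriv n A B + neg_proj_deriv n A B * neg_proj A = neg_proj_deriv n A B"
proof -
  obtain U l where decomp: "spectral_decomp n A U l" using hermitian_spectral_decomp[OF assms(1)] by blast
  note U = spectral_decomp_unitary[OF decomp]
  let ?D = "neg_diag n l"
    and ?X = "daletskii_krein n l (conj_mat (mat_adjoint U) B)"
  have "?D * ?X + ?X * ?D = ?X"
  proof (rule carrier_eq_matI[of _ n n])
    fix i j assume ij: "i < n" "j < n"
    show "(?D * ?X + ?X * ?D) $$ (i,j) = ?X $$ (i,j)"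
      using ij by (cases "(l i < 0) = (l j < 0)")
        (auto simp: mat_diag_mult_left[of _ n n] mat_diag_mult_right[of _ n n] step_quotient_same_sign)
  qed auto
  thus ?thesis
    unfolding neg_proj_deriv_eq[OF decomp assms(2,3)] neg_proj_eq[OF decomp]
    using unitary_carrier[OF U] by (simp flip: conj_mat_mult[OF U] conj_mat_add[of _ n])
qed

lemma neg_proj_deriv_commutator:
  assumes A: "hermitian n A" "\<not> eigenvalue A 0" and B: "hermitian n B" and N: "N \<in> carrier_mat n n"
    and B_eq: "B = \<i> \<cdot>\<^sub>m (N * A - A * N)"
  shows "neg_proj_deriv n A B = \<i> \<cdot>\<^sub>m (N * neg_proj A - neg_proj A * N)"
proof -
  obtain U l where decomp: "spectral_decomp n A U l" using hermitian_spectral_decomp[OF A(1)] by blast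
  note U = spectral_decomp_unitary[OF decomp]
  note carrier = unitary_carrier[OF U] hermitian_carrier[OF A(1)] N
  define M where "M = conj_mat (mat_adjoint U) N"
  let ?D = "neg_diag n l"
  have M: "M \<in> carrier_mat n n" "N = conj_mat U M"
    using carrier by (auto simp: M_def conj_mat_adjoint_cancel[OF U])
  have "conj_mat (mat_adjoint U) B = \<i> \<cdot>\<^sub>m (M * real_diag n l - real_diag n l * M)"
    unfolding B_eq M_def using carrier
    by (simp add: conj_mat_smult[of _ n] conj_mat_minus[of _ n] conj_mat_mult[OF unitary_adjoint[OF U]]
        spectral_decomp_conj_adjoint[OF decomp])
  moreover have "daletskii_krein n l (\<i> \<cdot>\<^sub>m (M * real_diag n l - real_diag n l * M))
      = \<i> \<cdot>\<^sub>m (M * ?D - ?D * M)"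
  proof (rule carrier_eq_matI[of _ n n])
    fix i j assume ij: "i < n" "j < n"
    have "daletskii_krein n l (\<i> \<cdot>\<^sub>m (M * real_diag n l - real_diag n l * M)) $$ (i,j)
        = complex_of_real (step_quotient (l i) (l j) * (l j - l i)) * (\<i> * M $$ (i,j))"
      using ij M(1) by (simp add: mat_diag_mult_left[of _ n n] mat_diag_mult_right[of _ n n] algebra_simps)
    also have "\<dots> = (\<i> \<cdot>\<^sub>m (M * ?D - ?D * M)) $$ (i,j)"
      unfolding step_quotient_mult
      using ij M(1) by (simp add: mat_diag_mult_left[of _ n n] mat_diag_mult_right[of _ n n] algebra_simps)
    finally show "daletskii_krein n l (\<i> \<cdot>\<^sub>m (M * real_diag n l - real_diag n l * M)) $$ (i,j)
        = (\<i> \<cdot>\<^sub>m (M * ?D - ?D * M)) $$ (i,j)" .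
  qed (use M(1) in auto)
  ultimately have "neg_proj_deriv n A B = conj_mat U (\<i> \<cdot>\<^sub>m (M * ?D - ?D * M))"
    by (simp add: neg_proj_deriv_eq[OF decomp A(2) B])
  thus ?thesis
    unfolding neg_proj_eq[OF decomp] using M carrier
    by (simp add: conj_mat_smult[of _ n] conj_mat_minus[of _ n] conj_mat_mult[OF U])
qed

lemma neg_proj_deriv_entry_bound:
  assumes A: "hermitian n A" "\<not> eigenvalue A 0" and B: "hermitian n B" and ab: "a < n" "b < n"
  shows "cmod (neg_proj_deriv n A B $$ (a,b)) \<le> (real n)\<^sup>2 * (entry_norm B / spectral_gap A)"
proof -
  obtain U l where decomp: "spectral_decomp n A U l" using hermitian_spectral_decomp[OF A(1)] by blast
  note U = spectral_decomp_unitary[OF decomp]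
  have gap: "spectral_gap A > 0" using ab A by (intro spectral_gap_pos) auto
  define X where "X = conj_mat (mat_adjoint U) B"
  have "cmod (neg_proj_deriv n A B $$ (a,b)) \<le> entry_norm (daletskii_krein n l X)"
    unfolding neg_proj_deriv_eq[OF decomp A(2) B] X_def by (intro conj_mat_entry_bound[OF U] ab) simp
  also have "\<dots> \<le> (real n)\<^sup>2 * (entry_norm B / spectral_gap A)"
  proof (rule entry_norm_le)
    fix i j assume ij: "i < n" "j < n"
    have "cmod (daletskii_krein n l X $$ (i,j)) = \<bar>step_quotient (l i) (l j)\<bar> * cmod (X $$ (i,j))"
      using ij by (simp add: norm_mult)
    also have "\<dots> \<le> (1 / spectral_gap A) * entry_norm B"
      unfolding X_def using ij gap spectral_gap_le[OF decomp] hermitian_carrier[OF B]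
      by (intro mult_mono abs_step_quotient_le conj_mat_entry_bound[OF unitary_adjoint[OF U]]) auto
    finally show "cmod (daletskii_krein n l X $$ (i,j)) \<le> entry_norm B / spectral_gap A" by simp
  qed simp
  finally show ?thesis .
qed

lemma projector_tangent_compression:
  fixes P S :: "complex mat"
  assumes carrier: "P \<in> carrier_mat n n" "S \<in> carrier_mat n n"
    and idem: "P * P = P" and tangent: "P * S + S * P = S"
  shows "P * (S * P) = 0\<^sub>m n n"
proof (rule carrier_eq_matI[of _ n n])
  note assoc = assoc_mult_mat[of _ n n _ n _ n]
  have idem_left: "P * (P * X) = P * X" if "X \<in> carrier_mat n n" for X
    using carrier that by (simp add: idem flip: assoc)
  have "P * (S * P) = P * ((P * S + S * P) * P)" by (simp add: tangent)
  also have "\<dots> = P * (S * P) + P * (S * P)"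
    using carrier
    by (simp add: mult_add_distrib_mat[of _ n n _ n] add_mult_distrib_mat[of _ n n _ _ n]
        assoc idem idem_left)
  finally have double: "P * (S * P) = P * (S * P) + P * (S * P)" .
  fix i j assume "i < n" "j < n"
  thus "(P * (S * P)) $$ (i,j) = 0\<^sub>m n n $$ (i,j)"
    using arg_cong[OF double, of "\<lambda>X. X $$ (i,j)"] carrier by (simp del: index_mult_mat(1))
qed (use carrier in auto)

lemma mtrace_projector_commutator:
  fixes P S N :: "complex mat"
  assumes carrier: "P \<in> carrier_mat n n" "S \<in> carrier_mat n n" "N \<in> carrier_mat n n"
    and idem: "P * P = P" and tangent: "P * S + S * P = S"
  defines "T \<equiv> N * P - P * N"
  shows "mtrace (P * (S * T - T * S)) = mtrace (N * S)"
proof -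
  note assoc = assoc_mult_mat[of _ n n _ n _ n]
  note PSP = projector_tangent_compression[OF carrier(1,2) idem tangent]
  have idem_left: "P * (P * X) = P * X" if "X \<in> carrier_mat n n" for X
    using carrier that by (simp add: idem flip: assoc)
  have "P * (S * T - T * S) = P * (S * (N * P)) - P * (S * P) * N - (P * (N * (P * S)) - P * (N * S))"
    using carrier by (simp add: T_def mult_minus_distrib_mat[of _ n n _ n]
        minus_mult_distrib_mat[of _ n n _ _ n] assoc idem_left)
  also have "mtrace \<dots> = mtrace (P * (S * (N * P))) - mtrace (P * (N * (P * S))) + mtrace (P * (N * S))"
    using carrier by (simp add: PSP mtrace_minus[of _ n] left_mult_zero_mat[of _ n n])
  also have "mtrace (P * (S * (N * P))) = mtrace (S * (N * P) * P)"
    using carrier by (intro mtrace_mult_comm) auto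
  also have "S * (N * P) * P = S * (N * P)" using carrier by (simp add: assoc idem)
  also have "mtrace (S * (N * P)) = mtrace (N * (P * S))"
    using carrier mtrace_mult_comm[of S n n "N * P"] by (simp add: assoc)
  also have "mtrace (P * (N * (P * S))) = mtrace (N * (P * S * P))"
    using carrier mtrace_mult_comm[of P n n "N * (P * S)"] by (simp add: assoc)
  also have "\<dots> = 0" using carrier by (simp add: assoc PSP)
  also have "mtrace (P * (N * S)) = mtrace (N * (S * P))"
    using carrier mtrace_mult_comm[of P n n "N * S"] by (simp add: assoc)
  also have "mtrace (N * (P * S)) - 0 + mtrace (N * (S * P)) = mtrace (N * (P * S + S * P))"
    using carrier by (simp add: mtrace_add[of _ n] mult_add_distrib_mat[of _ n n _ n])
  finally show ?thesis by (simp add: tangent)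
qed

lemma commutator_rotation:
  fixes X Y :: "complex mat" and x y :: complex
  assumes carrier: "X \<in> carrier_mat n n" "Y \<in> carrier_mat n n"
  defines "S \<equiv> x \<cdot>\<^sub>m X + y \<cdot>\<^sub>m Y" and "T \<equiv> - y \<cdot>\<^sub>m X + x \<cdot>\<^sub>m Y"
  shows "S * T - T * S = (x\<^sup>2 + y\<^sup>2) \<cdot>\<^sub>m (X * Y - Y * X)"
proof (rule carrier_eq_matI[of _ n n])
  fix i j assume ij: "i < n" "j < n"
  have "(S * T - T * S) $$ (i,j) = (\<Sum>k<n. S $$ (i,k) * T $$ (k,j) - T $$ (i,k) * S $$ (k,j))"
    using carrier ij by (simp add: S_def T_def mult_mat_index_sum[of _ n n _ n] sum_subtractf
        del: index_mult_mat(1))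
  also have "\<dots> = (\<Sum>k<n. (x\<^sup>2 + y\<^sup>2) * (X $$ (i,k) * Y $$ (k,j) - Y $$ (i,k) * X $$ (k,j)))"
    using carrier ij by (intro sum.cong) (auto simp: S_def T_def power2_eq_square algebra_simps)
  also have "\<dots> = ((x\<^sup>2 + y\<^sup>2) \<cdot>\<^sub>m (X * Y - Y * X)) $$ (i,j)"
    using carrier ij by (simp add: mult_mat_index_sum[of _ n n _ n] sum_subtractf
        flip: sum_distrib_left del: index_mult_mat(1))
  finally show "(S * T - T * S) $$ (i,j) = ((x\<^sup>2 + y\<^sup>2) \<cdot>\<^sub>m (X * Y - Y * X)) $$ (i,j)" .
qed (use carrier in \<open>auto simp: S_def T_def\<close>)

section \<open>Integrals of radial functions\<close>

lemma distr_lborel_norm_complex: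
  "distr lborel borel (norm :: complex \<Rightarrow> real)
     = density lborel (\<lambda>r. ennreal (2 * pi * r * indicator {0..} r))" (is "?D = ?E")
proof (rule measure_eqI_generator_eq[where \<Omega> = UNIV and E = "range atMost" and A = "\<lambda>i. {..real i}"])
  have distr: "emeasure ?D {..a} = emeasure lborel (cball (0::complex) a)" for a
    by (subst emeasure_distr) (auto simp: cball_def vimage_def)
  have density: "emeasure ?E {..a} = (\<integral>\<^sup>+r. ennreal (2 * pi * r) * indicator {0..a} r \<partial>lborel)" for a
    by (subst emeasure_density) (auto intro!: nn_integral_cong split: split_indicator)
  show "Int_stable (range (atMost :: real \<Rightarrow> real set))"
    by (auto simp: Int_stable_def)
  show "emeasure ?D X = emeasure ?E X" if "X \<in> range atMost" for X
  proof -
    from that obtain a where X: "X = {..a}" by blast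
    show ?thesis
    proof (cases "a \<ge> 0")
      case True
      have "(\<integral>\<^sup>+r. ennreal (2 * pi * r) * indicator {0..a} r \<partial>lborel) = ennreal (pi * a\<^sup>2 - pi * 0\<^sup>2)"
        using True by (intro nn_integral_FTC_Icc) (auto intro!: derivative_eq_intros)
      moreover have "emeasure lborel (cball (0::complex) a) = ennreal (pi * a\<^sup>2)"
        using emeasure_cball[OF True, of "0::complex"] by (simp add: unit_ball_vol_2)
      ultimately show ?thesis by (simp add: X distr density)
    qed (simp add: X distr density)
  qed
  show "emeasure ?D {..real i} \<noteq> \<infinity>" for i
    unfolding distr using emeasure_lborel_cball_finite[of "0::complex" "real i"] by simp
  show "(\<Union>i. {..real i}) = UNIV" by (auto intro: real_arch_simple)
qed (auto simp: borel_eq_atMost sets_measure_of)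

lemma has_integral_radial:
  fixes f :: "real \<Rightarrow> real"
  assumes [measurable]: "f \<in> borel_measurable borel" and int: "set_integrable lborel {0..} (\<lambda>r. r * f r)"
  shows "((\<lambda>z::complex. f (norm z)) has_integral 2 * pi * (LINT r:{0..}|lborel. r * f r)) UNIV"
proof -
  define w where "w r = 2 * pi * r * indicator {0..} r" for r :: real
  have [measurable]: "w \<in> borel_measurable borel" unfolding w_def[abs_def] by simp
  have w: "AE r in lborel. 0 \<le> w r" by (intro AE_I2) (auto simp: w_def indicator_def)
  have distr: "distr lborel borel (norm :: complex \<Rightarrow> real) = density lborel (\<lambda>r. ennreal (w r))"
    unfolding w_def by (rule distr_lborel_norm_complex)
  have w_mult: "w r *\<^sub>R f r = 2 * pi * (indicator {0..} r *\<^sub>R (r * f r))" for r by (simp add: w_def)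
  have "integrable lborel (\<lambda>r. w r *\<^sub>R f r)"
    using int unfolding w_mult set_integrable_def by (rule integrable_mult_right)
  hence "integrable (density lborel (\<lambda>r. ennreal (w r))) f"
    by (subst integrable_density) (use w in auto)
  hence integrable: "integrable lborel (\<lambda>z::complex. f (norm z))"
    unfolding distr[symmetric] by (subst (asm) integrable_distr_eq) auto
  have "(LINT z::complex|lborel. f (norm z)) = integral\<^sup>L (distr lborel borel (norm :: complex \<Rightarrow> real)) f"
    by (subst integral_distr) auto
  also have "\<dots> = (LINT r|lborel. w r *\<^sub>R f r)"
    unfolding distr by (subst integral_density) (use w in auto)
  also have "\<dots> = 2 * pi * (LINT r:{0..}|lborel. r * f r)"
    unfolding w_mult by (simp add: set_lebesgue_integral_def)
  finally show ?thesis using has_integral_integral_lborel[OF integrable] by simp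
qed

lemma borel_measurable_real_derivative:
  fixes G g :: "real \<Rightarrow> real"
  assumes deriv: "\<And>r. (G has_real_derivative g r) (at r)"
  shows "g \<in> borel_measurable borel"
proof (rule borel_measurable_LIMSEQ_real)
  have "continuous_on UNIV G" using deriv by (auto intro!: DERIV_continuous_on)
  hence [measurable]: "G \<in> borel_measurable borel" by (rule borel_measurable_continuous_onI)
  show "(\<lambda>r. (G (r + 1 / real (Suc n)) - G r) / (1 / real (Suc n))) \<in> borel_measurable borel" for n
    by simp
  fix r
  have "((\<lambda>h. (G (r + h) - G r) / h) \<longlongrightarrow> g r) (at 0)" using deriv[of r] by (simp add: DERIV_def)
  moreover have "filterlim (\<lambda>n. 1 / real (Suc n)) (at 0) sequentially"
    unfolding filterlim_at using LIMSEQ_inverse_real_of_nat by (auto simp: inverse_eq_divide)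
  ultimately show "(\<lambda>n. (G (r + 1 / real (Suc n)) - G r) / (1 / real (Suc n))) \<longlonglongrightarrow> g r"
    by (rule filterlim_compose)
qed

lemma set_integrable_inverse_quadratic: "set_integrable lborel {0..} (\<lambda>r::real. 1 / (1 + r\<^sup>2))"
  unfolding set_integrable_def
proof (rule integrableI_bounded)
  have "(\<integral>\<^sup>+r. ennreal (norm (indicator {0..} (r::real) *\<^sub>R (1 / (1 + r\<^sup>2)))) \<partial>lborel)
      = (\<integral>\<^sup>+r. ennreal (1 / (1 + r\<^sup>2)) * indicator {0..} r \<partial>lborel)"
    by (intro nn_integral_cong) (auto split: split_indicator)
  also have "\<dots> = ennreal (pi / 2 - arctan 0)"
    by (intro nn_integral_FTC_atLeast tendsto_arctan_at_top)
      (auto intro!: derivative_eq_intros simp: inverse_eq_divide)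
  finally show "(\<integral>\<^sup>+r. ennreal (norm (indicator {0..} (r::real) *\<^sub>R (1 / (1 + r\<^sup>2)))) \<partial>lborel) < \<infinity>" by simp
qed simp

lemma set_integrable_quadratic_decay:
  fixes g :: "real \<Rightarrow> real"
  assumes [measurable]: "g \<in> borel_measurable borel" and bound: "\<And>r. r \<ge> 0 \<Longrightarrow> \<bar>g r\<bar> * (1 + r\<^sup>2) \<le> C"
  shows "set_integrable lborel {0..} g"
proof (rule set_integrable_bound)
  show "set_integrable lborel {0..} (\<lambda>r. C * (1 / (1 + r\<^sup>2)))"
    by (intro set_integrable_mult_right set_integrable_inverse_quadratic)
  have "norm (g r) \<le> norm (C * (1 / (1 + r\<^sup>2)))" if "r \<ge> 0" for r
  proof -
    have "1 + r\<^sup>2 > 0" by (simp add: add_pos_nonneg)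
    hence "\<bar>g r\<bar> \<le> C * (1 / (1 + r\<^sup>2))" using bound[OF that] by (simp add: pos_le_divide_eq)
    also have "\<dots> \<le> norm (C * (1 / (1 + r\<^sup>2)))" unfolding real_norm_def by (rule abs_ge_self)
    finally show ?thesis by simp
  qed
  thus "AE r in lborel. r \<in> {0..} \<longrightarrow> norm (g r) \<le> norm (C * (1 / (1 + r\<^sup>2)))" by simp
qed (simp add: set_borel_measurable_def)

lemma integral_FTC_at_top:
  fixes G g :: "real \<Rightarrow> real"
  assumes deriv: "\<And>r. (G has_real_derivative g r) (at r)" and int: "set_integrable lborel {a..} g"
    and lim: "(G \<longlongrightarrow> L) at_top"
  shows "(LINT r:{a..}|lborel. g r) = L - G a"
proof (rule tendsto_unique[OF trivial_limit_at_top_linorder])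
  show "((\<lambda>b. LINT r:{a..b}|lborel. g r) \<longlongrightarrow> (LINT r:{a..}|lborel. g r)) at_top"
    using int by (intro tendsto_set_lebesgue_integral_at_top) auto
  have "(LINT r:{a..b}|lborel. g r) = G b - G a" if "b \<ge> a" for b
  proof -
    have "set_integrable lborel {a..b} g" using int by (rule set_integrable_subset) auto
    hence "(LINT r:{a..b}|lborel. g r) = integral {a..b} g" by (rule set_borel_integral_eq_integral(2))
    also have "\<dots> = G b - G a"
      using that deriv by (intro integral_unique fundamental_theorem_of_calculus)
        (auto simp: has_real_derivative_iff_has_vector_derivative[symmetric] intro: DERIV_subset)
    finally show ?thesis .
  qed
  hence "\<forall>\<^sub>F b in at_top. G b - G a = (LINT r:{a..b}|lborel. g r)"
    by (intro eventually_mono[OF eventually_ge_at_top[of a]]) simp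
  moreover have "((\<lambda>b. G b - G a) \<longlongrightarrow> L - G a) at_top" by (intro tendsto_intros lim)
  ultimately show "((\<lambda>b. LINT r:{a..b}|lborel. g r) \<longlongrightarrow> L - G a) at_top"
    by (rule Lim_transform_eventually[rotated])
qed

theorem radial_derivative_has_integral:
  fixes G g :: "real \<Rightarrow> real"
  assumes deriv: "\<And>r. (G has_real_derivative g r) (at r)"
    and bound: "\<And>r. r \<ge> 0 \<Longrightarrow> \<bar>g r\<bar> * (1 + r\<^sup>2) \<le> C"
    and lim: "(G \<longlongrightarrow> L) at_top"
  shows "((\<lambda>z::complex. g (norm z) / norm z) has_integral 2 * pi * (L - G 0)) UNIV"
proof -
  have [measurable]: "g \<in> borel_measurable borel" by (rule borel_measurable_real_derivative[OF deriv])
  have int: "set_integrable lborel {0..} g" by (rule set_integrable_quadratic_decay[OF _ bound]) auto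
  have AE_eq: "AE r in lborel. r \<in> {0..} \<longrightarrow> g r = r * (g r / r)"
    using AE_lborel_singleton[of "0::real"] by eventually_elim auto
  have "set_integrable lborel {0..} (\<lambda>r. r * (g r / r))"
    using int AE_eq by (subst (asm) set_integrable_cong_AE) auto
  moreover have "(LINT r:{0..}|lborel. r * (g r / r)) = L - G 0"
    using integral_FTC_at_top[OF deriv int lim] AE_eq by (subst (asm) set_lebesgue_integral_cong_AE) auto
  ultimately show ?thesis using has_integral_radial[of "\<lambda>r. g r / r"] by simp
qed

section \<open>Matrices supported on an involution\<close>

definition index_involution :: "nat \<Rightarrow> (nat \<Rightarrow> nat) \<Rightarrow> bool" where
  "index_involution n \<sigma> \<longleftrightarrow> (\<forall>i<n. \<sigma> i < n \<and> \<sigma> (\<sigma> i) = i)"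

definition pair_mat :: "nat \<Rightarrow> (nat \<Rightarrow> nat) \<Rightarrow> (nat \<Rightarrow> complex) \<Rightarrow> (nat \<Rightarrow> complex) \<Rightarrow> complex mat" where
  "pair_mat n \<sigma> a b = mat n n (\<lambda>(i,j). (if j = i then a i else 0) + (if j = \<sigma> i then b i else 0))"

lemma pair_mat_carrier [simp]: "pair_mat n \<sigma> a b \<in> carrier_mat n n"
  by (simp add: pair_mat_def)

lemma pair_mat_dims [simp]: "dim_row (pair_mat n \<sigma> a b) = n" "dim_col (pair_mat n \<sigma> a b) = n"
  by (simp_all add: pair_mat_def)

lemma pair_mat_index:
  "i < n \<Longrightarrow> j < n \<Longrightarrow> pair_mat n \<sigma> a b $$ (i,j) = (if j = i then a i else 0) + (if j = \<sigma> i then b i else 0)"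
  by (simp add: pair_mat_def)

lemma pair_mat_cong:
  assumes "\<And>i. i < n \<Longrightarrow> a i = a' i" "\<And>i. i < n \<Longrightarrow> b i = b' i"
  shows "pair_mat n \<sigma> a b = pair_mat n \<sigma> a' b'"
  using assms by (intro eq_matI) (auto simp: pair_mat_index)

lemma mat_diag_eq_pair_mat: "mat_diag n f = pair_mat n \<sigma> f (\<lambda>_. 0)"
  by (intro eq_matI) (auto simp: pair_mat_index)

lemma pair_mat_mult:
  assumes \<sigma>: "index_involution n \<sigma>"
  shows "pair_mat n \<sigma> a b * pair_mat n \<sigma> c d
    = pair_mat n \<sigma> (\<lambda>i. a i * c i + b i * d (\<sigma> i)) (\<lambda>i. a i * d i + b i * c (\<sigma> i))" (is "?M * ?N = ?MN")
proof (rule carrier_eq_matI[of _ n n])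
  fix i j assume ij: "i < n" "j < n"
  hence \<sigma>i: "\<sigma> i < n" "\<sigma> (\<sigma> i) = i" using \<sigma> by (auto simp: index_involution_def)
  have "(?M * ?N) $$ (i,j)
      = (\<Sum>k<n. (if k = i then a i * ?N $$ (k,j) else 0) + (if k = \<sigma> i then b i * ?N $$ (k,j) else 0))"
    unfolding mult_mat_index_sum[OF pair_mat_carrier pair_mat_carrier ij]
    using ij by (intro sum.cong) (auto simp: pair_mat_index distrib_right)
  also have "\<dots> = a i * ?N $$ (i,j) + b i * ?N $$ (\<sigma> i,j)" using ij \<sigma>i by (simp add: sum.distrib)
  also have "\<dots> = ?MN $$ (i,j)" using ij \<sigma>i by (simp add: pair_mat_index algebra_simps)
  finally show "(?M * ?N) $$ (i,j) = ?MN $$ (i,j)" .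
qed auto

lemma mat_adjoint_pair_mat:
  assumes "index_involution n \<sigma>"
  shows "mat_adjoint (pair_mat n \<sigma> a b) = pair_mat n \<sigma> (\<lambda>i. cnj (a i)) (\<lambda>i. cnj (b (\<sigma> i)))" (is "_ = ?M")
proof (rule carrier_eq_matI[of _ n n])
  fix i j assume ij: "i < n" "j < n"
  hence "i = \<sigma> j \<longleftrightarrow> j = \<sigma> i" using assms unfolding index_involution_def by metis
  thus "mat_adjoint (pair_mat n \<sigma> a b) $$ (i,j) = ?M $$ (i,j)" using ij by (auto simp: pair_mat_index)
qed auto

section \<open>The Hamiltonian and its symmetries\<close>

abbreviation layer_step :: "nat \<Rightarrow> real \<Rightarrow> real" where
  "layer_step m v \<equiv> v / (real m - 1)"

definition layer_energy :: "nat \<Rightarrow> real \<Rightarrow> nat \<Rightarrow> real" where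
  "layer_energy m v b = layer_step m v * (real (b + 1) - (real m + 1) / 2)"

lemma layer_energy_uminus: "layer_energy m (- v) b = - layer_energy m v b"
  by (simp add: layer_energy_def)

lemma layer_energy_reflect:
  assumes "b + b' + 1 = m"
  shows "layer_energy m v b' = - layer_energy m v b"
proof -
  have "real (b' + 1) - (real m + 1) / 2 = - (real (b + 1) - (real m + 1) / 2)"
    using assms by (auto simp: field_simps)
  thus ?thesis unfolding layer_energy_def by (simp only: mult_minus_right)
qed

lemma Hmat_carrier [simp]: "Hmat m \<gamma> v \<kappa> \<in> carrier_mat (2*m) (2*m)"
  by (simp add: Hmat_def)

lemma Hmat_dims [simp]: "dim_row (Hmat m \<gamma> v \<kappa>) = 2*m" "dim_col (Hmat m \<gamma> v \<kappa>) = 2*m"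
  by (simp_all add: Hmat_def)

lemma Hmat_index:
  assumes "i < 2*m" "j < 2*m"
  shows "Hmat m \<gamma> v \<kappa> $$ (i,j) =
    (if i = j then complex_of_real (layer_energy m v (i div 2))
     else if j = i + 1 then (if even i then cnj \<kappa> else \<gamma>)
     else if i = j + 1 then (if even j then \<kappa> else \<gamma>) else 0)"
proof -
  obtain b a where i: "i = 2 * b + a" "a < 2" by (metis mult_div_mod_eq mod_less_divisor pos2)
  obtain b' a' where j: "j = 2 * b' + a'" "a' < 2" by (metis mult_div_mod_eq mod_less_divisor pos2)
  have a: "a = 0 \<or> a = 1" "a' = 0 \<or> a' = 1" using i j by auto
  have "Hmat m \<gamma> v \<kappa> $$ (i,j) = (if b = b' then (if a = a' then complex_of_real (layer_energy m v b)
        else if a = 0 then cnj \<kappa> else \<kappa>)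
     else if b' = b + 1 \<and> a = 1 \<and> a' = 0 then complex_of_real \<gamma>
     else if b = b' + 1 \<and> a = 0 \<and> a' = 1 then complex_of_real \<gamma> else 0)"
    using assms i j by (simp add: Hmat_def Let_def layer_energy_def)
  moreover have "i div 2 = b" using i by simp
  ultimately show ?thesis using a unfolding i(1) j(1) by (elim disjE; auto; presburger)
qed

lemma Hmat_hermitian: "hermitian (2*m) (Hmat m \<gamma> v \<kappa>)"
  by (auto simp: hermitian_iff_index Hmat_index)

definition flip_in_layer :: "nat \<Rightarrow> nat" where
  "flip_in_layer i = (if even i then i + 1 else i - 1)"

lemma index_involution_flip_in_layer: "index_involution (2*m) flip_in_layer"
  by (auto simp: index_involution_def flip_in_layer_def)

definition inplane :: "nat \<Rightarrow> complex \<Rightarrow> complex mat" where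
  "inplane m \<kappa> = pair_mat (2*m) flip_in_layer (\<lambda>_. 0) (\<lambda>i. if even i then cnj \<kappa> else \<kappa>)"

lemma inplane_carrier [simp]: "inplane m \<kappa> \<in> carrier_mat (2*m) (2*m)"
  by (simp add: inplane_def)

lemma inplane_dims [simp]: "dim_row (inplane m \<kappa>) = 2*m" "dim_col (inplane m \<kappa>) = 2*m"
  by (simp_all add: inplane_def)

lemma inplane_index:
  "i < 2*m \<Longrightarrow> j < 2*m \<Longrightarrow> inplane m \<kappa> $$ (i,j) =
     (if j = i + 1 \<and> even i then cnj \<kappa> else if i = j + 1 \<and> even j then \<kappa> else 0)"
  by (auto simp: inplane_def pair_mat_index flip_in_layer_def elim: oddE)

lemma inplane_hermitian: "hermitian (2*m) (inplane m \<kappa>)"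
  by (auto simp: hermitian_iff_index inplane_index)

lemma inplane_square: "inplane m \<kappa> * inplane m \<kappa> = (complex_of_real ((cmod \<kappa>)\<^sup>2)) \<cdot>\<^sub>m 1\<^sub>m (2*m)"
proof -
  have "inplane m \<kappa> * inplane m \<kappa> = pair_mat (2*m) flip_in_layer (\<lambda>_. complex_of_real ((cmod \<kappa>)\<^sup>2)) (\<lambda>_. 0)"
    unfolding inplane_def pair_mat_mult[OF index_involution_flip_in_layer]
    by (rule pair_mat_cong) (auto simp: flip_in_layer_def complex_norm_square mult.commute
        simp del: of_real_power)
  also have "\<dots> = (complex_of_real ((cmod \<kappa>)\<^sup>2)) \<cdot>\<^sub>m 1\<^sub>m (2*m)"
    by (rule eq_matI) (auto simp: pair_mat_index)
  finally show ?thesis .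
qed

lemma inplane_lincomb:
  "inplane m (complex_of_real x * d + complex_of_real y * d')
    = complex_of_real x \<cdot>\<^sub>m inplane m d + complex_of_real y \<cdot>\<^sub>m inplane m d'"
  by (rule eq_matI) (auto simp: inplane_index)

lemma inplane_smult: "inplane m (complex_of_real x * d) = complex_of_real x \<cdot>\<^sub>m inplane m d"
  by (rule eq_matI) (auto simp: inplane_index)

lemma Hmat_add: "Hmat m \<gamma> v (\<kappa> + d) = Hmat m \<gamma> v \<kappa> + inplane m d"
  by (rule eq_matI) (auto simp: inplane_index Hmat_index)

definition rotation_weight :: "nat \<Rightarrow> nat" where
  "rotation_weight a = (a + 1) div 2"

definition weight_mat :: "nat \<Rightarrow> complex mat" where
  "weight_mat m = real_diag (2*m) (\<lambda>a. real (rotation_weight a))"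

lemma weight_mat_carrier [simp]: "weight_mat m \<in> carrier_mat (2*m) (2*m)"
  by (simp add: weight_mat_def)

lemma rotation_weight_Suc: "rotation_weight (Suc a) = rotation_weight a + of_bool (even a)"
  unfolding rotation_weight_def by (auto elim!: evenE oddE)

lemma sum_rotation_weight: "(\<Sum>a<2*m. real (rotation_weight a)) = (real m)\<^sup>2"
  by (induction m) (auto simp: rotation_weight_def power2_eq_square algebra_simps)

lemma inplane_rotation_generator:
  "inplane m (\<i> * \<kappa>) = \<i> \<cdot>\<^sub>m (weight_mat m * Hmat m \<gamma> v \<kappa> - Hmat m \<gamma> v \<kappa> * weight_mat m)" (is "_ = \<i> \<cdot>\<^sub>m ?C")
proof (rule carrier_eq_matI[of _ "2*m" "2*m"])
  fix i j assume ij: "i < 2*m" "j < 2*m"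
  have "(\<i> \<cdot>\<^sub>m ?C) $$ (i,j) = \<i> * ?C $$ (i,j)"
    using ij by (intro index_smult_mat(1)) (auto simp: weight_mat_def)
  also have "?C $$ (i,j)
      = (complex_of_real (real (rotation_weight i)) - complex_of_real (real (rotation_weight j)))
        * Hmat m \<gamma> v \<kappa> $$ (i,j)"
    unfolding weight_mat_def by (rule mat_diag_commutator_index[OF Hmat_carrier ij])
  also have "\<i> * \<dots> = inplane m (\<i> * \<kappa>) $$ (i,j)"
    using ij by (auto simp: Hmat_index inplane_index rotation_weight_Suc)
  finally show "inplane m (\<i> * \<kappa>) $$ (i,j) = (\<i> \<cdot>\<^sub>m ?C) $$ (i,j)" by simp
qed auto

lemma Hmat_rotate:
  assumes "cmod c = 1"
  shows "Hmat m \<gamma> v (c * \<kappa>) = conj_mat (mat_diag (2*m) (\<lambda>a. c ^ rotation_weight a)) (Hmat m \<gamma> v \<kappa>)"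
    (is "_ = ?X")
proof (rule carrier_eq_matI[of _ "2*m" "2*m"])
  fix i j assume ij: "i < 2*m" "j < 2*m"
  have "c * cnj c = 1" using assms by (metis complex_norm_square of_real_1 power_one)
  hence cancel: "c ^ k * cnj c ^ k = 1" "c ^ k * (cnj c ^ k * z) = z" for k z
    by (simp_all flip: power_mult_distrib mult.assoc)
  show "Hmat m \<gamma> v (c * \<kappa>) $$ (i,j) = ?X $$ (i,j)"
    unfolding conj_mat_diag_index[OF Hmat_carrier ij] Hmat_index[OF ij]
    by (auto simp: rotation_weight_Suc cancel mult_ac)
qed simp_all

definition sign_diag :: "nat \<Rightarrow> complex mat" where
  "sign_diag m = mat_diag (2*m) (\<lambda>a. (-1) ^ a)"

lemma unitary_sign_diag: "unitary (2*m) (sign_diag m)"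
  unfolding sign_diag_def by (rule unitary_mat_diag) (simp add: norm_power)

lemma conj_sign_diag_diag_entry:
  assumes "X \<in> carrier_mat (2*m) (2*m)" "a < 2*m"
  shows "conj_mat (sign_diag m) X $$ (a,a) = X $$ (a,a)"
  using assms by (simp add: sign_diag_def conj_mat_diag_index flip: power_add mult_2)

lemma conj_sign_diag_inplane: "conj_mat (sign_diag m) (inplane m \<kappa>) = (-1) \<cdot>\<^sub>m inplane m \<kappa>"
  by (rule carrier_eq_matI[of _ "2*m" "2*m"]) (auto simp: sign_diag_def conj_mat_diag_index inplane_index)

lemma Hmat_uminus_voltage: "Hmat m \<gamma> (- v) 0 = conj_mat (sign_diag m) ((-1) \<cdot>\<^sub>m Hmat m \<gamma> v 0)"
  by (rule carrier_eq_matI[of _ "2*m" "2*m"])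
    (auto simp: sign_diag_def conj_mat_diag_index Hmat_index layer_energy_uminus simp flip: power_add)

lemma spectral_decomp_square_scalar:
  assumes "spectral_decomp n A U l" "A * A = complex_of_real (c\<^sup>2) \<cdot>\<^sub>m 1\<^sub>m n" "i < n"
  shows "\<bar>l i\<bar> = \<bar>c\<bar>"
proof -
  note U = spectral_decomp_unitary[OF assms(1)] and A = spectral_decomp_carrier[OF assms(1)]
  have "real_diag n l * real_diag n l = conj_mat (mat_adjoint U) (A * A)"
    using A unitary_carrier[OF U]
    by (simp add: conj_mat_mult[OF unitary_adjoint[OF U]] spectral_decomp_conj_adjoint[OF assms(1)]
        del: mat_diag_diag)
  also have "\<dots> = complex_of_real (c\<^sup>2) \<cdot>\<^sub>m 1\<^sub>m n"
    unfolding assms(2) using unitary_carrier[OF U]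
    by (simp add: conj_mat_smult[of _ n] conj_mat_one[OF unitary_adjoint[OF U]])
  finally have "complex_of_real (l i * l i) = complex_of_real (c\<^sup>2)"
    using assms(3) by (auto dest!: arg_cong[where f = "\<lambda>X. X $$ (i,i)"])
  hence "(l i)\<^sup>2 = c\<^sup>2" unfolding of_real_eq_iff power2_eq_square .
  thus ?thesis by (auto simp: power2_eq_iff)
qed

lemma inplane_spectral_decomp_abs:
  assumes "spectral_decomp (2*m) (inplane m \<kappa>) U l" "i < 2*m"
  shows "\<bar>l i\<bar> = cmod \<kappa>"
  using spectral_decomp_square_scalar[OF assms(1) inplane_square assms(2)] by simp

lemma spectral_gap_inplane:
  assumes "m > 0"
  shows "spectral_gap (inplane m \<kappa>) = cmod \<kappa>"
proof -
  obtain U l where decomp: "spectral_decomp (2*m) (inplane m \<kappa>) U l"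
    using hermitian_spectral_decomp[OF inplane_hermitian] by blast
  obtain i where "i < 2*m" "spectral_gap (inplane m \<kappa>) = \<bar>l i\<bar>"
    by (rule spectral_gap_attained[OF decomp]) (use assms in auto)
  thus ?thesis using inplane_spectral_decomp_abs[OF decomp] by simp
qed

lemma inplane_nonsingular:
  assumes "\<kappa> \<noteq> 0"
  shows "\<not> eigenvalue (inplane m \<kappa>) 0"
proof -
  obtain U l where decomp: "spectral_decomp (2*m) (inplane m \<kappa>) U l"
    using hermitian_spectral_decomp[OF inplane_hermitian] by blast
  have "0 \<notin> spectrum (inplane m \<kappa>)"
    unfolding spectrum_spectral_decomp[OF decomp] using inplane_spectral_decomp_abs[OF decomp] assms by force
  thus ?thesis by (simp add: spectrum_def)
qed

lemma neg_proj_inplane_diag: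
  assumes "\<kappa> \<noteq> 0" "a < 2*m"
  shows "neg_proj (inplane m \<kappa>) $$ (a,a) = 1/2"
proof -
  let ?P = "neg_proj (inplane m \<kappa>)"
  have P: "?P \<in> carrier_mat (2*m) (2*m)" by (rule neg_proj_carrier[OF inplane_hermitian])
  have "conj_mat (sign_diag m) ?P = neg_proj (complex_of_real (-1) \<cdot>\<^sub>m inplane m \<kappa>)"
    by (simp add: neg_proj_conj[OF inplane_hermitian unitary_sign_diag, symmetric] conj_sign_diag_inplane)
  also have "\<dots> = 1\<^sub>m (2*m) - ?P"
    by (rule neg_proj_smult_neg[OF inplane_hermitian inplane_nonsingular[OF assms(1)]]) simp
  finally have "?P $$ (a,a) = (1\<^sub>m (2*m) - ?P) $$ (a,a)"
    using conj_sign_diag_diag_entry[OF P assms(2)] by simp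
  thus ?thesis using assms(2) P by (simp add: eq_diff_eq field_simps)
qed

section \<open>The gap closes only at zero wave vector\<close>

definition unreduced_lower_hessenberg :: "nat \<Rightarrow> 'a::zero mat \<Rightarrow> bool" where
  "unreduced_lower_hessenberg n A \<longleftrightarrow> A \<in> carrier_mat n n
     \<and> (\<forall>i j. j < n \<longrightarrow> i + 1 < j \<longrightarrow> A $$ (i,j) = 0) \<and> (\<forall>i. i + 1 < n \<longrightarrow> A $$ (i,i+1) \<noteq> 0)"

lemma unreduced_lower_hessenberg_kernel_zero:
  fixes A :: "'a :: idom mat"
  assumes hess: "unreduced_lower_hessenberg n A" and w: "w \<in> carrier_vec n"
    and ker: "A *\<^sub>v w = 0\<^sub>v n" and first: "w $ 0 = 0"
  shows "w = 0\<^sub>v n"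
proof -
  have A: "A \<in> carrier_mat n n" using hess by (simp add: unreduced_lower_hessenberg_def)
  have "w $ i = 0" if "i < n" for i
    using that
  proof (induction i rule: less_induct)
    case (less i)
    show ?case
    proof (cases i)
      case (Suc k)
      have k: "k < n" using less.prems Suc by simp
      have "0 = (\<Sum>j<n. A $$ (k,j) * w $ j)"
        using ker mult_mat_vec_index_sum[OF A w k] k by simp
      also have "\<dots> = (\<Sum>j\<in>{i}. A $$ (k,j) * w $ j)"
      proof (intro sum.mono_neutral_right ballI)
        fix j assume "j \<in> {..<n} - {i}"
        hence "j < n" "j < i \<or> k + 1 < j" using Suc by auto
        thus "A $$ (k,j) * w $ j = 0" using less.IH hess by (auto simp: unreduced_lower_hessenberg_def)
      qed (use less.prems in auto)
      finally show ?thesis using hess less.prems Suc by (simp add: unreduced_lower_hessenberg_def)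
    qed (use first in simp)
  qed
  thus ?thesis using w by (intro eq_vecI) auto
qed

lemma unreduced_lower_hessenberg_kernel_line:
  fixes A :: "'a :: field mat"
  assumes hess: "unreduced_lower_hessenberg n A" and "n > 0"
    and w: "w \<in> carrier_vec n" "A *\<^sub>v w = 0\<^sub>v n" and y: "y \<in> carrier_vec n" "A *\<^sub>v y = 0\<^sub>v n"
  shows "y $ 0 \<cdot>\<^sub>v w = w $ 0 \<cdot>\<^sub>v y"
proof -
  have "A \<in> carrier_mat n n" using hess by (simp add: unreduced_lower_hessenberg_def)
  hence "A *\<^sub>v (y $ 0 \<cdot>\<^sub>v w - w $ 0 \<cdot>\<^sub>v y) = y $ 0 \<cdot>\<^sub>v 0\<^sub>v n - w $ 0 \<cdot>\<^sub>v 0\<^sub>v n"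
    using w y by (simp add: mult_minus_distrib_mat_vec[of _ n n] mult_mat_vec[of _ n n])
  also have "\<dots> = 0\<^sub>v n" by (intro eq_vecI) auto
  finally have "y $ 0 \<cdot>\<^sub>v w - w $ 0 \<cdot>\<^sub>v y = 0\<^sub>v n"
    by (rule unreduced_lower_hessenberg_kernel_zero[OF hess, rotated]) (use w y \<open>n > 0\<close> in simp_all)
  hence "(y $ 0 \<cdot>\<^sub>v w - w $ 0 \<cdot>\<^sub>v y) $ i = 0" if "i < n" for i using that by simp
  thus ?thesis using w y by (intro eq_vecI) auto
qed

definition reflect_vec :: "nat \<Rightarrow> complex vec \<Rightarrow> complex vec" where
  "reflect_vec n w = vec n (\<lambda>a. (-1) ^ a * cnj (w $ (n - 1 - a)))"

lemma Hmat_reflect_index: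
  assumes "a < 2*m" "j < 2*m"
  shows "Hmat m \<gamma> v \<kappa> $$ (2*m - 1 - a, 2*m - 1 - j) = - ((-1) ^ (a + j)) * cnj (Hmat m \<gamma> v \<kappa> $$ (a,j))"
proof -
  have reflected: "2*m - 1 - a < 2*m" "2*m - 1 - j < 2*m" using assms by auto
  have parity: "even (2*m - 1 - k) \<longleftrightarrow> odd k" if "k < 2*m" for k using that by auto
  have neighbours: "2*m - 1 - a = 2*m - 1 - j \<longleftrightarrow> a = j" "2*m - 1 - j = 2*m - 1 - a + 1 \<longleftrightarrow> a = j + 1"
    "2*m - 1 - a = 2*m - 1 - j + 1 \<longleftrightarrow> j = a + 1" using assms by auto
  have "a div 2 + (2*m - 1 - a) div 2 + 1 = m" using assms(1) by linarith
  note energy = layer_energy_reflect[OF this]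
  show ?thesis
    unfolding Hmat_index[OF reflected] Hmat_index[OF assms] neighbours energy parity[OF assms(1)]
      parity[OF assms(2)]
    by (auto simp flip: power_add mult_2)
qed

lemma Hmat_mult_reflect_vec:
  assumes w: "w \<in> carrier_vec (2*m)"
  shows "Hmat m \<gamma> v \<kappa> *\<^sub>v reflect_vec (2*m) w = - reflect_vec (2*m) (Hmat m \<gamma> v \<kappa> *\<^sub>v w)"
proof (rule eq_vecI)
  define n where "n = 2 * m"
  let ?H = "Hmat m \<gamma> v \<kappa>"
  fix b assume "b < dim_vec (- reflect_vec (2*m) (?H *\<^sub>v w))"
  hence b: "b < n" by (simp add: reflect_vec_def n_def)
  define a where "a = n - 1 - b"
  have a: "a < n" "b = n - 1 - a" using b by (auto simp: a_def)
  have sign: "(-1 :: complex) ^ (n - 1 - j) = - ((-1) ^ j)" if "j < n" for j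
    using that by (auto simp: n_def minus_one_power_iff)
  have "(?H *\<^sub>v reflect_vec n w) $ b = (\<Sum>j<n. ?H $$ (b,j) * reflect_vec n w $ j)"
    using b by (intro mult_mat_vec_index_sum) (auto simp: n_def reflect_vec_def)
  also have "\<dots> = (\<Sum>j<n. ?H $$ (b,n - 1 - j) * reflect_vec n w $ (n - 1 - j))"
    by (subst sum.nat_diff_reindex[symmetric]) simp
  also have "\<dots> = (\<Sum>j<n. (-1) ^ a * cnj (?H $$ (a,j) * w $ j))"
  proof (rule sum.cong[OF refl])
    fix j assume "j \<in> {..<n}"
    hence j: "j < n" by simp
    have "n - 1 - (n - 1 - j) = j" using j by simp
    hence "?H $$ (b,n - 1 - j) * reflect_vec n w $ (n - 1 - j)
        = ((-1) ^ j * (-1) ^ j) * ((-1) ^ a * cnj (?H $$ (a,j) * w $ j))"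
      using Hmat_reflect_index[of a m j \<gamma> v \<kappa>] a j sign[OF j]
      by (simp add: reflect_vec_def n_def power_add)
    thus "?H $$ (b,n - 1 - j) * reflect_vec n w $ (n - 1 - j) = (-1) ^ a * cnj (?H $$ (a,j) * w $ j)"
      by (simp flip: power_add mult_2)
  qed
  also have "\<dots> = (-1) ^ a * cnj ((?H *\<^sub>v w) $ a)"
    using mult_mat_vec_index_sum[OF Hmat_carrier w, of a] a
    by (simp add: n_def sum_distrib_left del: index_mult_mat_vec)
  also have "\<dots> = (- reflect_vec n (?H *\<^sub>v w)) $ b"
    using a sign[OF a(1)] by (simp add: reflect_vec_def n_def)
  finally show "(?H *\<^sub>v reflect_vec (2*m) w) $ b = (- reflect_vec (2*m) (?H *\<^sub>v w)) $ b" unfolding n_def .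
qed (simp add: reflect_vec_def)

text \<open>The antiunitary reflection squares to \<open>-1\<close>, so the kernel, being invariant, has even dimension;
  but the kernel of a tridiagonal matrix with non-zero off-diagonal entries is at most a line.\<close>

lemma Hmat_nonsingular:
  assumes "\<gamma> \<noteq> 0" "\<kappa> \<noteq> 0"
  shows "\<not> eigenvalue (Hmat m \<gamma> v \<kappa>) 0"
proof
  let ?H = "Hmat m \<gamma> v \<kappa>"
  have hess: "unreduced_lower_hessenberg (2*m) ?H"
    using assms by (simp add: unreduced_lower_hessenberg_def Hmat_index)
  assume "eigenvalue ?H 0"
  then obtain w where "w \<in> carrier_vec (2*m)" "w \<noteq> 0\<^sub>v (2*m)" "?H *\<^sub>v w = 0 \<cdot>\<^sub>v w"
    by (auto simp: eigenvalue_def eigenvector_def)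
  moreover from this have "0 \<cdot>\<^sub>v w = 0\<^sub>v (2*m)" by auto
  ultimately have w: "w \<in> carrier_vec (2*m)" "w \<noteq> 0\<^sub>v (2*m)" "?H *\<^sub>v w = 0\<^sub>v (2*m)" by auto
  have "w = 0\<^sub>v (2*m)" if "m = 0" using w(1) that by (intro eq_vecI) auto
  hence m: "m > 0" using w(2) by blast
  define y where "y = reflect_vec (2*m) w"
  have y: "y \<in> carrier_vec (2*m)" by (simp add: y_def reflect_vec_def)
  have "?H *\<^sub>v y = 0\<^sub>v (2*m)"
    unfolding y_def Hmat_mult_reflect_vec[OF w(1)] w(3) by (auto simp: reflect_vec_def)
  with w y m have "y $ 0 \<cdot>\<^sub>v w = w $ 0 \<cdot>\<^sub>v y"
    by (intro unreduced_lower_hessenberg_kernel_line[OF hess]) auto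
  hence "(y $ 0 \<cdot>\<^sub>v w) $ (2*m - 1) = (w $ 0 \<cdot>\<^sub>v y) $ (2*m - 1)" by simp
  hence "cnj (w $ (2*m - 1)) * w $ (2*m - 1) + w $ 0 * cnj (w $ 0) = 0"
    using w y m by (simp add: y_def reflect_vec_def minus_one_power_iff)
  hence "complex_of_real ((cmod (w $ (2*m - 1)))\<^sup>2 + (cmod (w $ 0))\<^sup>2) = complex_of_real 0"
    by (simp add: complex_norm_square mult.commute del: of_real_power)
  hence "(cmod (w $ (2*m - 1)))\<^sup>2 + (cmod (w $ 0))\<^sup>2 = 0" unfolding of_real_eq_iff .
  hence "w $ 0 = 0" by (simp add: add_nonneg_eq_0_iff)
  thus False using unreduced_lower_hessenberg_kernel_zero[OF hess w(1,3)] w(2) by blast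
qed

section \<open>The Chern integral as a boundary term\<close>

definition occupied_weight :: "nat \<Rightarrow> real \<Rightarrow> real \<Rightarrow> complex \<Rightarrow> real" where
  "occupied_weight m \<gamma> v \<kappa> = Re (mtrace (weight_mat m * neg_proj (Hmat m \<gamma> v \<kappa>)))"

lemma mtrace_weight_mat_mult:
  "X \<in> carrier_mat (2*m) (2*m) \<Longrightarrow>
    mtrace (weight_mat m * X) = (\<Sum>a<2*m. complex_of_real (real (rotation_weight a)) * X $$ (a,a))"
  unfolding weight_mat_def by (rule mtrace_mat_diag_mult)

lemma neg_proj_Hmat_carrier [simp]: "neg_proj (Hmat m \<gamma> v \<kappa>) \<in> carrier_mat (2*m) (2*m)"
  by (rule neg_proj_carrier[OF Hmat_hermitian])

lemma complex_of_real_occupied_weight: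
  "complex_of_real (occupied_weight m \<gamma> v \<kappa>) = mtrace (weight_mat m * neg_proj (Hmat m \<gamma> v \<kappa>))"
proof -
  have "cnj (neg_proj (Hmat m \<gamma> v \<kappa>) $$ (a,a)) = neg_proj (Hmat m \<gamma> v \<kappa>) $$ (a,a)" if "a < 2*m" for a
    using neg_proj_hermitian[OF Hmat_hermitian] that by (simp add: hermitian_iff_index)
  hence "cnj (mtrace (weight_mat m * neg_proj (Hmat m \<gamma> v \<kappa>)))
      = mtrace (weight_mat m * neg_proj (Hmat m \<gamma> v \<kappa>))"
    by (simp add: mtrace_weight_mat_mult)
  thus ?thesis by (simp add: occupied_weight_def complex_eq_iff)
qed

lemma occupied_weight_rotate:
  assumes "cmod c = 1"
  shows "occupied_weight m \<gamma> v (c * \<kappa>) = occupied_weight m \<gamma> v \<kappa>"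
proof -
  let ?R = "mat_diag (2*m) (\<lambda>a. c ^ rotation_weight a)"
  have R: "unitary (2*m) ?R" using assms by (intro unitary_mat_diag) (simp add: norm_power)
  have "c * cnj c = 1" using assms by (metis complex_norm_square of_real_1 power_one)
  hence phase: "c ^ k * cnj (c ^ k) = 1" for k by (simp flip: power_mult_distrib)
  have "neg_proj (Hmat m \<gamma> v (c * \<kappa>)) $$ (a,a) = neg_proj (Hmat m \<gamma> v \<kappa>) $$ (a,a)" if a: "a < 2*m" for a
    unfolding Hmat_rotate[OF assms] neg_proj_conj[OF Hmat_hermitian R]
      conj_mat_diag_index[OF neg_proj_Hmat_carrier a a]
    using phase[of "rotation_weight a"] by (simp add: mult.commute mult.left_commute)
  thus ?thesis by (simp add: occupied_weight_def mtrace_weight_mat_mult)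
qed

lemma cmod_mtrace_weight_mat_mult_le:
  assumes "X \<in> carrier_mat (2*m) (2*m)" "\<And>a. a < 2*m \<Longrightarrow> cmod (X $$ (a,a)) \<le> C"
  shows "cmod (mtrace (weight_mat m * X)) \<le> (real m)\<^sup>2 * C"
proof -
  have "cmod (mtrace (weight_mat m * X)) \<le> (\<Sum>a<2*m. real (rotation_weight a) * C)"
    unfolding mtrace_weight_mat_mult[OF assms(1)]
    using assms(2) by (intro sum_norm_le) (auto simp: norm_mult intro!: mult_left_mono)
  thus ?thesis by (simp add: sum_rotation_weight flip: sum_distrib_right)
qed

locale gapped_hamiltonian =
  fixes m :: nat and \<gamma> v :: real
  assumes m_pos: "m > 0" and gamma: "\<gamma> \<noteq> 0" and gap_at_0: "\<not> eigenvalue (Hmat m \<gamma> v 0) 0"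
begin

abbreviation H :: "complex \<Rightarrow> complex mat" where
  "H \<equiv> Hmat m \<gamma> v"

abbreviation G :: "real \<Rightarrow> real" where
  "G r \<equiv> occupied_weight m \<gamma> v (complex_of_real r)"

abbreviation dP :: "complex \<Rightarrow> complex \<Rightarrow> complex mat" where
  "dP \<kappa> d \<equiv> neg_proj_deriv (2*m) (H \<kappa>) (inplane m d)"

lemma nonsingular: "\<not> eigenvalue (H \<kappa>) 0"
  using gap_at_0 Hmat_nonsingular[OF gamma] by (cases "\<kappa> = 0") auto

lemma gap_pos: "spectral_gap (H \<kappa>) > 0"
  using m_pos by (intro spectral_gap_pos[OF Hmat_hermitian _ nonsingular]) simp

lemma continuous_on_gap: "continuous_on S (\<lambda>r. spectral_gap (H (complex_of_real r)))"
proof -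
  define K where "K = 2 * real m * entry_norm (inplane m 1)"
  have "K-lipschitz_on S (\<lambda>r. spectral_gap (H (complex_of_real r)))"
  proof (rule lipschitz_onI)
    fix r s :: real
    have "H (complex_of_real r) - H (complex_of_real s) = complex_of_real (r - s) \<cdot>\<^sub>m inplane m 1"
      by (rule eq_matI) (auto simp: Hmat_index inplane_index)
    hence "entry_norm (H (complex_of_real r) - H (complex_of_real s)) = \<bar>r - s\<bar> * entry_norm (inplane m 1)"
      by (simp only: entry_norm_smult norm_of_real)
    thus "dist (spectral_gap (H (complex_of_real r))) (spectral_gap (H (complex_of_real s))) \<le> K * dist r s"
      using spectral_gap_lipschitz[OF Hmat_hermitian Hmat_hermitian,
          of m \<gamma> v "complex_of_real r" \<gamma> v "complex_of_real s"] m_pos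
      by (simp add: dist_real_def K_def mult_ac)
  qed (simp add: K_def)
  thus ?thesis by (rule lipschitz_on_continuous_on)
qed

lemma gap_lower_bound_far: "r - 2 * real m * entry_norm (H 0) \<le> spectral_gap (H (complex_of_real r))"
proof -
  have "inplane m (complex_of_real r) - H (complex_of_real r) = (-1) \<cdot>\<^sub>m H 0"
    by (rule eq_matI) (auto simp: Hmat_index inplane_index)
  hence "entry_norm (inplane m (complex_of_real r) - H (complex_of_real r)) = entry_norm (H 0)"
    by (simp add: entry_norm_smult)
  thus ?thesis
    using spectral_gap_perturbation[OF inplane_hermitian Hmat_hermitian,
        of m "complex_of_real r" \<gamma> v "complex_of_real r"]
      m_pos abs_ge_self[of r] by (simp add: spectral_gap_inplane)
qed

lemma gap_linear_lower_bound:
  obtains c where "c > 0" "\<And>r. r \<ge> 0 \<Longrightarrow> c * (1 + r) \<le> spectral_gap (H (complex_of_real r))"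
proof -
  define gap where "gap r = spectral_gap (H (complex_of_real r))" for r
  define K where "K = 2 * real m * entry_norm (H 0)"
  define R where "R = 2 * K + 1"
  have R: "R \<ge> 1" by (simp add: R_def K_def)
  have "continuous_on {0..R} (\<lambda>r. gap r / (1 + r))"
    unfolding gap_def by (intro continuous_intros continuous_on_gap) auto
  then obtain s where s: "s \<in> {0..R}" "\<And>r. r \<in> {0..R} \<Longrightarrow> gap s / (1 + s) \<le> gap r / (1 + r)"
    using continuous_attains_inf[of "{0..R}" "\<lambda>r. gap r / (1 + r)"] R by auto
  define c where "c = min (gap s / (1 + s)) (1/4)"
  have "c > 0" using gap_pos s(1) by (simp add: c_def gap_def)
  moreover have "c * (1 + r) \<le> gap r" if r: "r \<ge> 0" for r
  proof (cases "r \<le> R")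
    case True
    have "c \<le> gap r / (1 + r)" using s(2)[of r] r True by (simp add: c_def min_le_iff_disj)
    thus ?thesis using r by (simp add: pos_le_divide_eq)
  next
    case False
    have "c * (1 + r) \<le> 1/4 * (1 + r)"
      using r by (intro mult_right_mono) (simp_all only: c_def min.cobounded2)
    also have "\<dots> \<le> r - K" using False R by (simp add: R_def field_simps)
    also have "\<dots> \<le> gap r" unfolding K_def gap_def by (rule gap_lower_bound_far)
    finally show ?thesis .
  qed
  ultimately show ?thesis using that unfolding gap_def by blast
qed

lemma neg_proj_H_has_derivative:
  assumes "a < 2*m" "b < 2*m"
  shows "((\<lambda>t. neg_proj (H (\<kappa> + complex_of_real t * d)) $$ (a,b))
      has_vector_derivative dP \<kappa> d $$ (a,b)) (at 0)"
  unfolding Hmat_add inplane_smult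
  by (rule neg_proj_has_derivative[OF Hmat_hermitian nonsingular inplane_hermitian assms])

lemma mat_dderiv_neg_proj_H: "mat_dderiv (2*m) (\<lambda>\<kappa>. neg_proj (H \<kappa>)) \<kappa> d = dP \<kappa> d"
  unfolding mat_dderiv_def neg_proj_deriv_def Hmat_add inplane_smult ..

lemma occupied_weight_has_derivative:
  "((\<lambda>t. complex_of_real (occupied_weight m \<gamma> v (\<kappa> + complex_of_real t * d)))
     has_vector_derivative mtrace (weight_mat m * dP \<kappa> d)) (at 0)"
  unfolding complex_of_real_occupied_weight mtrace_weight_mat_mult[OF neg_proj_Hmat_carrier]
    mtrace_weight_mat_mult[OF neg_proj_deriv_carrier]
  by (intro has_vector_derivative_sum has_vector_derivative_mult_right neg_proj_H_has_derivative) auto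

lemma G_has_derivative:
  "(G has_real_derivative Re (mtrace (weight_mat m * dP (complex_of_real r) 1))) (at r)"
proof -
  have "((\<lambda>t. complex_of_real (G (t + r)))
      has_vector_derivative mtrace (weight_mat m * dP (complex_of_real r) 1)) (at 0)"
    using occupied_weight_has_derivative[of "complex_of_real r" 1] by (simp add: add.commute)
  hence "((\<lambda>t. Re (complex_of_real (G (t + r)))) has_vector_derivative
      Re (mtrace (weight_mat m * dP (complex_of_real r) 1))) (at 0)"
    by (rule bounded_linear.has_vector_derivative[OF bounded_linear_Re])
  hence "((\<lambda>t. G (t + r)) has_real_derivative Re (mtrace (weight_mat m * dP (complex_of_real r) 1))) (at 0)"
    by (simp add: has_real_derivative_iff_has_vector_derivative)
  thus ?thesis using DERIV_shift[of G _ 0 r] by simp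
qed

lemma G_has_deriv: "(G has_real_derivative deriv G r) (at r)"
  using G_has_derivative DERIV_imp_deriv by metis

lemma mtrace_weight_radial_derivative:
  assumes "\<kappa> \<noteq> 0"
  shows "mtrace (weight_mat m * dP \<kappa> \<kappa>) = complex_of_real (cmod \<kappa> * deriv G (cmod \<kappa>))"
proof -
  have "occupied_weight m \<gamma> v (\<kappa> + complex_of_real t * \<kappa>) = G (cmod \<kappa> * (1 + t))" for t
  proof -
    have "\<kappa> + complex_of_real t * \<kappa> = sgn \<kappa> * complex_of_real (cmod \<kappa> * (1 + t))"
      using assms by (simp add: sgn_eq field_simps)
    thus ?thesis using assms by (simp add: occupied_weight_rotate norm_sgn del: of_real_mult)
  qed
  hence "((\<lambda>t. complex_of_real (G (cmod \<kappa> * (1 + t))))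
      has_vector_derivative mtrace (weight_mat m * dP \<kappa> \<kappa>)) (at 0)"
    using occupied_weight_has_derivative[of \<kappa> \<kappa>] by simp
  moreover have "((\<lambda>t. G (cmod \<kappa> * (1 + t))) has_real_derivative deriv G (cmod \<kappa>) * cmod \<kappa>) (at 0)"
  proof (rule DERIV_chain2[where f = G and g = "\<lambda>t. cmod \<kappa> * (1 + t)"])
    show "((\<lambda>t. cmod \<kappa> * (1 + t)) has_real_derivative cmod \<kappa>) (at 0)" by (auto intro!: derivative_eq_intros)
  qed (use G_has_deriv in simp)
  hence "((\<lambda>t. complex_of_real (G (cmod \<kappa> * (1 + t)))) has_vector_derivative
      complex_of_real (deriv G (cmod \<kappa>) * cmod \<kappa>)) (at 0)"
    unfolding has_real_derivative_iff_has_vector_derivative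
    by (rule bounded_linear.has_vector_derivative[OF bounded_linear_of_real])
  ultimately show ?thesis by (metis vector_derivative_unique_at mult.commute)
qed

lemma cmod_mtrace_weight_deriv_le:
  assumes "hermitian (2*m) B"
  shows "cmod (mtrace (weight_mat m * neg_proj_deriv (2*m) (H \<kappa>) B))
    \<le> (real m)\<^sup>2 * ((real (2*m))\<^sup>2 * (entry_norm B / spectral_gap (H \<kappa>)))"
  by (intro cmod_mtrace_weight_mat_mult_le neg_proj_deriv_carrier
      neg_proj_deriv_entry_bound[OF Hmat_hermitian nonsingular assms])

text \<open>The projector does not change when \<open>H r\<close> is scaled, so its derivative along \<open>inplane m r = H r - H 0\<close>
  is the one along \<open>- H 0\<close>, which has bounded norm.\<close>

lemma dP_radial: "dP (complex_of_real r) (complex_of_real r)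
    = (-1) \<cdot>\<^sub>m neg_proj_deriv (2*m) (H (complex_of_real r)) (H 0)"
proof -
  let ?H = "H (complex_of_real r)"
  have "inplane m (complex_of_real r) = complex_of_real 1 \<cdot>\<^sub>m ?H + complex_of_real (-1) \<cdot>\<^sub>m H 0"
    by (rule eq_matI) (auto simp: Hmat_index inplane_index)
  thus ?thesis
    using neg_proj_deriv_lincomb[OF Hmat_hermitian nonsingular Hmat_hermitian Hmat_hermitian,
        where x = 1 and y = "-1"]
    by (simp add: neg_proj_deriv_self[OF Hmat_hermitian nonsingular])
qed

lemma abs_deriv_G_le:
  "\<bar>deriv G r\<bar>
    \<le> (real m)\<^sup>2 * ((real (2*m))\<^sup>2 * (entry_norm (inplane m 1) / spectral_gap (H (complex_of_real r))))"
proof -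
  have "deriv G r = Re (mtrace (weight_mat m * dP (complex_of_real r) 1))"
    using G_has_derivative by (rule DERIV_imp_deriv)
  thus ?thesis
    using cmod_mtrace_weight_deriv_le[OF inplane_hermitian] abs_Re_le_cmod order.trans by metis
qed

lemma radial_abs_deriv_G_le:
  assumes "r \<ge> 0"
  shows "r * \<bar>deriv G r\<bar>
    \<le> (real m)\<^sup>2 * ((real (2*m))\<^sup>2 * (entry_norm (H 0) / spectral_gap (H (complex_of_real r))))"
proof (cases "r = 0")
  case True
  thus ?thesis using gap_pos[of 0] by simp
next
  case False
  hence "r * \<bar>deriv G r\<bar> = cmod (mtrace (weight_mat m * dP (complex_of_real r) (complex_of_real r)))"
    using mtrace_weight_radial_derivative[of "complex_of_real r"] assms
    by (simp add: norm_mult abs_mult del: of_real_mult)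
  also have "\<dots> = cmod (mtrace (weight_mat m * neg_proj_deriv (2*m) (H (complex_of_real r)) (H 0)))"
    unfolding dP_radial
    by (simp add: mult_smult_distrib[of _ "2*m" "2*m" _ "2*m"] mtrace_smult[of _ "2*m"] norm_mult)
  also have "\<dots> \<le> (real m)\<^sup>2 * ((real (2*m))\<^sup>2 * (entry_norm (H 0) / spectral_gap (H (complex_of_real r))))"
    by (rule cmod_mtrace_weight_deriv_le[OF Hmat_hermitian])
  finally show ?thesis .
qed

lemma deriv_G_bound:
  obtains C where "\<And>r. r \<ge> 0 \<Longrightarrow> \<bar>deriv G r\<bar> * (1 + r\<^sup>2) \<le> C"
proof -
  obtain c where c: "c > 0" "\<And>r. r \<ge> 0 \<Longrightarrow> c * (1 + r) \<le> spectral_gap (H (complex_of_real r))"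
    using gap_linear_lower_bound by blast
  define K where "K = (real m)\<^sup>2 * ((real (2*m))\<^sup>2 * (entry_norm (inplane m 1) + entry_norm (H 0)))"
  have "\<bar>deriv G r\<bar> * (1 + r\<^sup>2) \<le> K / c" if r: "r \<ge> 0" for r
  proof -
    have "\<bar>deriv G r\<bar> * (1 + r\<^sup>2) \<le> (1 + r) * (\<bar>deriv G r\<bar> + r * \<bar>deriv G r\<bar>)"
      using r by (simp add: power2_eq_square algebra_simps)
    also have "\<dots> \<le> (1 + r) * (K / spectral_gap (H (complex_of_real r)))"
      using add_mono[OF abs_deriv_G_le radial_abs_deriv_G_le[OF r]] r
      by (intro mult_left_mono) (simp_all add: K_def distrib_left add_divide_distrib)
    also have "\<dots> \<le> (1 + r) * (K / (c * (1 + r)))"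
      using c r by (intro mult_left_mono divide_left_mono) (auto simp: K_def gap_pos)
    also have "\<dots> = K / c" using r by simp
    finally show ?thesis .
  qed
  thus ?thesis using that by blast
qed

lemma neg_proj_H_diag_tendsto:
  assumes a: "a < 2*m"
  shows "((\<lambda>r. neg_proj (H (complex_of_real r)) $$ (a,a)) \<longlongrightarrow> 1/2) at_top"
proof -
  define C where "C = real (2*m) ^ 3 * entry_norm (H 0)"
  have "cmod (neg_proj (H (complex_of_real r)) $$ (a,a) - 1/2) \<le> C * inverse r" if r: "r > 0" for r
  proof -
    define B where "B = inplane m 1 + complex_of_real (inverse r) \<cdot>\<^sub>m H 0"
    have B: "hermitian (2*m) B"
      unfolding B_def by (rule hermitian_add_smult[OF inplane_hermitian Hmat_hermitian])
    have "H (complex_of_real r) = complex_of_real r \<cdot>\<^sub>m B"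
      using r by (intro eq_matI) (auto simp: B_def Hmat_index inplane_index)
    hence "neg_proj (H (complex_of_real r)) = neg_proj B" using neg_proj_smult_pos[OF B r] by simp
    hence "cmod (neg_proj (H (complex_of_real r)) $$ (a,a) - 1/2)
        = cmod (neg_proj B $$ (a,a) - neg_proj (inplane m 1) $$ (a,a))"
      using a by (simp add: neg_proj_inplane_diag)
    also have "\<dots> \<le> real (2*m) ^ 3 * (entry_norm (inplane m 1 - B) / spectral_gap (inplane m 1))"
      using m_pos by (intro neg_proj_lipschitz inplane_hermitian B a) (simp add: spectral_gap_inplane)
    also have "inplane m 1 - B = complex_of_real (- inverse r) \<cdot>\<^sub>m H 0"
      by (rule eq_matI) (auto simp: B_def)
    finally show ?thesis
      using r m_pos by (simp add: C_def spectral_gap_inplane entry_norm_smult norm_divide field_simps)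
  qed
  hence "\<forall>\<^sub>F r in at_top. cmod (neg_proj (H (complex_of_real r)) $$ (a,a) - 1/2) \<le> C * inverse r"
    by (intro eventually_mono[OF eventually_gt_at_top[of 0]]) auto
  moreover have "((\<lambda>r. C * inverse r) \<longlongrightarrow> 0) at_top"
    by (intro tendsto_mult_right_zero tendsto_inverse_0_at_top filterlim_ident)
  ultimately have "((\<lambda>r. neg_proj (H (complex_of_real r)) $$ (a,a) - 1/2) \<longlongrightarrow> 0) at_top"
    by (rule Lim_null_comparison)
  thus ?thesis by (simp add: LIM_zero_iff)
qed

lemma G_tendsto: "(G \<longlongrightarrow> (real m)\<^sup>2 / 2) at_top"
proof -
  have "(G \<longlongrightarrow> Re (\<Sum>a<2*m. complex_of_real (real (rotation_weight a)) * (1/2))) at_top"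
    unfolding occupied_weight_def mtrace_weight_mat_mult[OF neg_proj_Hmat_carrier]
    by (intro tendsto_intros neg_proj_H_diag_tendsto) auto
  also have "Re (\<Sum>a<2*m. complex_of_real (real (rotation_weight a)) * (1/2)) = (real m)\<^sup>2 / 2"
    by (simp add: sum_rotation_weight flip: sum_divide_distrib)
  finally show ?thesis .
qed

lemma dP_lincomb:
  "dP \<kappa> (complex_of_real x * a + complex_of_real y * b)
    = complex_of_real x \<cdot>\<^sub>m dP \<kappa> a + complex_of_real y \<cdot>\<^sub>m dP \<kappa> b"
  unfolding inplane_lincomb
  by (rule neg_proj_deriv_lincomb[OF Hmat_hermitian nonsingular inplane_hermitian inplane_hermitian])

lemma dP_angular:
  "dP \<kappa> (\<i> * \<kappa>) = \<i> \<cdot>\<^sub>m (weight_mat m * neg_proj (H \<kappa>) - neg_proj (H \<kappa>) * weight_mat m)"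
  by (rule neg_proj_deriv_commutator[OF Hmat_hermitian nonsingular inplane_hermitian
        weight_mat_carrier inplane_rotation_generator])

lemma curvature_polar:
  "complex_of_real ((cmod \<kappa>)\<^sup>2) \<cdot>\<^sub>m (dP \<kappa> 1 * dP \<kappa> \<i> - dP \<kappa> \<i> * dP \<kappa> 1)
    = dP \<kappa> \<kappa> * dP \<kappa> (\<i> * \<kappa>) - dP \<kappa> (\<i> * \<kappa>) * dP \<kappa> \<kappa>"
proof -
  have "\<kappa> = complex_of_real (Re \<kappa>) * 1 + complex_of_real (Im \<kappa>) * \<i>"
    and "\<i> * \<kappa> = complex_of_real (- Im \<kappa>) * 1 + complex_of_real (Re \<kappa>) * \<i>"
    by (simp_all add: complex_eq_iff)
  hence "dP \<kappa> \<kappa> = complex_of_real (Re \<kappa>) \<cdot>\<^sub>m dP \<kappa> 1 + complex_of_real (Im \<kappa>) \<cdot>\<^sub>m dP \<kappa> \<i>"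
    and "dP \<kappa> (\<i> * \<kappa>) = - complex_of_real (Im \<kappa>) \<cdot>\<^sub>m dP \<kappa> 1 + complex_of_real (Re \<kappa>) \<cdot>\<^sub>m dP \<kappa> \<i>"
    by (metis dP_lincomb, metis dP_lincomb of_real_minus)
  thus ?thesis
    by (simp only: cmod_power2 of_real_add of_real_power commutator_rotation[of _ "2*m"]
        neg_proj_deriv_carrier)
qed

lemma mtrace_curvature:
  assumes "\<kappa> \<noteq> 0"
  shows "mtrace (neg_proj (H \<kappa>) * (dP \<kappa> 1 * dP \<kappa> \<i> - dP \<kappa> \<i> * dP \<kappa> 1))
    = \<i> * complex_of_real (deriv G (cmod \<kappa>) / cmod \<kappa>)"
proof -
  let ?P = "neg_proj (H \<kappa>)" and ?N = "weight_mat m"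
  let ?F = "dP \<kappa> 1 * dP \<kappa> \<i> - dP \<kappa> \<i> * dP \<kappa> 1"
  define S where "S = dP \<kappa> \<kappa>"
  define T where "T = ?N * ?P - ?P * ?N"
  have carrier: "S \<in> carrier_mat (2*m) (2*m)" "T \<in> carrier_mat (2*m) (2*m)"
    by (auto simp: S_def T_def)
  have "complex_of_real ((cmod \<kappa>)\<^sup>2) \<cdot>\<^sub>m ?F = S * (\<i> \<cdot>\<^sub>m T) - (\<i> \<cdot>\<^sub>m T) * S"
    unfolding curvature_polar dP_angular S_def T_def ..
  also have "\<dots> = \<i> \<cdot>\<^sub>m (S * T - T * S)"
    using carrier by (intro eq_matI) (auto simp: mult_smult_distrib[of _ "2*m" "2*m" _ "2*m"]
        mult_smult_assoc_mat[of _ "2*m" "2*m" _ "2*m"] algebra_simps simp del: index_mult_mat(1))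
  finally have "complex_of_real ((cmod \<kappa>)\<^sup>2) * mtrace (?P * ?F) = \<i> * mtrace (?P * (S * T - T * S))"
    using carrier by (simp flip: mtrace_smult[of _ "2*m"] mult_smult_distrib[of _ "2*m" "2*m" _ "2*m"])
  also have "\<dots> = \<i> * mtrace (?N * S)"
    unfolding T_def using carrier
    by (subst mtrace_projector_commutator[where n = "2*m"])
      (auto simp: S_def neg_proj_idem[OF Hmat_hermitian]
        neg_proj_deriv_tangent[OF Hmat_hermitian nonsingular inplane_hermitian])
  also have "\<dots> = \<i> * complex_of_real (cmod \<kappa> * deriv G (cmod \<kappa>))"
    unfolding S_def mtrace_weight_radial_derivative[OF assms] ..
  finally show ?thesis using assms by (simp add: power2_eq_square field_simps)
qed

theorem chern_eq: "chern (2*m) (\<lambda>\<kappa>. neg_proj (H \<kappa>)) = complex_of_real (G 0 - (real m)\<^sup>2 / 2)"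
proof -
  define F where "F \<kappa> = mtrace (neg_proj (H \<kappa>) * (dP \<kappa> 1 * dP \<kappa> \<i> - dP \<kappa> \<i> * dP \<kappa> 1))" for \<kappa>
  obtain C where C: "\<And>r. r \<ge> 0 \<Longrightarrow> \<bar>deriv G r\<bar> * (1 + r\<^sup>2) \<le> C" using deriv_G_bound by blast
  have "((\<lambda>\<kappa>::complex. deriv G (cmod \<kappa>) / cmod \<kappa>) has_integral 2 * pi * ((real m)\<^sup>2 / 2 - G 0)) UNIV"
    by (rule radial_derivative_has_integral[OF G_has_deriv C G_tendsto])
  hence "((\<lambda>\<kappa>::complex. \<i> * complex_of_real (deriv G (cmod \<kappa>) / cmod \<kappa>)) has_integral
      \<i> * complex_of_real (2 * pi * ((real m)\<^sup>2 / 2 - G 0))) UNIV"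
    by (intro has_integral_mult_right has_integral_of_real)
  hence "(F has_integral \<i> * complex_of_real (2 * pi * ((real m)\<^sup>2 / 2 - G 0))) UNIV"
    by (rule has_integral_spike[OF negligible_sing[of 0], rotated])
      (use mtrace_curvature in \<open>auto simp: F_def\<close>)
  hence "chern (2*m) (\<lambda>\<kappa>. neg_proj (H \<kappa>))
      = \<i> / (2 * complex_of_real pi) * (\<i> * complex_of_real (2 * pi * ((real m)\<^sup>2 / 2 - G 0)))"
    unfolding chern_def mat_dderiv_neg_proj_H F_def by (simp only: integral_unique)
  also have "\<dots> = complex_of_real (G 0 - (real m)\<^sup>2 / 2)" by (simp add: field_simps)
  finally show ?thesis .
qed

end

section \<open>The Hamiltonian at zero wave vector\<close>

text \<open>At zero wave vector only the interlayer bonds couple: they pair \<open>2 * p - 1\<close> with \<open>2 * p\<close> for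
  \<open>0 < p < m\<close>. The \<open>2 \<times> 2\<close> block of such a pair is a multiple of the identity plus a matrix that does
  not depend on \<open>p\<close>, so one rotation diagonalises all of them.\<close>

definition flip_bond :: "nat \<Rightarrow> nat \<Rightarrow> nat" where
  "flip_bond m i = (if i = 0 \<or> i = 2*m - 1 then i else if odd i then i + 1 else i - 1)"

lemma flip_bond_cases:
  assumes "i < 2*m"
  obtains "flip_bond m i = i"
    | "flip_bond m i < 2*m" "flip_bond m i \<noteq> i" "flip_bond m (flip_bond m i) = i"
      "odd (flip_bond m i) \<longleftrightarrow> even i" "rotation_weight (flip_bond m i) = rotation_weight i"
proof (cases "i = 0 \<or> i = 2*m - 1")
  case True
  thus ?thesis using that(1) by (auto simp: flip_bond_def)
next
  case inner: False
  show ?thesis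
  proof (cases "odd i")
    case True
    then obtain p where "i = 2*p + 1" by (rule oddE)
    moreover have "2*p + 2 \<noteq> 2*m - 1" by arith
    ultimately show ?thesis using inner assms that(2) by (auto simp: flip_bond_def rotation_weight_def)
  next
    case False
    then obtain q where q: "i = 2*q" by blast
    then obtain p where "q = Suc p" using inner by (cases q) auto
    moreover have "2*p + 1 \<noteq> 2*m - 1" using q calculation assms by simp
    ultimately show ?thesis using q inner assms that(2) by (auto simp: flip_bond_def rotation_weight_def)
  qed
qed

lemma index_involution_flip_bond: "index_involution (2*m) (flip_bond m)"
  unfolding index_involution_def
proof (intro allI impI)
  fix i assume i: "i < 2*m"
  thus "flip_bond m i < 2*m \<and> flip_bond m (flip_bond m i) = i"
    by (cases rule: flip_bond_cases) (use i in auto)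
qed

lemma Hmat_0_eq_pair_mat:
  "Hmat m \<gamma> v 0 = pair_mat (2*m) (flip_bond m) (\<lambda>i. complex_of_real (layer_energy m v (i div 2)))
     (\<lambda>i. if flip_bond m i = i then 0 else complex_of_real \<gamma>)" (is "_ = ?M")
proof (rule carrier_eq_matI[of _ "2*m" "2*m"])
  fix i j assume ij: "i < 2*m" "j < 2*m"
  define k where "k = 2*m - 1"
  have k: "odd k" "i \<le> k" "j \<le> k" using ij by (auto simp: k_def)
  show "Hmat m \<gamma> v 0 $$ (i,j) = ?M $$ (i,j)"
    unfolding Hmat_index[OF ij] pair_mat_index[OF ij] flip_bond_def k_def[symmetric] using k
    by (cases "odd i") auto
qed auto

definition bond_rotation :: "nat \<Rightarrow> real \<Rightarrow> real \<Rightarrow> complex mat" where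
  "bond_rotation m c s = pair_mat (2*m) (flip_bond m)
     (\<lambda>i. if flip_bond m i = i then 1 else complex_of_real c)
     (\<lambda>i. if flip_bond m i = i then 0 else if odd i then complex_of_real s else - complex_of_real s)"

lemma bond_rotation_carrier [simp]: "bond_rotation m c s \<in> carrier_mat (2*m) (2*m)"
  by (simp add: bond_rotation_def)

lemma unitary_bond_rotation:
  assumes "c\<^sup>2 + s\<^sup>2 = 1"
  shows "unitary (2*m) (bond_rotation m c s)"
proof -
  note inv = index_involution_flip_bond
  have unit: "complex_of_real c * complex_of_real c + complex_of_real s * complex_of_real s = 1"
    using assms by (simp add: power2_eq_square flip: of_real_mult of_real_add)
  have "mat_adjoint (bond_rotation m c s) * bond_rotation m c s
      = pair_mat (2*m) (flip_bond m) (\<lambda>_. 1) (\<lambda>_. 0)"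
    unfolding bond_rotation_def mat_adjoint_pair_mat[OF inv] pair_mat_mult[OF inv]
  proof (rule pair_mat_cong, goal_cases)
    case (1 i)
    thus ?case by (cases rule: flip_bond_cases) (auto simp: unit)
  next
    case (2 i)
    thus ?case by (cases rule: flip_bond_cases) auto
  qed
  also have "\<dots> = 1\<^sub>m (2*m)" by (simp flip: mat_diag_eq_pair_mat)
  finally show ?thesis by (simp add: unitary_def)
qed

lemma weight_mat_bond_rotation_commute:
  "weight_mat m * bond_rotation m c s = bond_rotation m c s * weight_mat m"
  unfolding weight_mat_def bond_rotation_def mat_diag_eq_pair_mat[where \<sigma> = "flip_bond m"]
    pair_mat_mult[OF index_involution_flip_bond]
proof (rule pair_mat_cong, goal_cases)
  case (2 i)
  thus ?case by (cases rule: flip_bond_cases) auto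
qed simp

lemma diagonalising_rotation:
  fixes a b :: real
  obtains c s where "c\<^sup>2 + s\<^sup>2 = 1"
    "a * c + b * s = sqrt (a\<^sup>2 + b\<^sup>2) * c" "b * c - a * s = sqrt (a\<^sup>2 + b\<^sup>2) * s"
proof -
  define \<rho> where "\<rho> = sqrt (a\<^sup>2 + b\<^sup>2)"
  define \<theta> where "\<theta> = Arg (Complex a b)"
  have "Complex a b = rcis \<rho> \<theta>" unfolding \<theta>_def \<rho>_def by (metis complex_norm rcis_cmod_Arg)
  hence ab: "a = \<rho> * cos \<theta>" "b = \<rho> * sin \<theta>" by (auto simp: rcis_def complex_eq_iff)
  have "a * cos (\<theta>/2) + b * sin (\<theta>/2) = \<rho> * cos (\<theta> - \<theta>/2)"
    unfolding ab cos_diff by (simp add: algebra_simps)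
  moreover have "b * cos (\<theta>/2) - a * sin (\<theta>/2) = \<rho> * sin (\<theta> - \<theta>/2)"
    unfolding ab sin_diff by (simp add: algebra_simps)
  ultimately show ?thesis using that[of "cos (\<theta>/2)" "sin (\<theta>/2)"] by (simp add: \<rho>_def)
qed

definition bond_eigenvalue :: "nat \<Rightarrow> real \<Rightarrow> real \<Rightarrow> nat \<Rightarrow> real" where
  "bond_eigenvalue m \<gamma> v k = (let \<Delta> = layer_step m v in
     if flip_bond m k = k then layer_energy m v (k div 2)
     else \<Delta> * (real (rotation_weight k) - real m / 2) + (if odd k then - 1 else 1) * sqrt ((\<Delta> / 2)\<^sup>2 + \<gamma>\<^sup>2))"

lemma layer_energy_eq_rotation_weight:
  "layer_energy m v (i div 2) = layer_step m v * (real (rotation_weight i) - real m / 2)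
     + (if odd i then - 1 else 1) * (layer_step m v / 2)"
proof -
  have "real (i div 2 + 1) - (real m + 1) / 2
      = (real (rotation_weight i) - real m / 2) + (if odd i then - 1 else 1) * (1 / 2)"
    by (auto simp: rotation_weight_def field_simps elim!: evenE oddE)
  thus ?thesis unfolding layer_energy_def by (simp only: distrib_left) simp
qed

lemma bond_eigenvalue_pair:
  assumes i: "i < 2*m" "flip_bond m i \<noteq> i"
    and cos: "layer_step m v / 2 * c + \<gamma> * s = sqrt ((layer_step m v / 2)\<^sup>2 + \<gamma>\<^sup>2) * c"
    and sin: "\<gamma> * c - layer_step m v / 2 * s = sqrt ((layer_step m v / 2)\<^sup>2 + \<gamma>\<^sup>2) * s"
  defines "\<epsilon> \<equiv> (if odd i then - 1 else 1)"
  shows "layer_energy m v (i div 2) * c + \<epsilon> * \<gamma> * s = bond_eigenvalue m \<gamma> v i * c"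
    and "\<gamma> * c - \<epsilon> * layer_energy m v (i div 2) * s = - (\<epsilon> * bond_eigenvalue m \<gamma> v (flip_bond m i) * s)"
proof -
  define \<Delta> where "\<Delta> = layer_step m v"
  define w where "w = \<Delta> * (real (rotation_weight i) - real m / 2)"
  define \<rho> where "\<rho> = sqrt ((\<Delta> / 2)\<^sup>2 + \<gamma>\<^sup>2)"
  have energy: "layer_energy m v (i div 2) = w + \<epsilon> * (\<Delta> / 2)"
    by (simp only: layer_energy_eq_rotation_weight \<Delta>_def w_def \<epsilon>_def)
  have eigenvalues: "bond_eigenvalue m \<gamma> v i = w + \<epsilon> * \<rho>"
      "bond_eigenvalue m \<gamma> v (flip_bond m i) = w - \<epsilon> * \<rho>"
    using i by (cases rule: flip_bond_cases;
        auto simp: bond_eigenvalue_def Let_def \<Delta>_def w_def \<rho>_def \<epsilon>_def)+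
  have "\<Delta> / 2 * c + \<gamma> * s = \<rho> * c" "\<gamma> * c - \<Delta> / 2 * s = \<rho> * s"
    using cos sin by (simp_all only: \<Delta>_def \<rho>_def)
  thus "layer_energy m v (i div 2) * c + \<epsilon> * \<gamma> * s = bond_eigenvalue m \<gamma> v i * c"
    and "\<gamma> * c - \<epsilon> * layer_energy m v (i div 2) * s = - (\<epsilon> * bond_eigenvalue m \<gamma> v (flip_bond m i) * s)"
    unfolding energy eigenvalues by (cases "odd i"; simp add: \<epsilon>_def algebra_simps)+
qed

lemma Hmat_0_spectral_decomp:
  obtains c s where "spectral_decomp (2*m) (Hmat m \<gamma> v 0) (bond_rotation m c s) (bond_eigenvalue m \<gamma> v)"
proof -
  obtain c s where unit: "c\<^sup>2 + s\<^sup>2 = 1"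
    and cos: "layer_step m v / 2 * c + \<gamma> * s = sqrt ((layer_step m v / 2)\<^sup>2 + \<gamma>\<^sup>2) * c"
    and sin: "\<gamma> * c - layer_step m v / 2 * s = sqrt ((layer_step m v / 2)\<^sup>2 + \<gamma>\<^sup>2) * s"
    by (rule diagonalising_rotation)
  note pair = bond_eigenvalue_pair[OF _ _ cos sin]
  let ?l = "bond_eigenvalue m \<gamma> v"
  have fixed: "layer_energy m v (i div 2) = ?l i" if "flip_bond m i = i" for i
    using that by (simp add: bond_eigenvalue_def Let_def)
  have "Hmat m \<gamma> v 0 * bond_rotation m c s = bond_rotation m c s * real_diag (2*m) ?l"
    unfolding Hmat_0_eq_pair_mat bond_rotation_def mat_diag_eq_pair_mat[where \<sigma> = "flip_bond m"]
      pair_mat_mult[OF index_involution_flip_bond]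
  proof (rule pair_mat_cong, goal_cases)
    case (1 i)
    thus ?case
      by (cases rule: flip_bond_cases)
        (use pair(1)[of i] 1 in \<open>auto simp: fixed
          simp flip: of_real_mult of_real_add of_real_diff of_real_minus\<close>)
  next
    case (2 i)
    thus ?case
      by (cases rule: flip_bond_cases)
        (use pair(2)[of i] 2 in \<open>auto simp: ac_simps
          simp flip: of_real_mult of_real_add of_real_diff of_real_minus\<close>)
  qed
  hence "spectral_decomp (2*m) (Hmat m \<gamma> v 0) (bond_rotation m c s) ?l"
    using unit by (intro spectral_decompI unitary_bond_rotation) auto
  thus ?thesis using that by blast
qed

lemma occupied_weight_0:
  "occupied_weight m \<gamma> v 0 = (\<Sum>k<2*m. real (rotation_weight k) * of_bool (bond_eigenvalue m \<gamma> v k < 0))"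
proof -
  obtain c s where decomp:
    "spectral_decomp (2*m) (Hmat m \<gamma> v 0) (bond_rotation m c s) (bond_eigenvalue m \<gamma> v)"
    by (rule Hmat_0_spectral_decomp)
  let ?U = "bond_rotation m c s" and ?D = "neg_diag (2*m) (bond_eigenvalue m \<gamma> v)"
  note U = spectral_decomp_unitary[OF decomp]
  have "weight_mat m * neg_proj (Hmat m \<gamma> v 0) = weight_mat m * ?U * (?D * mat_adjoint ?U)"
    unfolding neg_proj_eq[OF decomp] conj_mat_def
    by (simp add: assoc_mult_mat[of _ "2*m" "2*m" _ "2*m" _ "2*m"])
  also have "\<dots> = ?U * (weight_mat m * ?D) * mat_adjoint ?U"
    unfolding weight_mat_bond_rotation_commute by (simp add: assoc_mult_mat[of _ "2*m" "2*m" _ "2*m" _ "2*m"])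
  finally have "mtrace (weight_mat m * neg_proj (Hmat m \<gamma> v 0)) = mtrace (weight_mat m * ?D)"
    by (simp add: mtrace_conj_mat[OF U] flip: conj_mat_def)
  thus ?thesis unfolding occupied_weight_def by (simp add: mtrace_weight_mat_mult)
qed

section \<open>Counting phases\<close>

lemma bond_eigenvalue_outer:
  assumes "m \<ge> 2"
  shows "bond_eigenvalue m \<gamma> v 0 = - v / 2" "bond_eigenvalue m \<gamma> v (2*m - 1) = v / 2"
proof -
  have "(2*m - 1) div 2 = m - 1" by linarith
  thus "bond_eigenvalue m \<gamma> v 0 = - v / 2" "bond_eigenvalue m \<gamma> v (2*m - 1) = v / 2"
    using assms by (auto simp: bond_eigenvalue_def flip_bond_def layer_energy_def Let_def field_simps
        of_nat_diff)
qed

lemma bond_eigenvalue_inner: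
  assumes "m \<ge> 2" "v \<noteq> 0" "k \<noteq> 0" "k \<noteq> 2*m - 1"
  shows "bond_eigenvalue m \<gamma> v k = layer_step m v * (real (rotation_weight k) - real m / 2)
     + (if odd k then - 1 else 1) * (\<bar>layer_step m v\<bar> * delta m \<gamma> v)"
proof -
  define \<Delta> where "\<Delta> = layer_step m v"
  have "\<Delta>\<^sup>2 * (\<gamma>\<^sup>2 * (real m - 1)\<^sup>2 / v\<^sup>2) = \<gamma>\<^sup>2" using assms by (simp add: \<Delta>_def power_divide)
  hence "(\<Delta> / 2)\<^sup>2 + \<gamma>\<^sup>2 = \<Delta>\<^sup>2 * (\<gamma>\<^sup>2 * (real m - 1)\<^sup>2 / v\<^sup>2 + 1/4)"
    by (simp add: power_divide distrib_left)
  hence "sqrt ((\<Delta> / 2)\<^sup>2 + \<gamma>\<^sup>2) = \<bar>\<Delta>\<bar> * delta m \<gamma> v"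
    by (simp add: delta_def real_sqrt_mult)
  moreover have "flip_bond m k \<noteq> k" using assms(3,4) by (cases k) (auto simp: flip_bond_def)
  ultimately show ?thesis by (simp add: bond_eigenvalue_def Let_def \<Delta>_def)
qed

lemma bond_eigenvalue_nonzero:
  assumes m: "m \<ge> 2" and v: "v \<noteq> 0" and k: "k < 2*m"
    and gap: "\<And>p. 0 < p \<Longrightarrow> p < m \<Longrightarrow> \<bar>real p - real m / 2\<bar> \<noteq> delta m \<gamma> v"
  shows "bond_eigenvalue m \<gamma> v k \<noteq> 0"
proof (cases "k = 0 \<or> k = 2*m - 1")
  case True
  thus ?thesis using bond_eigenvalue_outer[OF m, of \<gamma> v] v by (elim disjE) simp_all
next
  case False
  define \<Delta> where "\<Delta> = layer_step m v"
  define x where "x = real (rotation_weight k) - real m / 2"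
  define y where "y = \<bar>\<Delta>\<bar> * delta m \<gamma> v"
  have \<Delta>: "\<Delta> \<noteq> 0" using v m by (simp add: \<Delta>_def)
  have "0 < rotation_weight k" "rotation_weight k < m"
    using k False unfolding rotation_weight_def by linarith+
  hence "\<bar>\<Delta> * x\<bar> \<noteq> y" using gap \<Delta> by (simp add: abs_mult x_def y_def)
  moreover have "y \<ge> 0" by (simp add: y_def delta_def)
  ultimately have "\<Delta> * x + y \<noteq> 0" "\<Delta> * x - y \<noteq> 0" by linarith+
  thus ?thesis
    using bond_eigenvalue_inner[OF m v, of k \<gamma>] False
    unfolding \<Delta>_def[symmetric] x_def[symmetric] y_def[symmetric]
    by (cases "odd k") simp_all
qed

lemma gapped_hamiltonianI:
  assumes "m \<ge> 2" "\<gamma> \<noteq> 0" "v \<noteq> 0"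
    "\<And>p. 0 < p \<Longrightarrow> p < m \<Longrightarrow> \<bar>real p - real m / 2\<bar> \<noteq> delta m \<gamma> v"
  shows "gapped_hamiltonian m \<gamma> v"
proof
  obtain c s where decomp:
    "spectral_decomp (2*m) (Hmat m \<gamma> v 0) (bond_rotation m c s) (bond_eigenvalue m \<gamma> v)"
    by (rule Hmat_0_spectral_decomp)
  have "0 \<notin> spectrum (Hmat m \<gamma> v 0)"
    unfolding spectrum_spectral_decomp[OF decomp]
    using bond_eigenvalue_nonzero[OF assms(1,3) _ assms(4)] by force
  thus "\<not> eigenvalue (Hmat m \<gamma> v 0) 0" by (simp add: spectrum_def)
qed (use assms in auto)

lemma sum_even_odd: "(\<Sum>k<2*m. f k) = (\<Sum>b<m. f (2*b)) + (\<Sum>b<m. f (2*b+1))"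
  for f :: "nat \<Rightarrow> 'a::comm_monoid_add"
  by (induction m) (auto simp: add_ac)

lemma sum_lessThan_real: "(\<Sum>b<n. real b) = real n * (real n - 1) / 2"
  by (induction n) (auto simp: field_simps)

lemma bond_eigenvalue_even_neg_iff:
  assumes m: "m \<ge> 2" and u: "u > 0" and b: "0 < b" "b < m"
  shows "bond_eigenvalue m \<gamma> u (2*b) < 0 \<longleftrightarrow> delta m \<gamma> u < real (m - b) - real m / 2"
proof -
  define \<Delta> where "\<Delta> = layer_step m u"
  have \<Delta>: "\<Delta> > 0" using u m by (simp add: \<Delta>_def)
  have "2*b \<noteq> 2*m - 1" using m by arith
  hence "bond_eigenvalue m \<gamma> u (2*b) = \<Delta> * (real b - real m / 2 + delta m \<gamma> u)"
    using bond_eigenvalue_inner[OF m, of u "2*b" \<gamma>] u b \<Delta> unfolding \<Delta>_def[symmetric]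
    by (simp add: rotation_weight_def distrib_left)
  thus ?thesis using \<Delta> b by (auto simp: mult_less_0_iff of_nat_diff)
qed

lemma bond_eigenvalue_odd_neg_iff:
  assumes m: "m \<ge> 2" and u: "u > 0" and b: "Suc b < m"
  shows "bond_eigenvalue m \<gamma> u (2*b + 1) < 0 \<longleftrightarrow> real (Suc b) - real m / 2 < delta m \<gamma> u"
proof -
  define \<Delta> where "\<Delta> = layer_step m u"
  have \<Delta>: "\<Delta> > 0" using u m by (simp add: \<Delta>_def)
  have "2*b + 1 \<noteq> 2*m - 1" using b by arith
  hence "bond_eigenvalue m \<gamma> u (2*b + 1) = \<Delta> * (real (Suc b) - real m / 2 - delta m \<gamma> u)"
    using bond_eigenvalue_inner[OF m, of u "2*b + 1" \<gamma>] u \<Delta> unfolding \<Delta>_def[symmetric]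
    by (simp add: rotation_weight_def right_diff_distrib)
  thus ?thesis using \<Delta> by (auto simp: mult_less_0_iff)
qed

lemma bond_eigenvalue_neg_iff_phase:
  assumes m: "m \<ge> 2" and u: "u > 0" and P: "P < m" and b: "b < m"
    and below: "\<And>p. p \<le> P \<Longrightarrow> real p - real m / 2 < delta m \<gamma> u"
    and above: "\<And>p. P < p \<Longrightarrow> p < m \<Longrightarrow> delta m \<gamma> u < real p - real m / 2"
  shows "0 < b \<Longrightarrow> bond_eigenvalue m \<gamma> u (2*b) < 0 \<longleftrightarrow> b < m - P"
    and "bond_eigenvalue m \<gamma> u (2*b + 1) < 0 \<longleftrightarrow> b < P"
proof -
  show "bond_eigenvalue m \<gamma> u (2*b) < 0 \<longleftrightarrow> b < m - P" if "0 < b"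
  proof -
    have "bond_eigenvalue m \<gamma> u (2*b) < 0 \<longleftrightarrow> delta m \<gamma> u < real (m - b) - real m / 2"
      by (rule bond_eigenvalue_even_neg_iff[OF m u that b])
    also have "\<dots> \<longleftrightarrow> P < m - b" using below[of "m - b"] above[of "m - b"] that b by (cases "P < m - b") auto
    also have "\<dots> \<longleftrightarrow> b < m - P" using b P by auto
    finally show ?thesis .
  qed
  show "bond_eigenvalue m \<gamma> u (2*b + 1) < 0 \<longleftrightarrow> b < P"
  proof (cases "Suc b = m")
    case True
    hence "2*b + 1 = 2*m - 1" by auto
    hence "bond_eigenvalue m \<gamma> u (2*b + 1) > 0" using bond_eigenvalue_outer(2)[OF m, of \<gamma> u] u by simp
    thus ?thesis using P True by auto
  next
    case False
    hence "bond_eigenvalue m \<gamma> u (2*b + 1) < 0 \<longleftrightarrow> real (Suc b) - real m / 2 < delta m \<gamma> u"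
      using b by (intro bond_eigenvalue_odd_neg_iff[OF m u]) auto
    also have "\<dots> \<longleftrightarrow> b < P" using below[of "Suc b"] above[of "Suc b"] b False by (cases "b < P") auto
    finally show ?thesis .
  qed
qed

lemma occupied_weight_0_phase:
  assumes m: "m \<ge> 2" and u: "u > 0" and P: "P < m"
    and below: "\<And>p. p \<le> P \<Longrightarrow> real p - real m / 2 < delta m \<gamma> u"
    and above: "\<And>p. P < p \<Longrightarrow> p < m \<Longrightarrow> delta m \<gamma> u < real p - real m / 2"
  shows "occupied_weight m \<gamma> u 0 = real P * (real P + 1) / 2 + (real m - real P - 1) * (real m - real P) / 2"
proof -
  let ?l = "bond_eigenvalue m \<gamma> u"
  note neg_iff = bond_eigenvalue_neg_iff_phase[OF m u P _ below above]
  have even_term: "real (rotation_weight (2*b)) * of_bool (?l (2*b) < 0) = of_bool (b < m - P) * real b"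
    if "b < m" for b
    using neg_iff(1)[OF that] by (cases "b = 0") (simp_all add: rotation_weight_def)
  have odd_term: "real (rotation_weight (2*b+1)) * of_bool (?l (2*b+1) < 0) = of_bool (b < P) * real (Suc b)"
    if "b < m" for b
    using neg_iff(2)[OF that] by (simp add: rotation_weight_def)
  have "occupied_weight m \<gamma> u 0
      = (\<Sum>b<m. of_bool (b < m - P) * real b) + (\<Sum>b<m. of_bool (b < P) * real (Suc b))"
    unfolding occupied_weight_0 sum_even_odd using even_term odd_term by simp
  also have "\<dots> = (\<Sum>b<m - P. real b) + (\<Sum>b<P. real (Suc b))"
  proof -
    have "{..<m} \<inter> {b. b < m - P} = {..<m - P}" "{..<m} \<inter> {b. b < P} = {..<P}" using P by auto
    thus ?thesis by (simp only: sum_of_bool_mult_eq finite_lessThan)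
  qed
  also have "(\<Sum>b<P. real (Suc b)) = (\<Sum>b<Suc P. real b)"
    by (simp add: sum.lessThan_Suc_shift del: sum.lessThan_Suc)
  finally show ?thesis using P by (simp add: sum_lessThan_real of_nat_diff field_simps)
qed

lemma occupied_weight_0_uminus:
  assumes "\<not> eigenvalue (Hmat m \<gamma> u 0) 0"
  shows "occupied_weight m \<gamma> (- u) 0 = (real m)\<^sup>2 - occupied_weight m \<gamma> u 0"
proof -
  let ?P = "neg_proj (Hmat m \<gamma> u 0)"
  have herm: "hermitian (2*m) (complex_of_real (-1) \<cdot>\<^sub>m Hmat m \<gamma> u 0)"
    using Hmat_hermitian[of m \<gamma> u 0] by (auto simp: hermitian_iff_index)
  have "neg_proj (Hmat m \<gamma> (- u) 0)
      = conj_mat (sign_diag m) (neg_proj (complex_of_real (-1) \<cdot>\<^sub>m Hmat m \<gamma> u 0))"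
    using neg_proj_conj[OF herm unitary_sign_diag] by (simp add: Hmat_uminus_voltage)
  also have "\<dots> = conj_mat (sign_diag m) (1\<^sub>m (2*m) - ?P)"
    by (subst neg_proj_smult_neg[OF Hmat_hermitian assms]) simp_all
  finally have flipped: "neg_proj (Hmat m \<gamma> (- u) 0) = conj_mat (sign_diag m) (1\<^sub>m (2*m) - ?P)" .
  have "neg_proj (Hmat m \<gamma> (- u) 0) $$ (a,a) = 1 - ?P $$ (a,a)" if "a < 2*m" for a
    unfolding flipped using that carrier_matD[OF neg_proj_Hmat_carrier, of m \<gamma> u 0]
    by (subst conj_sign_diag_diag_entry) auto
  thus ?thesis
    by (simp add: occupied_weight_def mtrace_weight_mat_mult right_diff_distrib sum_subtractf
        flip: sum_rotation_weight)
qed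

lemma delta_k_eq: "delta_k m j = real (j + (m + 1) div 2) - real m / 2"
proof -
  have "\<lceil>real m / 2\<rceil> = int ((m + 1) div 2)" by (rule ceiling_unique) linarith+
  thus ?thesis by (simp add: delta_k_def)
qed

lemma delta_k_nonneg: "delta_k m j \<ge> 0"
proof -
  have "real m / 2 \<le> real ((m + 1) div 2)" by linarith
  thus ?thesis by (simp add: delta_k_eq)
qed

lemma delta_gt_half:
  assumes "m \<ge> 2" "\<gamma> > 0" "u > 0"
  shows "delta m \<gamma> u > 1/2"
proof -
  have "sqrt ((1/2)\<^sup>2) < delta m \<gamma> u"
    unfolding delta_def using assms by (intro real_sqrt_less_mono) (simp add: power2_eq_square)
  thus ?thesis by simp
qed

definition in_phase :: "nat \<Rightarrow> nat \<Rightarrow> real \<Rightarrow> bool" where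
  "in_phase m j d \<longleftrightarrow> j < m div 2 \<and> delta_k m j < d \<and> (j + 1 < m div 2 \<longrightarrow> d < delta_k m (j + 1))"

lemma BDI_eq_BDI_val:
  assumes m: "m \<ge> 2" and \<gamma>: "\<gamma> > 0" and u: "u > 0" and phase: "in_phase m j (delta m \<gamma> u)"
  shows "BDI m \<gamma> u = complex_of_real (BDI_val m j)"
proof -
  define P where "P = j + (m + 1) div 2"
  have P: "P < m" using phase unfolding P_def in_phase_def by linarith
  have delta_j: "delta_k m j = real P - real m / 2" by (simp add: delta_k_eq P_def)
  have below: "real p - real m / 2 < delta m \<gamma> u" if "p \<le> P" for p
    using that phase delta_j unfolding in_phase_def by linarith
  have above: "delta m \<gamma> u < real p - real m / 2" if "P < p" "p < m" for p
  proof -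
    have "j + 1 < m div 2" using that unfolding P_def by linarith
    hence "delta m \<gamma> u < real (P + 1) - real m / 2" using phase by (simp add: in_phase_def delta_k_eq P_def)
    thus ?thesis using that by linarith
  qed
  have off: "real p - real m / 2 \<noteq> delta m \<gamma> u" if "p < m" for p
    using below[of p] above[of p] that by (cases "p \<le> P") auto
  have gap: "\<bar>real p - real m / 2\<bar> \<noteq> delta m \<gamma> u" if "0 < p" "p < m" for p
    using off[of p] off[of "m - p"] that by (auto simp: abs_if of_nat_diff)
  have "delta m \<gamma> (- u) = delta m \<gamma> u" by (simp add: delta_def)
  interpret N: gapped_hamiltonian m \<gamma> u using m \<gamma> u gap by (intro gapped_hamiltonianI) auto
  interpret S: gapped_hamiltonian m \<gamma> "- u"
    using m \<gamma> u gap \<open>delta m \<gamma> (- u) = delta m \<gamma> u\<close> by (intro gapped_hamiltonianI) auto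
  have "BDI m \<gamma> u = complex_of_real (occupied_weight m \<gamma> (- u) 0 - occupied_weight m \<gamma> u 0)"
    unfolding BDI_def N.chern_eq S.chern_eq by simp
  also have "occupied_weight m \<gamma> (- u) 0 - occupied_weight m \<gamma> u 0 = (real m)\<^sup>2 - 2 * occupied_weight m \<gamma> u 0"
    using occupied_weight_0_uminus[OF N.gap_at_0] by simp
  also have "\<dots> = (real m)\<^sup>2 - 2 * (real P * (real P + 1) / 2 + (real m - real P - 1) * (real m - real P) / 2)"
    using occupied_weight_0_phase[OF m u P below above] by simp
  also have "\<dots> = BDI_val m j" unfolding BDI_val_def delta_j by (simp add: power2_eq_square field_simps)
  finally show ?thesis .
qed

lemma in_phase_exists:
  assumes m: "m \<ge> 2" and d: "d > 1/2" "\<forall>k < m div 2. d \<noteq> delta_k m k"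
  shows "\<exists>j. in_phase m j d"
proof -
  define K where "K = {k. k < m div 2 \<and> delta_k m k < d}"
  have "2 * real ((m + 1) div 2) \<le> real m + 1" by linarith
  hence "delta_k m 0 \<le> 1/2" by (simp add: delta_k_eq)
  hence "0 \<in> K" using m d(1) by (simp add: K_def)
  moreover have fin: "finite K" by (simp add: K_def)
  ultimately have Max: "Max K \<in> K" by (intro Max_in) auto
  have "Max K + 1 \<notin> K" using Max_ge[OF fin, of "Max K + 1"] by auto
  hence "in_phase m (Max K) d" using Max d(2) by (force simp: in_phase_def K_def)
  thus ?thesis by blast
qed

lemma delta_attains:
  assumes "m \<ge> 2" "d > 1/2"
  obtains \<gamma> where "\<gamma> > 0" "delta m \<gamma> 1 = d"
proof
  define \<gamma> where "\<gamma> = sqrt (d\<^sup>2 - 1/4) / (real m - 1)"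
  have d: "d\<^sup>2 > 1/4" using assms(2) power_strict_mono[of "1/2" d 2] by (simp add: power2_eq_square)
  thus "\<gamma> > 0" using assms(1) by (simp add: \<gamma>_def)
  have "\<gamma>\<^sup>2 * (real m - 1)\<^sup>2 = d\<^sup>2 - 1/4" using d assms(1) by (simp add: \<gamma>_def power_divide)
  thus "delta m \<gamma> 1 = d" using assms(2) by (simp add: delta_def)
qed

lemma BDI_values:
  assumes m: "m \<ge> 2"
  shows "{BDI m \<gamma> u | \<gamma> u. \<gamma> > 0 \<and> u > 0 \<and> (\<forall>k < m div 2. delta m \<gamma> u \<noteq> delta_k m k)}
    = (\<lambda>j. complex_of_real (BDI_val m j)) ` {..<m div 2}" (is "?A = ?B")
proof
  show "?A \<subseteq> ?B"
  proof
    fix z assume "z \<in> ?A"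
    then obtain \<gamma> u where z: "z = BDI m \<gamma> u" and pos: "\<gamma> > 0" "u > 0"
      and off: "\<forall>k < m div 2. delta m \<gamma> u \<noteq> delta_k m k" by blast
    obtain j where phase: "in_phase m j (delta m \<gamma> u)"
      using in_phase_exists[OF m delta_gt_half[OF m pos] off] by blast
    show "z \<in> ?B" unfolding z BDI_eq_BDI_val[OF m pos phase] using phase by (auto simp: in_phase_def)
  qed
  show "?B \<subseteq> ?A"
  proof
    fix z assume "z \<in> ?B"
    then obtain j where j: "j < m div 2" and z: "z = complex_of_real (BDI_val m j)" by auto
    define d where "d = delta_k m j + 3/4"
    obtain \<gamma> where \<gamma>: "\<gamma> > 0" "delta m \<gamma> 1 = d"
      by (rule delta_attains[OF m, of d]) (use delta_k_nonneg[of m j] in \<open>auto simp: d_def\<close>)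
    have "in_phase m j d" using j by (simp add: in_phase_def d_def delta_k_eq)
    hence "BDI m \<gamma> 1 = z" using BDI_eq_BDI_val[OF m \<gamma>(1), of 1 j] \<gamma>(2) by (simp add: z)
    moreover have "d \<noteq> delta_k m k" for k
    proof
      assume "d = delta_k m k"
      hence "4 * j + 3 = 4 * k" unfolding d_def delta_k_eq by linarith
      thus False by presburger
    qed
    ultimately show "z \<in> ?A" using \<gamma> by (intro CollectI exI[of _ \<gamma>] exI[of _ 1]) auto
  qed
qed

lemma strict_antimono_BDI_val:
  assumes "i < j"
  shows "BDI_val m j < BDI_val m i"
proof -
  have "delta_k m i < delta_k m j" using assms by (simp add: delta_k_eq)
  hence "delta_k m i * (delta_k m i + 1) < delta_k m j * (delta_k m j + 1)"
    using delta_k_nonneg[of m i] by (intro mult_strict_mono) auto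
  thus ?thesis by (simp add: BDI_val_def)
qed

theorem theorem2p3:
  fixes m :: nat
  assumes "m \<ge> 2"
  shows "(\<forall>\<gamma> u j. \<gamma> > 0 \<longrightarrow> u > 0 \<longrightarrow> j < m div 2 \<longrightarrow>
            delta_k m j < delta m \<gamma> u \<longrightarrow>
            (j + 1 < m div 2 \<longrightarrow> delta m \<gamma> u < delta_k m (j + 1)) \<longrightarrow>
            BDI m \<gamma> u = complex_of_real (BDI_val m j))
       \<and> card {BDI m \<gamma> u | \<gamma> u. \<gamma> > 0 \<and> u > 0 \<and> (\<forall>k < m div 2. delta m \<gamma> u \<noteq> delta_k m k)}
           = m div 2"
proof
  show "\<forall>\<gamma> u j. \<gamma> > 0 \<longrightarrow> u > 0 \<longrightarrow> j < m div 2 \<longrightarrow>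
            delta_k m j < delta m \<gamma> u \<longrightarrow>
            (j + 1 < m div 2 \<longrightarrow> delta m \<gamma> u < delta_k m (j + 1)) \<longrightarrow>
            BDI m \<gamma> u = complex_of_real (BDI_val m j)"
    using BDI_eq_BDI_val[OF assms, unfolded in_phase_def] by blast
  have "inj_on (\<lambda>j. complex_of_real (BDI_val m j)) {..<m div 2}"
    by (intro linorder_inj_onI) (auto dest: strict_antimono_BDI_val[of _ _ m])
  thus "card {BDI m \<gamma> u | \<gamma> u. \<gamma> > 0 \<and> u > 0 \<and> (\<forall>k < m div 2. delta m \<gamma> u \<noteq> delta_k m k)} = m div 2"
    unfolding BDI_values[OF assms] by (simp add: card_image)
qed

end
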